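(* Let $j\ge1$, let $q:\mathbb{R}^2\to Y_{m,n}$ be a solution of the $(2j-1)$-th $\mathcal{G}_{m,n}$-flow with frame $F(x,t,\lambda)$, let $\pi$ be an $O(m+n+1,m+n)$-projection, $\alpha\in\mathbb{C}\setminus\{0\}$, and $\tilde V(x,t)=F(x,t,\alpha)^{-1}(\mathrm{Im}\,\pi)$. Assume there is an open neighborhood $\mathcal{O}$ of the origin in which the form $\langle\,,\rangle$ restricted to $\tilde V(x,t)$ is nondegenerate, and let $\tilde\pi(x,t)$ be the $O(m+n+1,m+n)$-projection onto $\tilde V(x,t)$. Then $$\tilde q=q+2\alpha\,[e_{2m+1,2m+2n+1},\tilde\pi]$$ is a solution of the $(2j-1)$-th $\mathcal{G}_{m,n}$-flow on $\mathcal{O}$, and $\tilde F(x,t,\lambda)=k_{\alpha,\pi}(\lambda)F(x,t,\lambda)k_{\alpha,\tilde\pi(x,t)}(\lambda)^{-1}$ is a frame of $\tilde q$.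
   Context: Setup: $m,n\ge0$, $N=2m+2n+1$; $C_{m,n}=\mathrm{diag}(\sum_{i=1}^{2m}e_{i,2m+1-i},\sum_{i=1}^{2n+1}(-1)^{n+i-1}e_{i,2n+2-i})$; $\sigma(Y)=(C_{m,n}Y^tC_{m,n}^{-1})^{-1}$, $\sigma_*(y)=-C_{m,n}y^tC_{m,n}^{-1}$. $\mathcal{G}_{m,n}$: formal series $\sum_{i\le i_0}\xi_i\lambda^i$, $\xi_i\in sl(N,\mathbb{C})$, $\sigma_*(\xi(-\lambda))=\xi(\lambda)$; $(\mathcal{G}_{m,n})_-$ those with only negative powers; $(G_{m,n})_-$: series $I+\sum_{i<0}g_i\lambda^i$ with $\sigma(g(-\lambda))=g(\lambda)$; $\xi_+$ = nonnegative-power part. $b=\sum_{i=1}^{2n}e_{i+1,i}$, $J_0(\lambda)=\lambda e_{1,2n+1}+b$, $J(\lambda)=\mathrm{diag}(0_{2m},J_0(\lambda))$; $Y_{m,n}=\{([J,g])_+: g\in(\mathcal{G}_{m,n})_-\}$. $S(q,\lambda)$: unique series with $S_x+[J+q,S]=0$, $S=gJg^{-1}$, $g$ valued in $(G_{m,n})_-$; $S^k=\sum_iS_{k,i}(q)\lambda^i$. The $(2j-1)$-th $\mathcal{G}_{m,n}$-flow is $q_t=S_{2j-1,0}(q)_x+[\mathrm{diag}(0_{2m},b)+q,S_{2j-1,0}(q)]$. A frame of $q$ is $F(x,t,\lambda)\in SL(N,\mathbb{C})$ with $F^{-1}F_x=J(\lambda)+q$, $F^{-1}F_t=(S(q,\lambda)^{2j-1})_+$,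 $\sigma(F(x,t,-\lambda))=F(x,t,\lambda)$. Bilinear form $\langle X,Y\rangle=X^tC_{m,n}Y$ on $\mathbb{C}^N$, adjoint $\sharp$; an $O(m+n+1,m+n)$-projection onto a nondegenerate subspace $V$ is $\pi$ with $\pi^2=\pi=\pi^\sharp$, image $V$; $\pi^\perp=I-\pi$; $k_{\alpha,\pi}(\lambda)=I+\frac{2\alpha}{\lambda-\alpha}\pi^\perp$. *)

theory Defs
  imports Complex_Main "HOL-Computational_Algebra.Formal_Laurent_Series"
    "Jordan_Normal_Form.Matrix" "Jordan_Normal_Form.Determinant"
begin

text \<open>Conventions.  Matrices are Jordan_Normal_Form matrices with 0-based indices; the
  paper's e_{i,j} is the matrix unit at (i-1,j-1).  N = 2m+2n+1.

  A formal series sum_{i <= i0} xi_i lambda^i with N x N matrix coefficients is encoded as an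
  N x N matrix of formal Laurent series in mu = 1/lambda (type complex fls, which has only
  finitely many negative powers of mu, i.e. finitely many positive powers of lambda).
  The coefficient of lambda^i is the coefficient of mu^(-i); see ser_coeff.\<close>

abbreviation NN :: "nat \<Rightarrow> nat \<Rightarrow> nat" where "NN m n \<equiv> 2*m + 2*n + 1"

definition minv :: "'a::comm_ring_1 mat \<Rightarrow> 'a mat" where
  "minv A = (THE B. B \<in> carrier_mat (dim_row A) (dim_row A) \<and> inverts_mat A B \<and> inverts_mat B A)"

definition mtrace :: "complex mat \<Rightarrow> complex" where
  "mtrace A = (\<Sum>i<dim_row A. A $$ (i,i))"

definition Cmat :: "nat \<Rightarrow> nat \<Rightarrow> complex mat" where
  "Cmat m n = mat (NN m n) (NN m n) (\<lambda>(r,c).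
     if r < 2*m then (if c = 2*m - 1 - r then 1 else 0)
     else (if 2*m \<le> c \<and> c = 2*m + 2*n - (r - 2*m) then (-1) ^ (n + (r - 2*m)) else 0))"

definition Cinv :: "nat \<Rightarrow> nat \<Rightarrow> complex mat" where
  "Cinv m n = minv (Cmat m n)"

definition bmat :: "nat \<Rightarrow> nat \<Rightarrow> complex mat" where
  "bmat m n = mat (NN m n) (NN m n) (\<lambda>(r,c). if 2*m \<le> c \<and> c < 2*m + 2*n \<and> r = c + 1 then 1 else 0)"

definition Emat :: "nat \<Rightarrow> nat \<Rightarrow> complex mat" where
  "Emat m n = mat (NN m n) (NN m n) (\<lambda>(r,c). if r = 2*m \<and> c = 2*m + 2*n then 1 else 0)"

definition Jmat :: "nat \<Rightarrow> nat \<Rightarrow> complex \<Rightarrow> complex mat" where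
  "Jmat m n lam = bmat m n + lam \<cdot>\<^sub>m Emat m n"

definition ser_coeff :: "complex fls mat \<Rightarrow> int \<Rightarrow> complex mat" where
  "ser_coeff X i = mat (dim_row X) (dim_col X) (\<lambda>(r,c). fls_nth (X $$ (r,c)) (- i))"

definition cser :: "complex mat \<Rightarrow> complex fls mat" where
  "cser A = map_mat fls_const A"

definition ser_neg :: "complex fls mat \<Rightarrow> complex fls mat" where
  "ser_neg X = map_mat (\<lambda>f. fls_compose_fps f (- fps_X)) X"

definition Jser :: "nat \<Rightarrow> nat \<Rightarrow> complex fls mat" where
  "Jser m n = cser (bmat m n) + fls_X_inv \<cdot>\<^sub>m cser (Emat m n)"

text \<open>The Lie algebra G_{m,n}: sl(N)-valued coefficients, sigma_*(xi(-lambda)) = xi(lambda)\<close>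
definition GLie :: "nat \<Rightarrow> nat \<Rightarrow> complex fls mat set" where
  "GLie m n = {xi. xi \<in> carrier_mat (NN m n) (NN m n) \<and>
      (\<forall>i. mtrace (ser_coeff xi i) = 0) \<and>
      - (cser (Cmat m n) * transpose_mat (ser_neg xi) * cser (Cinv m n)) = xi}"

definition GLie_minus :: "nat \<Rightarrow> nat \<Rightarrow> complex fls mat set" where
  "GLie_minus m n = {xi \<in> GLie m n. \<forall>i\<ge>0. ser_coeff xi i = 0\<^sub>m (NN m n) (NN m n)}"

text \<open>(G_{m,n})_- (group): I + sum_{i<0} g_i lambda^i with sigma(g(-lambda)) = g(lambda)\<close>
definition GGrp_minus :: "nat \<Rightarrow> nat \<Rightarrow> complex fls mat set" where
  "GGrp_minus m n = {g. g \<in> carrier_mat (NN m n) (NN m n) \<and>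
      ser_coeff g 0 = 1\<^sub>m (NN m n) \<and> (\<forall>i>0. ser_coeff g i = 0\<^sub>m (NN m n) (NN m n)) \<and>
      minv (cser (Cmat m n) * transpose_mat (ser_neg g) * cser (Cinv m n)) = g}"

text \<open>Y_{m,n} = { ([J,g])_+ : g in (G_{m,n})_- }; the nonnegative part (a constant) is identified
  with the matrix q.\<close>
definition Ymn :: "nat \<Rightarrow> nat \<Rightarrow> complex mat set" where
  "Ymn m n = {q. \<exists>g \<in> GLie_minus m n. \<forall>i\<ge>0.
      ser_coeff (Jser m n * g - g * Jser m n) i = (if i = 0 then q else 0\<^sub>m (NN m n) (NN m n))}"

definition ser_pos_eval :: "complex fls mat \<Rightarrow> complex \<Rightarrow> complex mat" where
  "ser_pos_eval X lam = mat (dim_row X) (dim_col X) (\<lambda>(r,c).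
     \<Sum>k\<in>{fls_subdegree (X $$ (r,c)) .. 0}. fls_nth (X $$ (r,c)) k * lam ^ nat (- k))"

definition mat_deriv :: "nat \<Rightarrow> (real \<Rightarrow> complex mat) \<Rightarrow> complex mat \<Rightarrow> real \<Rightarrow> bool" where
  "mat_deriv N f D s \<longleftrightarrow> D \<in> carrier_mat N N \<and>
     (\<forall>r<N. \<forall>c<N. ((\<lambda>u. f u $$ (r,c)) has_vector_derivative (D $$ (r,c))) (at s))"

definition ser_deriv :: "nat \<Rightarrow> (real \<Rightarrow> complex fls mat) \<Rightarrow> complex fls mat \<Rightarrow> real \<Rightarrow> bool" where
  "ser_deriv N f D s \<longleftrightarrow> D \<in> carrier_mat N N \<and>
     (\<forall>r<N. \<forall>c<N. \<forall>k. ((\<lambda>u. fls_nth (f u $$ (r,c)) k) has_vector_derivative fls_nth (D $$ (r,c)) k) (at s))"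

definition flow_sol :: "nat \<Rightarrow> nat \<Rightarrow> nat \<Rightarrow> (real \<Rightarrow> real \<Rightarrow> complex mat) \<Rightarrow>
    (real \<Rightarrow> real \<Rightarrow> complex fls mat) \<Rightarrow> (real \<times> real) set \<Rightarrow> bool" where
  "flow_sol m n j q S U \<longleftrightarrow> (\<forall>x t. (x,t) \<in> U \<longrightarrow>
     q x t \<in> Ymn m n \<and>
     S x t \<in> carrier_mat (NN m n) (NN m n) \<and>
     (\<exists>g \<in> GGrp_minus m n. S x t = g * Jser m n * minv g) \<and>
     (\<exists>Sx. ser_deriv (NN m n) (\<lambda>s. S s t) Sx x \<and>
        Sx + ((Jser m n + cser (q x t)) * S x t - S x t * (Jser m n + cser (q x t)))
          = 0\<^sub>m (NN m n) (NN m n)) \<and>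
     (\<exists>qt Px. mat_deriv (NN m n) (\<lambda>s. q x s) qt t \<and>
        mat_deriv (NN m n) (\<lambda>s. ser_coeff (S s t ^\<^sub>m (2*j-1)) 0) Px x \<and>
        qt = Px + ((bmat m n + q x t) * ser_coeff (S x t ^\<^sub>m (2*j-1)) 0
                   - ser_coeff (S x t ^\<^sub>m (2*j-1)) 0 * (bmat m n + q x t))))"

definition sigma :: "nat \<Rightarrow> nat \<Rightarrow> complex mat \<Rightarrow> complex mat" where
  "sigma m n Y = minv (Cmat m n * transpose_mat Y * Cinv m n)"

definition is_frame :: "nat \<Rightarrow> nat \<Rightarrow> nat \<Rightarrow> (real \<Rightarrow> real \<Rightarrow> complex mat) \<Rightarrow>
    (real \<Rightarrow> real \<Rightarrow> complex fls mat) \<Rightarrow> (real \<Rightarrow> real \<Rightarrow> complex \<Rightarrow> complex mat) \<Rightarrow>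
    (real \<times> real) set \<Rightarrow> complex set \<Rightarrow> bool" where
  "is_frame m n j q S F U L \<longleftrightarrow> (\<forall>x t lam. (x,t) \<in> U \<longrightarrow> lam \<in> L \<longrightarrow>
     F x t lam \<in> carrier_mat (NN m n) (NN m n) \<and> det (F x t lam) = 1 \<and>
     (\<exists>Fx. mat_deriv (NN m n) (\<lambda>s. F s t lam) Fx x \<and>
        minv (F x t lam) * Fx = Jmat m n lam + q x t) \<and>
     (\<exists>Ft. mat_deriv (NN m n) (\<lambda>s. F x s lam) Ft t \<and>
        minv (F x t lam) * Ft = ser_pos_eval (S x t ^\<^sub>m (2*j-1)) lam) \<and>
     sigma m n (F x t (- lam)) = F x t lam)"

definition bform :: "nat \<Rightarrow> nat \<Rightarrow> complex vec \<Rightarrow> complex vec \<Rightarrow> complex" where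
  "bform m n X Y = X \<bullet> (Cmat m n *\<^sub>v Y)"

definition sharp :: "nat \<Rightarrow> nat \<Rightarrow> complex mat \<Rightarrow> complex mat" where
  "sharp m n A = Cinv m n * transpose_mat A * Cmat m n"

definition nondeg :: "nat \<Rightarrow> nat \<Rightarrow> complex vec set \<Rightarrow> bool" where
  "nondeg m n V \<longleftrightarrow> (\<forall>v\<in>V. (\<forall>w\<in>V. bform m n v w = 0) \<longrightarrow> v = 0\<^sub>v (NN m n))"

definition mat_image :: "complex mat \<Rightarrow> complex vec set" where
  "mat_image A = {A *\<^sub>v v | v. v \<in> carrier_vec (dim_col A)}"

definition Oproj :: "nat \<Rightarrow> nat \<Rightarrow> complex mat \<Rightarrow> complex vec set \<Rightarrow> bool" where
  "Oproj m n P V \<longleftrightarrow> P \<in> carrier_mat (NN m n) (NN m n) \<and> P * P = P \<and> sharp m n P = P \<and>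
     mat_image P = V \<and> nondeg m n V"

definition kmat :: "nat \<Rightarrow> complex \<Rightarrow> complex mat \<Rightarrow> complex \<Rightarrow> complex mat" where
  "kmat N a P lam = 1\<^sub>m N + (2 * a / (lam - a)) \<cdot>\<^sub>m (1\<^sub>m N - P)"

end

theory Submission
  imports Defs
begin

text \<open>Conjugation by \<open>K = k\<^sub>\<alpha>,\<^sub>\<pi>\<close> (with \<open>\<pi>\<close> the varying projection) turns the Lax pair
  \<open>(J + q, (S\<^sup>2\<^sup>j\<^sup>-\<^sup>1)\<^sub>+)\<close> into \<open>K B K\<^sup>-\<^sup>1 + K (K\<^sup>-\<^sup>1)'\<close>, a priori with simple poles at \<open>\<plusminus>\<alpha>\<close>.
  Since \<open>Im \<pi> = F(\<alpha>)\<^sup>-\<^sup>1 Im \<pi>\<^sub>0\<close>, the residue at \<open>\<alpha>\<close> vanishes, and the reality condition carries this over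
  to \<open>-\<alpha>\<close>.  The result is therefore polynomial in \<open>\<lambda>\<close>, hence determined by its expansion at
  \<open>\<lambda> = \<infinity>\<close>, where \<open>K\<close> lies in the negative group: it is the positive part of the same power of
  \<open>K S K\<^sup>-\<^sup>1\<close>.  The evolution equation amounts to \<open>q\<^sub>t = [S\<^sub>-\<^sub>1, e]\<close>, with \<open>S\<^sub>-\<^sub>1\<close> the next
  coefficient of that power and \<open>e\<close> the coefficient of \<open>\<lambda>\<close> in \<open>J\<close>; the \<open>\<lambda>\<^sup>-\<^sup>1\<close> term of the same expansion
  shifts \<open>S\<^sub>-\<^sub>1\<close> by \<open>-2\<alpha> \<pi>\<^sub>t\<close>, which is the change of \<open>q\<^sub>t\<close>.\<close>

section \<open>A type-class ring containing the matrices of a fixed size\<close>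

text \<open>The moving projection R is given only pointwise, as the orthogonal projection onto a
  moving subspace, so its differentiability has to be established before any gauge computation.
  After that its derivative D enters only through two algebraic relations, (1 - R)(B(a) R + D) = 0
  and R (B(-a)(1 - R) - D) = 0, where B is the logarithmic derivative of F. They express the
  vanishing of the residues at a and -a, since K^-1 is the factor for -a and so K (K^-1)' = 2a/(z +
  a) K D. The gauge transform is needed both at numbers z, for the frame, and as an expansion in mu
  = 1/lambda, for the series S. Both are images of one polynomial matrix in lambda under ring
  homomorphisms; this is why its numerator, cleared of (lambda - a)(lambda + a), is treated without
  division over commutative rings. The correction to q is forced: K = 1 + 2a (1 - R)/lambda + ...,
  and commuting the 1/lambda coefficient with lambda e leaves 2a [1 - R, e] = 2a [e, R].\<close>

text \<open>Matrices of a fixed size form no type-class ring.  Acting blockwise on infinite sequences they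
  embed unitally into the ring of linear operators, where noncommutative identities are left to
  the simplifier; the scalars \<open>sc c\<close> are central.\<close>

typedef (overloaded) 'a linop = "{f :: (nat \<Rightarrow> 'a::comm_ring_1) \<Rightarrow> nat \<Rightarrow> 'a.
    (\<forall>v w. f (\<lambda>p. v p + w p) = (\<lambda>p. f v p + f w p)) \<and> (\<forall>c v. f (\<lambda>p. c * v p) = (\<lambda>p. c * f v p))}"
  morphisms app Abs_linop
  by (rule exI[of _ "\<lambda>v. v"]) auto

setup_lifting type_definition_linop

instantiation linop :: (comm_ring_1) ring_1
begin
lift_definition zero_linop :: "'a linop" is "\<lambda>v p. 0" by auto
lift_definition one_linop :: "'a linop" is "\<lambda>v. v" by auto
lift_definition plus_linop :: "'a linop \<Rightarrow> 'a linop \<Rightarrow> 'a linop" is "\<lambda>f g v p. f v p + g v p"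
  by (auto simp: algebra_simps)
lift_definition minus_linop :: "'a linop \<Rightarrow> 'a linop \<Rightarrow> 'a linop" is "\<lambda>f g v p. f v p - g v p"
  by (auto simp: algebra_simps)
lift_definition uminus_linop :: "'a linop \<Rightarrow> 'a linop" is "\<lambda>f v p. - f v p"
  by (auto simp: algebra_simps)
lift_definition times_linop :: "'a linop \<Rightarrow> 'a linop \<Rightarrow> 'a linop" is "\<lambda>f g v. f (g v)"
  by auto
instance
proof
  show "(0 :: 'a linop) \<noteq> 1"
  proof
    assume "(0 :: 'a linop) = 1"
    hence "app (0 :: 'a linop) (\<lambda>_. 1) 0 = app (1 :: 'a linop) (\<lambda>_. 1) 0" by simp
    thus False by (simp add: zero_linop.rep_eq one_linop.rep_eq)
  qed
qed (transfer; auto simp: algebra_simps fun_eq_iff)+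
end

lift_definition sc :: "'a::comm_ring_1 \<Rightarrow> 'a linop" is "\<lambda>c v p. c * v p"
  by (auto simp: algebra_simps)

lemma sc_add: "sc (c + d) = sc c + sc d" by transfer (auto simp: algebra_simps)
lemma sc_diff: "sc (c - d) = sc c - sc d" by transfer (auto simp: algebra_simps)
lemma sc_minus: "sc (- c) = - sc c" by transfer auto
lemma sc_mult: "sc (c * d) = sc c * sc d" by transfer (auto simp: algebra_simps)
lemma sc_1: "sc 1 = 1" by transfer auto
lemma sc_0: "sc 0 = 0" by transfer auto
lemma sc_central: "X * sc c = sc c * X" by transfer auto
lemma sc_central': "X * (sc c * Y) = sc c * (X * Y)"
  by (metis sc_central mult.assoc)

text \<open>\<open>A\<close> acts alike on every block of \<open>N\<close> consecutive entries,
  \<open>p div N\<close> being the block and \<open>p mod N\<close> the place in it. Acting on a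
  single block would send the identity matrix to a proper idempotent instead of 1.\<close>

lift_definition emb :: "nat \<Rightarrow> 'a::comm_ring_1 mat \<Rightarrow> 'a linop" is
  "\<lambda>N A v p. \<Sum>j<N. A $$ (p mod N, j) * v (N * (p div N) + j)"
  by (auto simp: algebra_simps sum.distrib sum_distrib_left)

lemma emb_1: "0 < N \<Longrightarrow> emb N (1\<^sub>m N) = 1"
  apply transfer
  apply (intro ext)
  subgoal for N v p
    by (subst sum.cong[OF refl, of _ _ "\<lambda>j. if j = p mod N then v p else 0"]) auto
  done

lemma emb_0: "0 < N \<Longrightarrow> emb N (0\<^sub>m N N) = 0"
  by transfer auto

lemma emb_add:
  "0 < N \<Longrightarrow> A \<in> carrier_mat N N \<Longrightarrow> B \<in> carrier_mat N N \<Longrightarrow> emb N (A + B) = emb N A + emb N B"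
  by transfer (auto simp: fun_eq_iff sum.distrib[symmetric] algebra_simps intro!: sum.cong)

lemma emb_diff:
  "0 < N \<Longrightarrow> A \<in> carrier_mat N N \<Longrightarrow> B \<in> carrier_mat N N \<Longrightarrow> emb N (A - B) = emb N A - emb N B"
  by transfer (auto simp: fun_eq_iff sum_subtractf[symmetric] algebra_simps intro!: sum.cong)

lemma emb_uminus: "0 < N \<Longrightarrow> A \<in> carrier_mat N N \<Longrightarrow> emb N (- A) = - emb N A"
  by transfer (auto simp: fun_eq_iff sum_negf[symmetric] algebra_simps intro!: sum.cong)

lemma emb_smult: "0 < N \<Longrightarrow> A \<in> carrier_mat N N \<Longrightarrow> emb N (c \<cdot>\<^sub>m A) = sc c * emb N A"
  by transfer (auto simp: fun_eq_iff sum_distrib_left algebra_simps intro!: sum.cong)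

lemma emb_mult:
  "0 < N \<Longrightarrow> A \<in> carrier_mat N N \<Longrightarrow> B \<in> carrier_mat N N \<Longrightarrow> emb N (A * B) = emb N A * emb N B"
proof (transfer, intro ext, goal_cases)
  case (1 N A B v p)
  have "(\<Sum>j<N. (A * B) $$ (p mod N, j) * v (N * (p div N) + j))
      = (\<Sum>j<N. \<Sum>l<N. A $$ (p mod N, l) * B $$ (l, j) * v (N * (p div N) + j))"
    using 1 by (auto simp: scalar_prod_def sum_distrib_right atLeast0LessThan intro!: sum.cong)
  also have "\<dots> = (\<Sum>l<N. \<Sum>j<N. A $$ (p mod N, l) * B $$ (l, j) * v (N * (p div N) + j))"
    by (rule sum.swap)
  also have "\<dots> = (\<Sum>l<N. A $$ (p mod N, l) * (\<Sum>j<N. B $$ ((N * (p div N) + l) mod N, j) *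
                 v (N * ((N * (p div N) + l) div N) + j)))"
    by (auto simp: sum_distrib_left algebra_simps intro!: sum.cong)
  finally show ?case .
qed

lemma emb_inject:
  assumes "emb N A = emb N B" "A \<in> carrier_mat N N" "B \<in> carrier_mat N N"
  shows "A = B"
proof (rule eq_matI)
  fix i j assume ij: "i < dim_row B" "j < dim_col B"
  hence l: "i < N" "j < N" using assms by auto
  \<comment> \<open>Block 0 of the image of the \<open>j\<close>-th unit sequence is column
    \<open>j\<close>, and \<open>i < N\<close> lies in block 0.\<close>
  have e: "app (emb N X) (\<lambda>p. if p = j then 1 else 0) i = X $$ (i, j)" for X
    using l by (simp add: emb.rep_eq if_distrib[of "\<lambda>x. _ * x"] cong: if_cong)
  show "A $$ (i,j) = B $$ (i,j)" using e[of A] e[of B] assms(1) by simp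
qed (use assms in auto)

lemmas emb_simps = emb_1 emb_0 emb_add emb_diff emb_uminus emb_smult emb_mult
lemmas sc_simps = sc_add sc_diff sc_minus sc_mult sc_1 sc_0

section \<open>Inverses and the simple factor\<close>

lemma mult_carrier_mat_square [simp]:
  "A \<in> carrier_mat N N \<Longrightarrow> B \<in> carrier_mat N N \<Longrightarrow> A * B \<in> carrier_mat N N"
  by (rule mult_carrier_mat)

declare minus_carrier_mat [simp]

lemma minv_eqI:
  assumes "A \<in> carrier_mat N N" "B \<in> carrier_mat N N" "A * B = 1\<^sub>m N" "B * A = 1\<^sub>m N"
  shows "minv A = B"
  unfolding minv_def
proof (rule the_equality)
  show "B \<in> carrier_mat (dim_row A) (dim_row A) \<and> inverts_mat A B \<and> inverts_mat B A"
    using assms by (auto simp: inverts_mat_def)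
next
  fix B' assume B': "B' \<in> carrier_mat (dim_row A) (dim_row A) \<and> inverts_mat A B' \<and> inverts_mat B' A"
  hence c: "B' \<in> carrier_mat N N" and i: "B' * A = 1\<^sub>m N" using assms by (auto simp: inverts_mat_def)
  have "B' = B' * (A * B)" using assms c by simp
  also have "\<dots> = (B' * A) * B" using assms c by simp
  also have "\<dots> = B" using i assms by simp
  finally show "B' = B" .
qed

lemma minv_eqI_field:
  fixes A :: "'a::field mat"
  assumes "A \<in> carrier_mat N N" "B \<in> carrier_mat N N" "A * B = 1\<^sub>m N"
  shows "minv A = B"
  using assms minv_eqI mat_mult_left_right_inverse by blast

text \<open>\<open>minv\<close> is a definite description, so an inverse has to be exhibited: the
  adjugate divided by the determinant. The field is left open because matrices of Laurent series
  need this too.\<close>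

lemma minv_det_nz:
  fixes A :: "'a::field mat"
  assumes A: "A \<in> carrier_mat N N" and d: "det A \<noteq> 0"
  shows "minv A \<in> carrier_mat N N" "A * minv A = 1\<^sub>m N" "minv A * A = 1\<^sub>m N"
proof -
  define B where "B = inverse (det A) \<cdot>\<^sub>m adj_mat A"
  have B: "B \<in> carrier_mat N N" using adj_mat[OF A] by (simp add: B_def)
  have "A * B = inverse (det A) \<cdot>\<^sub>m (det A \<cdot>\<^sub>m 1\<^sub>m N)"
    using adj_mat[OF A] by (simp add: B_def mult_smult_distrib[OF A])
  also have "\<dots> = 1\<^sub>m N" using d by (intro eq_matI) auto
  finally have i: "A * B = 1\<^sub>m N" .
  have "minv A = B" using minv_eqI_field[OF A B i] .
  thus "minv A \<in> carrier_mat N N" "A * minv A = 1\<^sub>m N" "minv A * A = 1\<^sub>m N"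
    using B i mat_mult_left_right_inverse[OF A B i] by auto
qed

lemma det_nz_if_inverse:
  fixes A :: "'a::field mat"
  assumes "A \<in> carrier_mat N N" "B \<in> carrier_mat N N" "A * B = 1\<^sub>m N"
  shows "det A \<noteq> 0" "det B \<noteq> 0"
  using det_mult[OF assms(1,2)] assms(3) by auto

lemma minv_mult:
  fixes A :: "'a::field mat"
  assumes A: "A \<in> carrier_mat N N" and B: "B \<in> carrier_mat N N" and d: "det A \<noteq> 0" "det B \<noteq> 0"
  shows "minv (A * B) = minv B * minv A"
proof (rule minv_eqI_field)
  note a = minv_det_nz[OF A d(1)] and b = minv_det_nz[OF B d(2)]
  have "A * B * (minv B * minv A) = A * (B * minv B) * minv A"
    using A B a(1) b(1) by (simp del: assoc_mult_mat add: assoc_mult_mat[of _ N N _ N _ N])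
  thus "A * B * (minv B * minv A) = 1\<^sub>m N" using a b A by simp
  show "A * B \<in> carrier_mat N N" "minv B * minv A \<in> carrier_mat N N" using A B a b by auto
qed

text \<open>The factor \<open>k\<^sub>\<alpha>,\<^sub>\<pi>(\<lambda>)\<close> over an arbitrary field, so that the spectral parameter may be a
  number as well as the Laurent series \<open>\<lambda> = 1/\<mu>\<close>.  Its inverse is \<open>k\<^sub>-\<alpha>,\<^sub>\<pi>(\<lambda>)\<close>.\<close>

definition gk :: "nat \<Rightarrow> 'a::field \<Rightarrow> 'a mat \<Rightarrow> 'a \<Rightarrow> 'a mat" where
  "gk N a R u = 1\<^sub>m N + (2 * a / (u - a)) \<cdot>\<^sub>m (1\<^sub>m N - R)"

lemma kmat_eq_gk: "kmat = gk"
  by (intro ext) (simp add: kmat_def gk_def)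

lemma gk_carrier [simp]: "R \<in> carrier_mat N N \<Longrightarrow> gk N a R u \<in> carrier_mat N N"
  by (simp add: gk_def minus_carrier_mat)

text \<open>On the image of \<open>p\<close> the factor \<open>1 + sc c * p\<close> is the scalar 1
  + c and on the kernel it is 1; the new parameter is (1 + c)(1 + d) - 1.\<close>

lemma linop_unipotent_mult:
  assumes "p * p = (p :: 'a::comm_ring_1 linop)"
  shows "(1 + sc c * p) * (1 + sc d * p) = 1 + sc (c + d + c * d) * p"
proof -
  have "sc c * p * (sc d * p) = sc (c * d) * (p * p)"
    by (simp add: sc_mult mult.assoc sc_central'[of p])
  thus ?thesis using assms by (simp add: sc_add algebra_simps)
qed

lemma gk_inverse:
  fixes a u :: "'a::field"
  assumes R: "R \<in> carrier_mat N N" "R * R = R" and u: "u \<noteq> a" "u \<noteq> - a" and N: "0 < N"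
  shows "gk N a R u * gk N (- a) R u = 1\<^sub>m N"
proof (rule emb_inject[of N])
  have r: "emb N R * emb N R = emb N R" using R N by (metis emb_mult)
  have p: "(1 - emb N R) * (1 - emb N R) = 1 - emb N R" using r by (simp add: algebra_simps)
  have "u + a \<noteq> 0" "u - a \<noteq> 0" using u by (auto simp: add_eq_0_iff2)
  \<comment> \<open>The scalars 1 + 2a/(u - a) = (u + a)/(u - a) and 1 - 2a/(u + a) = (u - a)/(u +
    a) are reciprocal, so the combined parameter is 0.\<close>
  hence c: "2 * a / (u - a) + 2 * (- a) / (u - (- a)) + 2 * a / (u - a) * (2 * (- a) / (u - (- a))) = 0"
    by (simp add: field_simps)
  have "emb N (gk N a R u * gk N (- a) R u)
      = (1 + sc (2 * a / (u - a)) * (1 - emb N R)) * (1 + sc (2 * (- a) / (u - (- a))) * (1 - emb N R))"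
    using R(1) N unfolding gk_def by (simp add: emb_simps)
  also have "\<dots> = 1" unfolding linop_unipotent_mult[OF p] c by (simp add: sc_simps)
  finally show "emb N (gk N a R u * gk N (- a) R u) = emb N (1\<^sub>m N)" using N by (simp add: emb_simps)
qed (use R in auto)

lemma gk_inverse':
  fixes a u :: "'a::field"
  assumes R: "R \<in> carrier_mat N N" "R * R = R" and u: "u \<noteq> a" "u \<noteq> - a" and N: "0 < N"
  shows "gk N (- a) R u * gk N a R u = 1\<^sub>m N"
  using gk_inverse[of R N u "-a"] assms by simp

lemma minv_gk:
  fixes a u :: "'a::field"
  assumes "R \<in> carrier_mat N N" "R * R = R" "u \<noteq> a" "u \<noteq> - a" "0 < N"
  shows "minv (gk N a R u) = gk N (- a) R u"
  using gk_inverse[OF assms] by (intro minv_eqI_field[of _ N]) (use assms in auto)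

text \<open>Projections with the same image are conjugate by the unipotent \<open>1 + R - Q\<close>.\<close>

lemma det_gk_same_image:
  fixes a u :: "'a::field"
  assumes R: "R \<in> carrier_mat N N" and Q: "Q \<in> carrier_mat N N"
    and RQ: "R * Q = Q" and QR: "Q * R = R" and N: "0 < N"
  shows "det (gk N a R u) = det (gk N a Q u)"
proof -
  define T where "T = 1\<^sub>m N + (R - Q)"
  define T' where "T' = 1\<^sub>m N + (Q - R)"
  have c: "T \<in> carrier_mat N N" "T' \<in> carrier_mat N N" "R - Q \<in> carrier_mat N N" "Q - R \<in> carrier_mat N N"
    using R Q by (auto simp: T_def T'_def minus_carrier_mat)
  define r q where "r = emb N R" and "q = emb N Q"
  have rq: "r * q = q" "q * r = r"
    using emb_mult[OF N R Q] emb_mult[OF N Q R] RQ QR by (simp_all add: r_def q_def)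
  \<comment> \<open>Idempotence is a consequence: r r = r (q r) = (r q) r = q r = r, and likewise
    for q.\<close>
  have rr: "r * r = r" "q * q = q"
    using rq by (metis mult.assoc)+
  note rules = rr rq rr[THEN arg_cong[where f = "\<lambda>x. x * y" for y], unfolded mult.assoc]
    rq[THEN arg_cong[where f = "\<lambda>x. x * y" for y], unfolded mult.assoc]
  \<comment> \<open>(R - Q)(R - Q) = R - Q - R + Q = 0, so 1 + (R - Q) has the inverse 1 - (R -
    Q).\<close>
  have TT: "T' * T = 1\<^sub>m N"
  proof (rule emb_inject[of N])
    have "emb N (T' * T) = (1 + (q - r)) * (1 + (r - q))"
      using R Q N c unfolding T_def T'_def by (simp add: emb_simps r_def q_def)
    also have "\<dots> = 1" by (simp add: algebra_simps rules)
    finally show "emb N (T' * T) = emb N (1\<^sub>m N)" using N by (simp add: emb_simps)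
  qed (use c in auto)
  have "T' * gk N a Q u * T = gk N a R u"
  proof (rule emb_inject[of N])
    define s where "s = sc (2 * a / (u - a))"
    have s: "X * s = s * X" "X * (s * Y) = s * (X * Y)" for X Y
      unfolding s_def by (rule sc_central, rule sc_central')
    have e: "emb N (gk N a X u) = 1 + s * (1 - emb N X)" if "X \<in> carrier_mat N N" for X
      using N that by (simp add: gk_def emb_simps s_def)
    have g: "gk N a Q u \<in> carrier_mat N N" using Q by simp
    have "emb N (T' * gk N a Q u * T) = (1 + (q - r)) * (1 + s * (1 - q)) * (1 + (r - q))"
      using N c g R Q by (simp add: emb_mult e[OF Q] del: assoc_mult_mat) (simp add: T_def T'_def emb_simps r_def q_def)
    also have "\<dots> = 1 + s * (1 - r)"
      by (simp add: algebra_simps rules s(1)[of r] s(1)[of q] s(2)[of r] s(2)[of q])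
    finally show "emb N (T' * gk N a Q u * T) = emb N (gk N a R u)" using e[OF R] by (simp add: r_def)
  qed (use c R Q in auto)
  moreover have "det (T' * gk N a Q u * T) = det T' * det (gk N a Q u) * det T"
    using c Q by (simp add: det_mult[of _ N] del: assoc_mult_mat)
  ultimately have "det (gk N a R u) = det T' * det (gk N a Q u) * det T" by simp
  moreover have "det T' * det T = 1" using TT det_mult[OF c(2,1)] by simp
  ultimately show ?thesis by (simp add: mult.commute mult.left_commute)
qed

section \<open>Clearing the denominators of the gauge transformation\<close>

lemma linop_pull_scalars:
  "sc x * k * B * (sc y * k') + sc x * k * (sc y * sc w * d) = sc (x * y) * (k * B * k' + sc w * (k * d))"
proof -
  have "sc x * k * B * (sc y * k') = sc (x * y) * (k * B * k')"
    by (simp only: sc_mult mult.assoc sc_central'[of _ y])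
  moreover have "sc x * k * (sc y * sc w * d) = sc (x * y) * (sc w * (k * d))"
    by (simp only: sc_mult mult.assoc sc_central'[of k y] sc_central'[of k w])
  ultimately show ?thesis by (simp only: distrib_left)
qed

text \<open>With K = 1 + 2a/(u - a) (1 - r), the poles are cleared by (u - a) K = (u + a) - 2a r and
  (u + a) K^-1 = (u - a) + 2a r; in the derivative term u + a cancels the denominator of the
  scalar.\<close>

lemma linop_dress_factor:
  fixes u a :: "'a::field"
  assumes u: "u \<noteq> a" "u \<noteq> - a"
  shows "(sc (u + a) - sc (2 * a) * r) * B * (sc (u - a) + sc (2 * a) * r)
      + (sc (u + a) - sc (2 * a) * r) * (sc (2 * a) * d)
    = sc ((u - a) * (u + a)) *
      ((1 + sc (2 * a / (u - a)) * (1 - r)) * B * (1 + sc (2 * (- a) / (u - (- a))) * (1 - r))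
      + sc (2 * a / (u + a)) * ((1 + sc (2 * a / (u - a)) * (1 - r)) * d))"
proof -
  have nz: "u + a \<noteq> 0" "u - a \<noteq> 0" using u by (auto simp: add_eq_0_iff2)
  have g: "sc x * (1 + sc c * (1 - r)) = sc (x + x * c) - sc (x * c) * r" for x c
    by (simp only: sc_mult sc_add right_diff_distrib distrib_left mult_1_right mult.assoc add_diff_eq)
  have "(u - a) + (u - a) * (2 * a / (u - a)) = u + a" "(u - a) * (2 * a / (u - a)) = 2 * a"
    "(u + a) + (u + a) * (2 * (- a) / (u - (- a))) = u - a" "(u + a) * (2 * (- a) / (u - (- a))) = - (2 * a)"
    using nz by simp_all
  hence L: "sc (u + a) - sc (2 * a) * r = sc (u - a) * (1 + sc (2 * a / (u - a)) * (1 - r))"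
    and M: "sc (u - a) + sc (2 * a) * r = sc (u + a) * (1 + sc (2 * (- a) / (u - (- a))) * (1 - r))"
    unfolding g by (simp_all only: sc_minus mult_minus_left diff_minus_eq_add)
  have S: "sc (2 * a) * d = sc (u + a) * sc (2 * a / (u + a)) * d"
    using nz by (simp flip: sc_mult)
  show ?thesis unfolding L M S by (rule linop_pull_scalars)
qed
text \<open>The two residue conditions fix both halves (1 - r) d and r d, hence \<open>d\<close>
  itself; after substituting it the identity is pure expansion. The commutator on the right is the
  correction to q.\<close>

lemma linop_dress_linear:
  fixes U al r E A d :: "'a::ring_1"
  assumes r: "r * r = r"
    and c: "\<And>X. X * U = U * X" "\<And>X. X * al = al * X"
    and d1: "(1 - r) * ((al * E + A) * r + d) = 0"
    and d2: "r * ((A - al * E) * (1 - r) - d) = 0"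
  shows "(U + al - (al + al) * r) * (U * E + A) * (U - al + (al + al) * r)
      + (U + al - (al + al) * r) * ((al + al) * d)
    = (U - al) * (U + al) * (U * E + A + (al + al) * (E * r - r * E))"
proof -
  have d1': "d - r * d = - ((1 - r) * (al * E + A) * r)"
    using d1 by (simp add: algebra_simps)
  have d2': "r * d = r * (A - al * E) * (1 - r)"
    using d2 by (simp add: algebra_simps)
  have d: "d = r * (A - al * E) * (1 - r) - (1 - r) * (al * E + A) * r"
    using d1' d2' by (simp add: algebra_simps)
  have r': "r * (r * X) = r * X" for X using r by (simp flip: mult.assoc)
  have c': "X * (U * Y) = U * (X * Y)" "X * (al * Y) = al * (X * Y)" for X Y
    using c by (simp_all flip: mult.assoc)
  note cs = c(1)[of r] c(1)[of E] c(1)[of A] c(1)[of al] c(2)[of r] c(2)[of E] c(2)[of A]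
    c'(1)[of r] c'(1)[of E] c'(1)[of A] c'(1)[of al] c'(2)[of r] c'(2)[of E] c'(2)[of A]
  show ?thesis unfolding d
    by (simp add: algebra_simps r r' cs)
qed

section \<open>Gauge transformation of polynomial matrices\<close>

lemma (in comm_ring_hom) mat_hom_add:
  "A \<in> carrier_mat n k \<Longrightarrow> B \<in> carrier_mat n k \<Longrightarrow> map_mat hom (A + B) = map_mat hom A + map_mat hom B"
  by (rule eq_matI) (auto simp: hom_add)

lemma (in comm_ring_hom) mat_hom_minus:
  "A \<in> carrier_mat n k \<Longrightarrow> B \<in> carrier_mat n k \<Longrightarrow> map_mat hom (A - B) = map_mat hom A - map_mat hom B"
  by (rule eq_matI) (auto simp: hom_minus)

lemma (in comm_ring_hom) mat_hom_smult: "map_mat hom (c \<cdot>\<^sub>m A) = hom c \<cdot>\<^sub>m map_mat hom A"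
  by (rule eq_matI) (auto simp: hom_mult)

lemma (in comm_ring_hom) mat_hom_zero: "map_mat hom (0\<^sub>m n k) = 0\<^sub>m n k"
  by (rule eq_matI) auto

text \<open>This is (u - a)(u + a) times K B K^-1 + K (K^-1)', where \<open>D\<close> stands for the
  derivative of \<open>R\<close>. Being free of division, it makes sense over polynomials in lambda
  and is preserved by ring homomorphisms.\<close>

definition dress_num ::
  "nat \<Rightarrow> 'a::comm_ring_1 \<Rightarrow> 'a \<Rightarrow> 'a mat \<Rightarrow> 'a mat \<Rightarrow> 'a mat \<Rightarrow> 'a mat" where
  "dress_num N u a R B D =
    ((u + a) \<cdot>\<^sub>m 1\<^sub>m N - (2 * a) \<cdot>\<^sub>m R) * B * ((u - a) \<cdot>\<^sub>m 1\<^sub>m N + (2 * a) \<cdot>\<^sub>m R)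
    + ((u + a) \<cdot>\<^sub>m 1\<^sub>m N - (2 * a) \<cdot>\<^sub>m R) * ((2 * a) \<cdot>\<^sub>m D)"

lemma dress_num_carrier [simp]:
  "R \<in> carrier_mat N N \<Longrightarrow> B \<in> carrier_mat N N \<Longrightarrow> D \<in> carrier_mat N N \<Longrightarrow>
    dress_num N u a R B D \<in> carrier_mat N N"
  by (simp add: dress_num_def)

lemma (in comm_ring_hom) mat_hom_dress_num:
  assumes "R \<in> carrier_mat N N" "B \<in> carrier_mat N N" "D \<in> carrier_mat N N"
  shows "map_mat hom (dress_num N u a R B D)
    = dress_num N (hom u) (hom a) (map_mat hom R) (map_mat hom B) (map_mat hom D)"
  unfolding dress_num_def using assms
  by (simp add: mat_hom_add[of _ N N] mat_hom_minus[of _ N N] mat_hom_mult[of _ N N _ N] mat_hom_smult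
      mat_hom_one hom_distribs del: assoc_mult_mat)

lemma emb_dress_num:
  assumes "R \<in> carrier_mat N N" "B \<in> carrier_mat N N" "D \<in> carrier_mat N N" "0 < N"
  shows "emb N (dress_num N u a R B D) =
      (sc (u + a) - sc (2 * a) * emb N R) * emb N B * (sc (u - a) + sc (2 * a) * emb N R)
      + (sc (u + a) - sc (2 * a) * emb N R) * (sc (2 * a) * emb N D)"
  unfolding dress_num_def using assms by (simp add: emb_simps del: assoc_mult_mat)

lemma linop_pull_square:
  "sc s * p * B * (sc s * q) + sc s * p * (sc s * d) = sc (s * s) * (p * (B * q + d))"
  by (simp only: sc_mult distrib_left mult.assoc sc_central'[of B] sc_central'[of p])

text \<open>At u = a the outer factors become 2a (1 - R) and 2a R, so the numerator is 4a^2 times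
  the left side of \<open>z\<close>.\<close>

lemma dress_num_at:
  assumes c: "R \<in> carrier_mat N N" "B \<in> carrier_mat N N" "D \<in> carrier_mat N N" "0 < N"
    and z: "(1\<^sub>m N - R) * (B * R + D) = 0\<^sub>m N N"
  shows "dress_num N a a R B D = 0\<^sub>m N N"
proof (rule emb_inject[of N])
  have z': "(1 - emb N R) * (emb N B * emb N R + emb N D) = 0"
    using arg_cong[OF z, of "emb N"] c by (simp add: emb_simps)
  have L: "sc (a + a) - sc (2 * a) * emb N R = sc (2 * a) * (1 - emb N R)"
    "sc (a - a) + sc (2 * a) * emb N R = sc (2 * a) * emb N R"
    by (simp_all add: sc_0 right_diff_distrib flip: mult_2)
  show "emb N (dress_num N a a R B D) = emb N (0\<^sub>m N N)"
    unfolding emb_dress_num[OF c] L linop_pull_square z' using c by (simp add: emb_0)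
qed (use c in auto)

text \<open>At u = -a the outer factors are -2a R and -2a (1 - R); pulling the same -2a out of 2a D
  is what reverses the sign of \<open>D\<close>.\<close>

lemma dress_num_at_minus:
  assumes c: "R \<in> carrier_mat N N" "B \<in> carrier_mat N N" "D \<in> carrier_mat N N" "0 < N"
    and z: "R * (B * (1\<^sub>m N - R) - D) = 0\<^sub>m N N"
  shows "dress_num N (- a) a R B D = 0\<^sub>m N N"
proof (rule emb_inject[of N])
  have "emb N R * (emb N B * (1 - emb N R) - emb N D) = 0"
    using arg_cong[OF z, of "emb N"] c by (simp add: emb_simps)
  hence z': "emb N R * (emb N B * (1 - emb N R) + - emb N D) = 0" by simp
  have L: "sc (- a + a) - sc (2 * a) * emb N R = sc (- 2 * a) * emb N R"
    "sc (- a - a) + sc (2 * a) * emb N R = sc (- 2 * a) * (1 - emb N R)"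
    "sc (2 * a) * emb N D = sc (- 2 * a) * (- emb N D)"
    by (simp_all add: sc_0 sc_minus right_diff_distrib flip: mult_2)
  show "emb N (dress_num N (- a) a R B D) = emb N (0\<^sub>m N N)"
    unfolding emb_dress_num[OF c] L linop_pull_square z' using c by (simp add: emb_0)
qed (use c in auto)

lemma dress_num_field:
  fixes a u :: "'a::field"
  assumes c: "R \<in> carrier_mat N N" "B \<in> carrier_mat N N" "D \<in> carrier_mat N N" "0 < N"
    and u: "u \<noteq> a" "u \<noteq> - a"
  shows "dress_num N u a R B D = ((u - a) * (u + a)) \<cdot>\<^sub>m
    (gk N a R u * B * gk N (- a) R u + (2 * a / (u + a)) \<cdot>\<^sub>m (gk N a R u * D))"
proof (rule emb_inject[of N])
  have e: "emb N (gk N b R u) = 1 + sc (2 * b / (u - b)) * (1 - emb N R)" for b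
    using c by (simp add: gk_def emb_simps)
  have "emb N (((u - a) * (u + a)) \<cdot>\<^sub>m
    (gk N a R u * B * gk N (- a) R u + (2 * a / (u + a)) \<cdot>\<^sub>m (gk N a R u * D)))
    = sc ((u - a) * (u + a)) * (emb N (gk N a R u) * emb N B * emb N (gk N (- a) R u) +
       sc (2 * a / (u + a)) * (emb N (gk N a R u) * emb N D))"
    using c by (simp add: emb_mult emb_smult emb_add del: assoc_mult_mat)
  thus "emb N (dress_num N u a R B D) = emb N (((u - a) * (u + a)) \<cdot>\<^sub>m
    (gk N a R u * B * gk N (- a) R u + (2 * a / (u + a)) \<cdot>\<^sub>m (gk N a R u * D)))"
    unfolding e emb_dress_num[OF c] linop_dress_factor[OF u] by simp
qed (use c in auto)

lemma dress_num_linear: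
  fixes a u :: "'a::comm_ring_1"
  assumes c: "R \<in> carrier_mat N N" "E \<in> carrier_mat N N" "A \<in> carrier_mat N N" "D \<in> carrier_mat N N" "0 < N"
    and R: "R * R = R"
    and z1: "(1\<^sub>m N - R) * ((a \<cdot>\<^sub>m E + A) * R + D) = 0\<^sub>m N N"
    and z2: "R * ((A - a \<cdot>\<^sub>m E) * (1\<^sub>m N - R) - D) = 0\<^sub>m N N"
  shows "dress_num N u a R (u \<cdot>\<^sub>m E + A) D = ((u - a) * (u + a)) \<cdot>\<^sub>m
    (u \<cdot>\<^sub>m E + A + (2 * a) \<cdot>\<^sub>m (E * R - R * E))"
proof (rule emb_inject[of N])
  have r: "emb N R * emb N R = emb N R" using R c by (metis emb_mult)
  have d1: "(1 - emb N R) * ((sc a * emb N E + emb N A) * emb N R + emb N D) = 0"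
    using arg_cong[OF z1, of "emb N"] c by (simp add: emb_simps)
  have d2: "emb N R * ((emb N A - sc a * emb N E) * (1 - emb N R) - emb N D) = 0"
    using arg_cong[OF z2, of "emb N"] c by (simp add: emb_simps)
  have s2: "sc (2 * a) = sc a + sc a" by (simp only: mult_2 sc_add)
  have c': "u \<cdot>\<^sub>m E + A \<in> carrier_mat N N" using c by simp
  have "emb N (dress_num N u a R (u \<cdot>\<^sub>m E + A) D) =
    (sc u + sc a - (sc a + sc a) * emb N R) * (sc u * emb N E + emb N A) * (sc u - sc a + (sc a + sc a) * emb N R)
      + (sc u + sc a - (sc a + sc a) * emb N R) * ((sc a + sc a) * emb N D)"
    unfolding emb_dress_num[OF c(1) c' c(4,5)] using c by (simp only: s2) (simp add: emb_add emb_smult sc_add sc_diff)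
  also have "\<dots> = (sc u - sc a) * (sc u + sc a) *
      (sc u * emb N E + emb N A + (sc a + sc a) * (emb N E * emb N R - emb N R * emb N E))"
    by (rule linop_dress_linear[OF r sc_central sc_central d1 d2])
  also have "\<dots> = emb N (((u - a) * (u + a)) \<cdot>\<^sub>m (u \<cdot>\<^sub>m E + A + (2 * a) \<cdot>\<^sub>m (E * R - R * E)))"
    using c by (simp add: emb_add emb_smult emb_diff emb_mult sc_add sc_diff sc_mult[of "u - a"] s2)
  finally show "emb N (dress_num N u a R (u \<cdot>\<^sub>m E + A) D) =
    emb N (((u - a) * (u + a)) \<cdot>\<^sub>m (u \<cdot>\<^sub>m E + A + (2 * a) \<cdot>\<^sub>m (E * R - R * E)))" .
qed (use c in auto)

definition cpoly_mat :: "complex mat \<Rightarrow> complex poly mat" where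
  "cpoly_mat = map_mat (\<lambda>c. [:c:])"

lemma cpoly_mat_carrier [simp]: "cpoly_mat A \<in> carrier_mat n k \<longleftrightarrow> A \<in> carrier_mat n k"
  by (simp add: cpoly_mat_def)

interpretation poly_eval: comm_ring_hom "\<lambda>p :: complex poly. poly p z" for z
  by unfold_locales auto

lemma poly_eval_cpoly_mat: "map_mat (\<lambda>p. poly p z) (cpoly_mat A) = A"
  by (rule eq_matI) (auto simp: cpoly_mat_def)

text \<open>Both \<open>a\<close> and \<open>- a\<close> are roots of every entry of the numerator,
  so (lambda - a)(lambda + a) divides it. The quotient \<open>T\<close> is the gauge-transformed
  coefficient, now polynomial in lambda.\<close>

lemma dress_polynomial:
  fixes a :: complex
  assumes c: "R \<in> carrier_mat N N" "B \<in> carrier_mat N N" "D \<in> carrier_mat N N" "0 < N" and a: "a \<noteq> 0"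
    and z1: "(1\<^sub>m N - R) * (map_mat (\<lambda>p. poly p a) B * R + D) = 0\<^sub>m N N"
    and z2: "R * (map_mat (\<lambda>p. poly p (- a)) B * (1\<^sub>m N - R) - D) = 0\<^sub>m N N"
  obtains T where "T \<in> carrier_mat N N"
    "dress_num N [:0, 1:] [:a:] (cpoly_mat R) B (cpoly_mat D) = ([:- a, 1:] * [:a, 1:]) \<cdot>\<^sub>m T"
proof -
  define M where "M = dress_num N [:0, 1:] [:a:] (cpoly_mat R) B (cpoly_mat D)"
  have M: "M \<in> carrier_mat N N" using c by (simp add: M_def)
  have ev: "map_mat (\<lambda>p. poly p z) M = dress_num N z a R (map_mat (\<lambda>p. poly p z) B) D" for z
    unfolding M_def using c by (subst poly_eval.mat_hom_dress_num) (simp_all add: poly_eval_cpoly_mat)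
  have 1: "map_mat (\<lambda>p. poly p a) M = 0\<^sub>m N N" "map_mat (\<lambda>p. poly p (- a)) M = 0\<^sub>m N N"
    unfolding ev using c z1 z2 by (auto intro!: dress_num_at dress_num_at_minus)
  have dv: "[:- a, 1:] * [:a, 1:] dvd M $$ (i, j)" if "i < N" "j < N" for i j
  proof -
    have p: "poly (M $$ (i,j)) a = 0" "poly (M $$ (i,j)) (- a) = 0"
      using 1[THEN arg_cong[where f = "\<lambda>A. A $$ (i,j)"]] that M by auto
    obtain g where g: "M $$ (i,j) = [:- a, 1:] * g" using p(1) by (auto simp: poly_eq_0_iff_dvd)
    \<comment> \<open>The two roots must be distinct: lambda - a takes the nonzero value -2a at
      -a.\<close>
    have "poly g (- a) = 0" using p(2) a unfolding g by simp
    hence "[:a, 1:] dvd g" by (simp add: poly_eq_0_iff_dvd)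
    thus ?thesis unfolding g by (rule mult_dvd_mono[OF dvd_refl])
  qed
  define w where "w = [:- a, 1:] * [:a, 1:]"
  define T where "T = map_mat (\<lambda>p. p div w) M"
  have "M = w \<cdot>\<^sub>m T"
    by (rule eq_matI) (use M dv[folded w_def] in \<open>auto simp: T_def\<close>)
  moreover have "T \<in> carrier_mat N N" using M by (simp add: T_def)
  ultimately show ?thesis using that unfolding M_def w_def by blast
qed

lemma smult_mat_cancel:
  fixes c :: "'a::field"
  assumes "c \<cdot>\<^sub>m A = c \<cdot>\<^sub>m B" "c \<noteq> 0" "A \<in> carrier_mat n k" "B \<in> carrier_mat n k"
  shows "A = B"
proof (rule eq_matI)
  fix i j assume "i < dim_row B" "j < dim_col B"
  moreover have "(c \<cdot>\<^sub>m A) $$ (i,j) = (c \<cdot>\<^sub>m B) $$ (i,j)" by (simp only: assms(1))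
  ultimately show "A $$ (i,j) = B $$ (i,j)" using assms(2-4) by auto
qed (use assms in auto)

text \<open>One polynomial matrix \<open>T\<close> is read in two ways: evaluation at a number gives
  the logarithmic derivative of the dressed frame, substitution of lambda = 1/mu its expansion at
  infinity. In both target fields u differs from a and -a, so the cleared denominators can be
  divided out again.\<close>

lemma dress_polynomial_hom:
  fixes h :: "complex poly \<Rightarrow> 'k::field"
  assumes hom: "comm_ring_hom h"
    and c: "R \<in> carrier_mat N N" "B \<in> carrier_mat N N" "D \<in> carrier_mat N N" "T \<in> carrier_mat N N" "0 < N"
    and T: "dress_num N [:0, 1:] [:a:] (cpoly_mat R) B (cpoly_mat D) = ([:- a, 1:] * [:a, 1:]) \<cdot>\<^sub>m T"
    and u: "h [:0, 1:] = u" and al: "h [:a:] = al" and ne: "u \<noteq> al" "u \<noteq> - al"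
    and R': "map_mat h (cpoly_mat R) = R'" and D': "map_mat h (cpoly_mat D) = D'"
  shows "map_mat h T = gk N al R' u * map_mat h B * gk N (- al) R' u
    + (2 * al / (u + al)) \<cdot>\<^sub>m (gk N al R' u * D')"
proof -
  interpret h: comm_ring_hom h by (rule hom)
  have c': "R' \<in> carrier_mat N N" "D' \<in> carrier_mat N N" "map_mat h B \<in> carrier_mat N N"
    using R' D' c by auto
  have "[:- a, 1:] = [:0, 1:] - [:a:]" "[:a, 1:] = [:0, 1:] + [:a:]" by simp_all
  hence w: "h ([:- a, 1:] * [:a, 1:]) = (u - al) * (u + al)"
    by (simp only: h.hom_mult h.hom_minus h.hom_add u al)
  have "h ([:- a, 1:] * [:a, 1:]) \<cdot>\<^sub>m map_mat h T
      = map_mat h (dress_num N [:0, 1:] [:a:] (cpoly_mat R) B (cpoly_mat D))"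
    unfolding T h.mat_hom_smult ..
  also have "\<dots> = dress_num N u al R' (map_mat h B) D'"
    using c by (simp add: h.mat_hom_dress_num u al R' D')
  also have "\<dots> = ((u - al) * (u + al)) \<cdot>\<^sub>m (gk N al R' u * map_mat h B * gk N (- al) R' u
    + (2 * al / (u + al)) \<cdot>\<^sub>m (gk N al R' u * D'))"
    by (rule dress_num_field) (use c' c ne in auto)
  finally show ?thesis unfolding w
    by (rule smult_mat_cancel[of _ _ _ N N]) (use c c' ne in \<open>auto simp: add_eq_0_iff2\<close>)
qed

text \<open>A polynomial in \<open>\<lambda>\<close> as a Laurent series in \<open>\<mu> = 1/\<lambda>\<close>.\<close>

definition lampoly :: "complex poly \<Rightarrow> complex fls" where
  "lampoly p = poly (map_poly fls_const p) fls_X_inv"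

lemma lampoly_pCons: "lampoly (pCons c p) = fls_const c + fls_X_inv * lampoly p"
  by (simp add: lampoly_def map_poly_pCons)

lemma lampoly_0 [simp]: "lampoly 0 = 0"
  by (simp add: lampoly_def)

lemma lampoly_const [simp]: "lampoly [:c:] = fls_const c"
  by (simp add: lampoly_pCons)

lemma lampoly_add: "lampoly (p + q) = lampoly p + lampoly q"
  by (induction p q rule: poly_induct2) (simp_all add: lampoly_pCons algebra_simps flip: fls_plus_const)

lemma lampoly_smult: "lampoly (Polynomial.smult c p) = fls_const c * lampoly p"
  by (induction p) (simp_all add: lampoly_pCons algebra_simps flip: fls_const_mult_const)

lemma lampoly_mult: "lampoly (p * q) = lampoly p * lampoly q"
  by (induction p) (simp_all add: lampoly_pCons lampoly_add lampoly_smult algebra_simps)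

interpretation lampoly: comm_ring_hom lampoly
proof
  show "lampoly 1 = 1" using lampoly_const[of 1] by (simp flip: one_pCons del: lampoly_const)
qed (simp_all add: lampoly_add lampoly_mult)

lemma lampoly_X: "lampoly [:0, 1:] = fls_X_inv"
  by (simp add: lampoly_pCons)

lemma lampoly_nth: "fls_nth (lampoly p) k = (if k \<le> 0 then coeff p (nat (- k)) else 0)"
proof (induction p arbitrary: k)
  case (pCons c p)
  show ?case
    using pCons(2)[of "k + 1"]
    by (auto simp: lampoly_pCons fls_X_inv_times_conv_shift coeff_pCons nat_diff_distrib split: nat.splits)
qed simp

section \<open>Derivatives of matrix-valued functions\<close>

lemma has_vector_derivative_unique:
  fixes f :: "real \<Rightarrow> 'a::real_normed_vector"
  assumes "(f has_vector_derivative D) (at s)" "(f has_vector_derivative D') (at s)"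
  shows "D = D'"
  using has_derivative_unique[OF assms[unfolded has_vector_derivative_def]] by (metis scaleR_one)

lemma has_vector_derivative_cong_eventually:
  assumes "(f has_vector_derivative D) (at s)" "\<forall>\<^sub>F u in nhds s. f u = g u"
  shows "(g has_vector_derivative D) (at s)"
proof -
  have "\<forall>\<^sub>F u in at s. f u = g u" "f s = g s"
    using assms(2) by (simp_all add: eventually_nhds_conv_at)
  thus ?thesis
    using assms(1) unfolding has_vector_derivative_def
    using has_derivative_transform_eventually[of f _ s UNIV g] by simp
qed

text \<open>A derivative depends only on the germ at \<open>s\<close>. This matters because the
  moving projection is controlled only on an open set, not along the whole line.\<close>

lemma mat_deriv_cong:
  assumes "mat_deriv N f D s" "\<forall>\<^sub>F u in nhds s. f u = g u"
  shows "mat_deriv N g D s"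
  unfolding mat_deriv_def
proof (intro conjI allI impI)
  fix r c assume "r < N" "c < N"
  hence "((\<lambda>u. f u $$ (r,c)) has_vector_derivative D $$ (r,c)) (at s)"
    using assms(1) by (simp add: mat_deriv_def)
  thus "((\<lambda>u. g u $$ (r,c)) has_vector_derivative D $$ (r,c)) (at s)"
    by (rule has_vector_derivative_cong_eventually) (use assms(2) in \<open>auto elim: eventually_mono\<close>)
qed (use assms(1) in \<open>simp add: mat_deriv_def\<close>)

lemma mat_deriv_carrier: "mat_deriv N f D s \<Longrightarrow> D \<in> carrier_mat N N"
  by (simp add: mat_deriv_def)

lemma mat_deriv_unique:
  assumes "mat_deriv N f D s" "mat_deriv N f D' s"
  shows "D = D'"
proof (rule eq_matI)
  fix r c assume "r < dim_row D'" "c < dim_col D'"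
  hence "r < N" "c < N" using assms by (auto simp: mat_deriv_def)
  thus "D $$ (r,c) = D' $$ (r,c)"
    using assms unfolding mat_deriv_def
    by (blast intro: has_vector_derivative_unique[of "\<lambda>u. f u $$ (r,c)" _ s])
qed (use assms in \<open>auto simp: mat_deriv_def\<close>)

lemma mat_deriv_const: "mat_deriv N (\<lambda>_. A) (0\<^sub>m N N) s"
  by (auto simp: mat_deriv_def)

lemma mat_deriv_add:
  assumes "mat_deriv N f D s" "mat_deriv N g D' s" "\<forall>\<^sub>F u in nhds s. g u \<in> carrier_mat N N"
  shows "mat_deriv N (\<lambda>u. f u + g u) (D + D') s"
  unfolding mat_deriv_def
proof (intro conjI allI impI)
  fix r c assume rc: "r < N" "c < N"
  show "((\<lambda>u. (f u + g u) $$ (r,c)) has_vector_derivative (D + D') $$ (r,c)) (at s)"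
    by (rule has_vector_derivative_cong_eventually[where f = "\<lambda>u. f u $$ (r,c) + g u $$ (r,c)"],
        use assms rc in \<open>auto simp: mat_deriv_def intro!: has_vector_derivative_add\<close>)
       (use assms(3) rc in \<open>auto elim!: eventually_mono\<close>)
qed (use assms in \<open>auto simp: mat_deriv_def\<close>)

lemma mat_deriv_smult:
  fixes k :: complex
  assumes "mat_deriv N f D s" "\<forall>\<^sub>F u in nhds s. f u \<in> carrier_mat N N"
  shows "mat_deriv N (\<lambda>u. k \<cdot>\<^sub>m f u) (k \<cdot>\<^sub>m D) s"
  unfolding mat_deriv_def
proof (intro conjI allI impI)
  fix r c assume rc: "r < N" "c < N"
  show "((\<lambda>u. (k \<cdot>\<^sub>m f u) $$ (r,c)) has_vector_derivative (k \<cdot>\<^sub>m D) $$ (r,c)) (at s)"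
    by (rule has_vector_derivative_cong_eventually[where f = "\<lambda>u. k * f u $$ (r,c)"],
        use assms rc in \<open>auto simp: mat_deriv_def intro!: has_vector_derivative_mult_right\<close>)
       (use assms(2) rc in \<open>auto elim!: eventually_mono\<close>)
qed (use assms in \<open>auto simp: mat_deriv_def\<close>)

lemma mat_deriv_minus:
  assumes "mat_deriv N f D s" "mat_deriv N g D' s" "\<forall>\<^sub>F u in nhds s. g u \<in> carrier_mat N N"
  shows "mat_deriv N (\<lambda>u. f u - g u) (D - D') s"
  unfolding mat_deriv_def
proof (intro conjI allI impI)
  fix r c assume rc: "r < N" "c < N"
  show "((\<lambda>u. (f u - g u) $$ (r,c)) has_vector_derivative (D - D') $$ (r,c)) (at s)"
    by (rule has_vector_derivative_cong_eventually[where f = "\<lambda>u. f u $$ (r,c) - g u $$ (r,c)"],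
        use assms rc in \<open>auto simp: mat_deriv_def intro!: has_vector_derivative_diff\<close>)
       (use assms(3) rc in \<open>auto elim!: eventually_mono\<close>)
qed (use assms in \<open>auto simp: mat_deriv_def\<close>)

lemma mat_deriv_transpose:
  assumes "mat_deriv N f D s" "\<forall>\<^sub>F u in nhds s. f u \<in> carrier_mat N N"
  shows "mat_deriv N (\<lambda>u. transpose_mat (f u)) (transpose_mat D) s"
  unfolding mat_deriv_def
proof (intro conjI allI impI)
  fix r c assume rc: "r < N" "c < N"
  show "((\<lambda>u. transpose_mat (f u) $$ (r,c)) has_vector_derivative transpose_mat D $$ (r,c)) (at s)"
    by (rule has_vector_derivative_cong_eventually[where f = "\<lambda>u. f u $$ (c,r)"],
        use assms rc in \<open>auto simp: mat_deriv_def\<close>)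
       (use assms(2) rc in \<open>auto elim!: eventually_mono\<close>)
qed (use assms in \<open>auto simp: mat_deriv_def\<close>)

lemma mult_mat_entry:
  "A \<in> carrier_mat n k \<Longrightarrow> B \<in> carrier_mat k l \<Longrightarrow> r < n \<Longrightarrow> c < l \<Longrightarrow>
    (A * B) $$ (r,c) = (\<Sum>i<k. A $$ (r,i) * B $$ (i,c))"
  by (auto simp: scalar_prod_def atLeast0LessThan intro!: sum.cong)

lemma mat_deriv_mult:
  assumes f: "mat_deriv N f D s" "\<forall>\<^sub>F u in nhds s. f u \<in> carrier_mat N N"
    and g: "mat_deriv N g D' s" "\<forall>\<^sub>F u in nhds s. g u \<in> carrier_mat N N"
  shows "mat_deriv N (\<lambda>u. f u * g u) (f s * D' + D * g s) s"
  unfolding mat_deriv_def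
proof (intro conjI allI impI)
  have c: "D \<in> carrier_mat N N" "D' \<in> carrier_mat N N" "f s \<in> carrier_mat N N" "g s \<in> carrier_mat N N"
    using f g eventually_nhds_x_imp_x by (auto simp: mat_deriv_def)
  thus "f s * D' + D * g s \<in> carrier_mat N N" by simp
  fix r c assume rc: "r < N" "c < N"
  show "((\<lambda>u. (f u * g u) $$ (r,c)) has_vector_derivative (f s * D' + D * g s) $$ (r,c)) (at s)"
  proof (rule has_vector_derivative_cong_eventually[where f = "\<lambda>u. \<Sum>i<N. f u $$ (r,i) * g u $$ (i,c)"])
    have "((\<lambda>u. \<Sum>i<N. f u $$ (r,i) * g u $$ (i,c)) has_vector_derivative
        (\<Sum>i<N. f s $$ (r,i) * D' $$ (i,c) + D $$ (r,i) * g s $$ (i,c))) (at s)"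
      using f(1) g(1) rc by (intro has_vector_derivative_sum has_vector_derivative_mult) (auto simp: mat_deriv_def)
    also have "(\<Sum>i<N. f s $$ (r,i) * D' $$ (i,c) + D $$ (r,i) * g s $$ (i,c)) = (f s * D' + D * g s) $$ (r,c)"
      using c rc by (simp add: mult_mat_entry[of _ N N _ N] sum.distrib del: index_mult_mat(1))
    finally show "((\<lambda>u. \<Sum>i<N. f u $$ (r,i) * g u $$ (i,c)) has_vector_derivative
        (f s * D' + D * g s) $$ (r,c)) (at s)" .
    show "\<forall>\<^sub>F u in nhds s. (\<Sum>i<N. f u $$ (r,i) * g u $$ (i,c)) = (f u * g u) $$ (r,c)"
      using f(2) g(2) by eventually_elim (use rc in \<open>auto simp: mult_mat_entry[of _ N N _ N] simp del: index_mult_mat(1)\<close>)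
  qed
qed

section \<open>Differentiability of determinants, adjugates and matrix quotients\<close>

lemma has_derivative_imp_has_vector_derivative:
  fixes f :: "real \<Rightarrow> 'a::real_normed_vector"
  assumes "(f has_derivative f') (at s)"
  shows "(f has_vector_derivative f' 1) (at s)"
proof -
  have "linear f'" using assms has_derivative_bounded_linear bounded_linear.linear by blast
  hence "f' x = x *\<^sub>R f' 1" for x
    using linear_scale[of f' x 1] by simp
  hence "f' = (\<lambda>x. x *\<^sub>R f' 1)" by (rule ext)
  with assms show ?thesis unfolding has_vector_derivative_def by simp
qed

lemma mat_differentiableI:
  fixes f :: "real \<Rightarrow> complex mat"
  assumes "\<And>r c. r < N \<Longrightarrow> c < N \<Longrightarrow> (\<lambda>u. f u $$ (r,c)) differentiable (at s)"
  shows "\<exists>D. mat_deriv N f D s"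
proof -
  have "\<exists>d. ((\<lambda>u. f u $$ (r,c)) has_vector_derivative d) (at s)" if "r < N" "c < N" for r c
    using assms[OF that] unfolding differentiable_def
    by (elim exE) (rule exI, erule has_derivative_imp_has_vector_derivative)
  then obtain d where d: "\<And>r c. r < N \<Longrightarrow> c < N \<Longrightarrow> ((\<lambda>u. f u $$ (r,c)) has_vector_derivative d r c) (at s)"
    by metis
  hence "mat_deriv N f (mat N N (\<lambda>(r,c). d r c)) s" by (auto simp: mat_deriv_def)
  thus ?thesis by blast
qed

lemma mat_deriv_differentiable:
  "mat_deriv N f D s \<Longrightarrow> r < N \<Longrightarrow> c < N \<Longrightarrow> (\<lambda>u. f u $$ (r,c)) differentiable (at s)"
  unfolding mat_deriv_def has_vector_derivative_def differentiable_def by blast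

lemma det_differentiable:
  fixes f :: "real \<Rightarrow> complex mat"
  assumes c: "\<And>u. f u \<in> carrier_mat n n"
    and d: "\<And>r c. r < n \<Longrightarrow> c < n \<Longrightarrow> (\<lambda>u. f u $$ (r,c)) differentiable (at s)"
  shows "(\<lambda>u. det (f u)) differentiable (at s)"
proof -
  have prod: "(\<lambda>u. \<Prod>i\<in>I. h i u) differentiable (at s)"
    if "\<And>i. i \<in> I \<Longrightarrow> h i differentiable (at s)" "finite I" for I and h :: "nat \<Rightarrow> real \<Rightarrow> complex"
    using that(2,1) by (induction I) (auto intro!: differentiable_mult)
  have "(\<lambda>u. \<Prod>i = 0..<n. f u $$ (i, p i)) differentiable (at s)" if "p permutes {0..<n}" for p
  proof (rule prod)
    fix i assume i: "i \<in> {0..<n}"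
    hence "p i \<in> {0..<n}" using that by (simp add: permutes_in_image)
    thus "(\<lambda>u. f u $$ (i, p i)) differentiable (at s)" using i by (auto intro!: d)
  qed simp
  hence "(\<lambda>u. \<Sum>p \<in> {p. p permutes {0..<n}}. signof p * (\<Prod>i = 0..<n. f u $$ (i, p i))) differentiable (at s)"
    by (intro differentiable_sum ballI differentiable_mult) (auto simp: finite_permutations)
  thus ?thesis unfolding det_def'[OF c] .
qed

lemma adj_mat_differentiable:
  fixes f :: "real \<Rightarrow> complex mat"
  assumes c: "\<And>u. f u \<in> carrier_mat n n"
    and d: "\<And>r c. r < n \<Longrightarrow> c < n \<Longrightarrow> (\<lambda>u. f u $$ (r,c)) differentiable (at s)"
    and rc: "r < n" "c < n"
  shows "(\<lambda>u. adj_mat (f u) $$ (r,c)) differentiable (at s)"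
proof -
  have dd: "(\<lambda>u. mat_delete (f u) c r $$ (i,j)) differentiable (at s)" if "i < n - 1" "j < n - 1" for i j
  proof -
    have "mat_delete (f u) c r $$ (i,j)
        = f u $$ (if i < c then i else Suc i, if j < r then j else Suc j)" for u
      using c[of u] that by (auto simp: mat_delete_def)
    thus ?thesis using that by (auto intro!: d)
  qed
  have "adj_mat (f u) $$ (r,c) = (-1) ^ (c + r) * det (mat_delete (f u) c r)" for u
    using c[of u] rc by (simp add: adj_mat_def cofactor_def)
  moreover have "(\<lambda>u. det (mat_delete (f u) c r)) differentiable (at s)"
    by (rule det_differentiable[where n = "n - 1"]) (use mat_delete_carrier[OF c] dd in auto)
  ultimately show ?thesis by simp
qed

text \<open>Cramer's rule near \<open>s\<close>: \<open>h\<close> equals f adj(g) / det g, and det g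
  stays nonzero by continuity. It serves to differentiate an \<open>h\<close> that is known only
  through the equation h g = f.\<close>

lemma quotient_differentiable:
  fixes f g :: "real \<Rightarrow> complex mat"
  assumes f: "mat_deriv N f D s" "\<And>u. f u \<in> carrier_mat N N"
    and g: "mat_deriv N g D' s" "\<And>u. g u \<in> carrier_mat N N" "det (g s) \<noteq> 0"
    and h: "\<forall>\<^sub>F u in nhds s. h u \<in> carrier_mat N N \<and> h u * g u = f u"
  shows "\<exists>D. mat_deriv N h D s"
proof -
  note df = mat_deriv_differentiable[OF f(1)] and dg = mat_deriv_differentiable[OF g(1)]
  have ddet: "(\<lambda>u. det (g u)) differentiable (at s)" by (rule det_differentiable[OF g(2) dg])
  have "isCont (\<lambda>u. det (g u)) s" using ddet has_derivative_continuous unfolding differentiable_def by blast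
  hence "\<forall>\<^sub>F u in at s. det (g u) \<noteq> 0"
    using g(3) by (intro tendsto_imp_eventually_ne) (auto simp: isCont_def)
  hence nz: "\<forall>\<^sub>F u in nhds s. det (g u) \<noteq> 0" using g(3) by (simp add: eventually_nhds_conv_at)
  have "\<exists>E. mat_deriv N (\<lambda>u. inverse (det (g u)) \<cdot>\<^sub>m (f u * adj_mat (g u))) E s"
  proof (rule mat_differentiableI)
    fix r c assume rc: "r < N" "c < N"
    have "(inverse (det (g u)) \<cdot>\<^sub>m (f u * adj_mat (g u))) $$ (r,c)
        = inverse (det (g u)) * (\<Sum>i<N. f u $$ (r,i) * adj_mat (g u) $$ (i,c))" for u
      using f(2)[of u] adj_mat(1)[OF g(2)[of u]] rc
      by (simp add: mult_mat_entry[of _ N N _ N] del: index_mult_mat(1))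
    thus "(\<lambda>u. (inverse (det (g u)) \<cdot>\<^sub>m (f u * adj_mat (g u))) $$ (r,c)) differentiable (at s)"
      using rc by (auto intro!: differentiable_mult differentiable_inverse differentiable_sum
          ddet g(3) df adj_mat_differentiable[OF g(2) dg])
  qed
  then obtain E where "mat_deriv N (\<lambda>u. inverse (det (g u)) \<cdot>\<^sub>m (f u * adj_mat (g u))) E s" by blast
  moreover have "\<forall>\<^sub>F u in nhds s. inverse (det (g u)) \<cdot>\<^sub>m (f u * adj_mat (g u)) = h u"
    using nz h
  proof eventually_elim
    case (elim u)
    have "f u * adj_mat (g u) = h u * (g u * adj_mat (g u))"
      using elim assoc_mult_mat[of "h u" N N "g u" N "adj_mat (g u)" N] adj_mat(1)[OF g(2)[of u]] g(2)[of u]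
      by simp
    also have "\<dots> = det (g u) \<cdot>\<^sub>m h u"
      using elim unfolding adj_mat(2)[OF g(2)] by (auto simp: mult_smult_distrib[of _ N N _ N] right_mult_one_mat[of _ N N])
    finally show ?case using elim by (auto intro!: eq_matI)
  qed
  ultimately show ?thesis using mat_deriv_cong by blast
qed

section \<open>Laurent series matrices\<close>

text \<open>The range of summation is fixed by the bounds \<open>d\<close> and \<open>e\<close>
  instead of the subdegrees, which may jump when the series vary with a parameter; a coefficient of
  a product can then be differentiated term by term.\<close>

lemma fls_times_nth_bounded:
  fixes f g :: "'a::comm_ring_1 fls"
  assumes "\<And>k. k < d \<Longrightarrow> fls_nth f k = 0" "\<And>k. k < e \<Longrightarrow> fls_nth g k = 0"
  shows "fls_nth (f * g) n = (\<Sum>i = d..n - e. fls_nth f i * fls_nth g (n - i))"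
proof -
  let ?h = "\<lambda>i. fls_nth f i * fls_nth g (n - i)"
  have "fls_nth (f * g) n = (\<Sum>i = fls_subdegree f..n - fls_subdegree g. ?h i)"
    unfolding fls_times_nth(2)
    by (rule sum.reindex_bij_witness[of _ "\<lambda>i. i" "\<lambda>i. i"]) auto
  also have "\<dots> = sum ?h ({fls_subdegree f..n - fls_subdegree g} \<inter> {d..n - e})"
    by (rule sum.mono_neutral_right) (use assms in \<open>auto simp: not_le\<close>)
  also have "\<dots> = (\<Sum>i = d..n - e. ?h i)"
    by (rule sum.mono_neutral_left) (auto simp: not_le)
  finally show ?thesis .
qed

text \<open>The order is taken in mu = 1/lambda, so no power of lambda above -d occurs: d = 1 means
  strictly negative powers of lambda, d = -1 is the growth of J.\<close>

definition ord_ge :: "nat \<Rightarrow> int \<Rightarrow> complex fls mat \<Rightarrow> bool" where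
  "ord_ge N d X \<longleftrightarrow> X \<in> carrier_mat N N \<and> (\<forall>r<N. \<forall>c<N. \<forall>k<d. fls_nth (X $$ (r,c)) k = 0)"

lemma ord_geD: "ord_ge N d X \<Longrightarrow> r < N \<Longrightarrow> c < N \<Longrightarrow> k < d \<Longrightarrow> fls_nth (X $$ (r,c)) k = 0"
  by (auto simp: ord_ge_def)

lemma ord_ge_carrier: "ord_ge N d X \<Longrightarrow> X \<in> carrier_mat N N"
  by (auto simp: ord_ge_def)

lemma ord_ge_mono: "ord_ge N d X \<Longrightarrow> e \<le> d \<Longrightarrow> ord_ge N e X"
  by (auto simp: ord_ge_def)

lemma ord_ge_add: "ord_ge N d X \<Longrightarrow> ord_ge N d Y \<Longrightarrow> ord_ge N d (X + Y)"
  and ord_ge_minus: "ord_ge N d X \<Longrightarrow> ord_ge N d Y \<Longrightarrow> ord_ge N d (X - Y)"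
  by (auto simp: ord_ge_def)

lemma mult_mat_entry_nth:
  assumes X: "ord_ge N d X" and Y: "ord_ge N e Y" and rc: "r < N" "c < N"
  shows "fls_nth ((X * Y) $$ (r,c)) n = (\<Sum>i<N. \<Sum>k = d..n - e. fls_nth (X $$ (r,i)) k * fls_nth (Y $$ (i,c)) (n - k))"
proof -
  have "fls_nth ((X * Y) $$ (r,c)) n = (\<Sum>i<N. fls_nth (X $$ (r,i) * Y $$ (i,c)) n)"
    using rc X Y by (simp add: mult_mat_entry[of _ N N _ N] ord_ge_carrier fls_nth_sum del: index_mult_mat(1))
  also have "\<dots> = (\<Sum>i<N. \<Sum>k = d..n - e. fls_nth (X $$ (r,i)) k * fls_nth (Y $$ (i,c)) (n - k))"
    using rc X Y by (intro sum.cong refl fls_times_nth_bounded) (auto intro: ord_geD)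
  finally show ?thesis .
qed

lemma ord_ge_mult: "ord_ge N d X \<Longrightarrow> ord_ge N e Y \<Longrightarrow> ord_ge N (d + e) (X * Y)"
  unfolding ord_ge_def[of N "d + e"]
  using ord_ge_carrier[of N d X] ord_ge_carrier[of N e Y]
  by (auto simp: mult_mat_entry_nth[of N d X e Y] simp del: index_mult_mat(1))

lemma ser_coeff_carrier [simp]: "X \<in> carrier_mat n k \<Longrightarrow> ser_coeff X i \<in> carrier_mat n k"
  by (auto simp: ser_coeff_def)

lemma ser_coeff_nth [simp]:
  "r < dim_row X \<Longrightarrow> c < dim_col X \<Longrightarrow> ser_coeff X i $$ (r,c) = fls_nth (X $$ (r,c)) (- i)"
  "dim_row (ser_coeff X i) = dim_row X" "dim_col (ser_coeff X i) = dim_col X"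
  by (auto simp: ser_coeff_def)

lemma ser_coeff_add:
  "X \<in> carrier_mat n k \<Longrightarrow> Y \<in> carrier_mat n k \<Longrightarrow> ser_coeff (X + Y) i = ser_coeff X i + ser_coeff Y i"
  by (rule eq_matI) auto

lemma ser_coeff_minus:
  "X \<in> carrier_mat n k \<Longrightarrow> Y \<in> carrier_mat n k \<Longrightarrow> ser_coeff (X - Y) i = ser_coeff X i - ser_coeff Y i"
  by (rule eq_matI) auto

lemma ser_coeff_mult_lead:
  assumes X: "ord_ge N d X" and Y: "ord_ge N e Y" and n: "n = - (d + e)"
  shows "ser_coeff (X * Y) n = ser_coeff X (- d) * ser_coeff Y (- e)"
proof (rule eq_matI)
  note c = ord_ge_carrier[OF X] ord_ge_carrier[OF Y]
  fix r s assume "r < dim_row (ser_coeff X (- d) * ser_coeff Y (- e))"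
    "s < dim_col (ser_coeff X (- d) * ser_coeff Y (- e))"
  hence rs: "r < N" "s < N" using c by auto
  have "ser_coeff (X * Y) n $$ (r,s) = fls_nth ((X * Y) $$ (r,s)) (d + e)"
    using rs c n by (simp add: add.commute)
  also have "\<dots> = (\<Sum>i<N. fls_nth (X $$ (r,i)) d * fls_nth (Y $$ (i,s)) e)"
    using mult_mat_entry_nth[OF X Y rs, of "d + e"] by simp
  also have "\<dots> = (ser_coeff X (- d) * ser_coeff Y (- e)) $$ (r,s)"
    using c rs by (simp add: mult_mat_entry[of _ N N _ N] del: index_mult_mat(1))
  finally show "ser_coeff (X * Y) n $$ (r,s) = (ser_coeff X (- d) * ser_coeff Y (- e)) $$ (r,s)" .
qed (use ord_ge_carrier[OF X] ord_ge_carrier[OF Y] in auto)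

lemma ord_ge_smult:
  assumes k: "\<And>i. i < e \<Longrightarrow> fls_nth k i = 0" and X: "ord_ge N d X"
  shows "ord_ge N (e + d) (k \<cdot>\<^sub>m X)"
  unfolding ord_ge_def
proof (intro conjI allI impI)
  fix r c n assume "r < N" "c < N" "n < e + d"
  thus "fls_nth ((k \<cdot>\<^sub>m X) $$ (r,c)) n = 0"
    using fls_times_nth_bounded[of e k d "X $$ (r,c)" n] k ord_geD[OF X] ord_ge_carrier[OF X] by auto
qed (use X in \<open>auto simp: ord_ge_def\<close>)

lemma ser_coeff_smult_lead:
  assumes k: "\<And>i. i < e \<Longrightarrow> fls_nth k i = 0" and X: "ord_ge N d X" and n: "n = - (e + d)"
  shows "ser_coeff (k \<cdot>\<^sub>m X) n = fls_nth k e \<cdot>\<^sub>m ser_coeff X (- d)"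
proof (rule eq_matI)
  fix r c assume "r < dim_row (fls_nth k e \<cdot>\<^sub>m ser_coeff X (- d))" "c < dim_col (fls_nth k e \<cdot>\<^sub>m ser_coeff X (- d))"
  hence "r < N" "c < N" using ord_ge_carrier[OF X] by auto
  thus "ser_coeff (k \<cdot>\<^sub>m X) n $$ (r,c) = (fls_nth k e \<cdot>\<^sub>m ser_coeff X (- d)) $$ (r,c)"
    using fls_times_nth_bounded[of e k d "X $$ (r,c)" "e + d"] k ord_geD[OF X] ord_ge_carrier[OF X] n
    by (auto simp: add.commute[of d e])
qed auto

interpretation fls_const: comm_ring_hom "fls_const :: complex \<Rightarrow> complex fls"
  by unfold_locales (simp_all flip: fls_plus_const)

lemma cser_carrier [simp]: "cser A \<in> carrier_mat n k \<longleftrightarrow> A \<in> carrier_mat n k"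
  by (simp add: cser_def)

lemma cser_index [simp]:
  "r < dim_row A \<Longrightarrow> c < dim_col A \<Longrightarrow> cser A $$ (r,c) = fls_const (A $$ (r,c))"
  "dim_row (cser A) = dim_row A" "dim_col (cser A) = dim_col A"
  by (auto simp: cser_def)

lemma cser_hom:
  "A \<in> carrier_mat N N \<Longrightarrow> B \<in> carrier_mat N N \<Longrightarrow> cser (A + B) = cser A + cser B"
  "A \<in> carrier_mat N N \<Longrightarrow> B \<in> carrier_mat N N \<Longrightarrow> cser (A - B) = cser A - cser B"
  "A \<in> carrier_mat N N \<Longrightarrow> B \<in> carrier_mat N N \<Longrightarrow> cser (A * B) = cser A * cser B"
  "cser (c \<cdot>\<^sub>m A) = fls_const c \<cdot>\<^sub>m cser A" "cser (1\<^sub>m N) = 1\<^sub>m N"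
  unfolding cser_def
  by (simp_all add: fls_const.mat_hom_add fls_const.mat_hom_minus fls_const.mat_hom_mult
      fls_const.mat_hom_smult fls_const.mat_hom_one)

lemma ord_ge_cser: "A \<in> carrier_mat N N \<Longrightarrow> ord_ge N 0 (cser A)"
  by (auto simp: ord_ge_def)

lemma ser_coeff_cser_mult:
  assumes "A \<in> carrier_mat N N" "X \<in> carrier_mat N N"
  shows "ser_coeff (cser A * X) i = A * ser_coeff X i" "ser_coeff (X * cser A) i = ser_coeff X i * A"
  using assms by (auto intro!: eq_matI simp: mult_mat_entry[of _ N N _ N] fls_nth_sum simp del: index_mult_mat(1))

lemma ser_coeff_X_inv: "ser_coeff (fls_X_inv \<cdot>\<^sub>m X) i = ser_coeff X (i - 1)"
  by (rule eq_matI) (auto simp: fls_X_inv_times_conv_shift)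

text \<open>The nonnegative part in lambda as a genuine polynomial; beyond the pole order the
  coefficients vanish, so the cutoff loses nothing.\<close>

definition pospart :: "complex fls \<Rightarrow> complex poly" where
  "pospart f = (\<Sum>i\<le>nat (- fls_subdegree f). monom (fls_nth f (- int i)) i)"

lemma coeff_pospart: "coeff (pospart f) i = fls_nth f (- int i)"
proof -
  have "coeff (pospart f) i = (if i \<le> nat (- fls_subdegree f) then fls_nth f (- int i) else 0)"
    unfolding pospart_def by (simp add: coeff_sum)
  thus ?thesis by auto
qed

lemma ord_ge_pospart:
  "X \<in> carrier_mat N N \<Longrightarrow> ord_ge N 1 (X - map_mat lampoly (map_mat pospart X))"
  by (auto simp: ord_ge_def lampoly_nth coeff_pospart)

lemma sum_nonneg_powers_eq_poly:
  fixes f :: "complex fls"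
  assumes "\<And>k. k \<le> 0 \<Longrightarrow> fls_nth f k = coeff p (nat (- k))"
  shows "(\<Sum>k\<in>{fls_subdegree f..0}. fls_nth f k * z ^ nat (- k)) = poly p z"
proof -
  define M where "M = max (nat (- fls_subdegree f)) (degree p)"
  have "(\<Sum>k\<in>{fls_subdegree f..0}. fls_nth f k * z ^ nat (- k))
      = (\<Sum>k\<in>{- int M..0}. fls_nth f k * z ^ nat (- k))"
    by (rule sum.mono_neutral_left) (auto simp: M_def)
  also have "\<dots> = (\<Sum>i\<le>M. coeff p i * z ^ i)"
    by (rule sum.reindex_bij_witness[of _ "\<lambda>i. - int i" "\<lambda>k. nat (- k)"]) (auto simp: assms)
  also have "\<dots> = (\<Sum>i\<le>degree p. coeff p i * z ^ i)"
    by (rule sum.mono_neutral_right) (auto simp: M_def coeff_eq_0)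
  finally show ?thesis by (simp add: poly_altdef)
qed

text \<open>Only one polynomial differs from \<open>X\<close> by strictly negative powers of lambda,
  so exhibiting such a \<open>T\<close> determines the positive part.\<close>

lemma ser_pos_eval_eq:
  assumes T: "T \<in> carrier_mat N N" and X: "X \<in> carrier_mat N N" and o: "ord_ge N 1 (X - map_mat lampoly T)"
  shows "ser_pos_eval X z = map_mat (\<lambda>p. poly p z) T"
proof (rule eq_matI)
  fix r c assume "r < dim_row (map_mat (\<lambda>p. poly p z) T)" "c < dim_col (map_mat (\<lambda>p. poly p z) T)"
  hence rc: "r < N" "c < N" using T by auto
  have "fls_nth (X $$ (r,c)) k = coeff (T $$ (r,c)) (nat (- k))" if "k \<le> 0" for k
    using ord_geD[OF o rc, of k] that rc T X by (simp add: lampoly_nth)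
  thus "ser_pos_eval X z $$ (r,c) = map_mat (\<lambda>p. poly p z) T $$ (r,c)"
    unfolding ser_pos_eval_def using rc T X sum_nonneg_powers_eq_poly[of "X $$ (r,c)"] by simp
qed (use T X in \<open>auto simp: ser_pos_eval_def\<close>)

section \<open>The simple factor expanded at infinity\<close>

lemma fls_X_inv_neq_const: "fls_X_inv \<noteq> fls_const c" for c :: complex
proof
  assume "(fls_X_inv :: complex fls) = fls_const c"
  hence "fls_nth (fls_X_inv :: complex fls) (-1) = fls_nth (fls_const c) (-1)" by simp
  thus False by simp
qed

text \<open>c/(lambda - a) = c mu + a c mu^2 + ...; multiplication by lambda - a turns this into a
  first-order recursion for the coefficients, with c entering only at the step from index 0 to index
  1.\<close>

lemma dressing_scalar_nth:
  fixes c a :: complex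
  shows "i < 1 \<Longrightarrow> fls_nth (fls_const c / (fls_X_inv - fls_const a)) i = 0"
    and "fls_nth (fls_const c / (fls_X_inv - fls_const a)) 1 = c"
proof -
  define k where "k = fls_const c / (fls_X_inv - fls_const a)"
  have nz: "fls_X_inv - fls_const a \<noteq> 0"
    by (simp add: fls_X_inv_neq_const)
  hence k: "k * (fls_X_inv - fls_const a) = fls_const c" by (simp add: k_def)
  have e: "fls_nth k (i + 1) - fls_nth k i * a = (if i = 0 then c else 0)" for i
  proof -
    have "fls_nth (k * (fls_X_inv - fls_const a)) i = fls_nth (fls_const c) i" by (simp only: k)
    thus ?thesis by (simp add: right_diff_distrib fls_X_inv_times_conv_shift)
  qed
  have z: "fls_nth k i = 0" if "i < 1" for i
  proof -
    \<comment> \<open>A start below the subdegree and not above \<open>i\<close>; from there the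
      recursion carries the value 0 upwards through index 0.\<close>
    define m where "m = min (fls_subdegree k - 1) i"
    have "m \<le> i" "fls_nth k m = 0" by (auto simp: m_def)
    have "\<forall>j. m \<le> j \<and> j < 1 \<longrightarrow> fls_nth k j = 0"
    proof (intro allI impI, elim conjE)
      fix j assume "m \<le> j" "j < 1"
      thus "fls_nth k j = 0"
      proof (induction j rule: int_ge_induct)
        case (step j) thus ?case using e[of j] by auto
      qed (use \<open>fls_nth k m = 0\<close> in simp)
    qed
    thus ?thesis using that \<open>m \<le> i\<close> by blast
  qed
  show "i < 1 \<Longrightarrow> fls_nth (fls_const c / (fls_X_inv - fls_const a)) i = 0"
    using z by (simp add: k_def)
  show "fls_nth (fls_const c / (fls_X_inv - fls_const a)) 1 = c"
    using e[of 0] z[of 0] by (simp add: k_def)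
qed

definition Kser :: "nat \<Rightarrow> complex \<Rightarrow> complex mat \<Rightarrow> complex fls mat" where
  "Kser N a R = gk N (fls_const a) (cser R) fls_X_inv"

lemma Kser_carrier [simp]: "R \<in> carrier_mat N N \<Longrightarrow> Kser N a R \<in> carrier_mat N N"
  by (simp add: Kser_def)

lemma Kser_eq: "Kser N a R = 1\<^sub>m N + (fls_const (2 * a) / (fls_X_inv - fls_const a)) \<cdot>\<^sub>m (1\<^sub>m N - cser R)"
  by (simp add: Kser_def gk_def flip: fls_const_mult_const)

lemma ord_ge_one: "ord_ge N 0 (1\<^sub>m N)"
  by (auto simp: ord_ge_def)

lemma ser_coeff_one: "ser_coeff (1\<^sub>m N) 0 = 1\<^sub>m N"
  by (rule eq_matI) auto

lemma ord_ge_Kser: "R \<in> carrier_mat N N \<Longrightarrow> ord_ge N 0 (Kser N a R)"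
  unfolding Kser_eq
  by (intro ord_ge_add ord_ge_one ord_ge_mono[OF ord_ge_smult[where e = 1 and d = 0]] ord_ge_minus ord_ge_cser)
     (auto simp: dressing_scalar_nth)

lemma ser_coeff_Kser:
  assumes R: "R \<in> carrier_mat N N"
  shows "ser_coeff (Kser N a R) 0 = 1\<^sub>m N"
proof -
  define M where "M = (fls_const (2 * a) / (fls_X_inv - fls_const a)) \<cdot>\<^sub>m (1\<^sub>m N - cser R)"
  have o: "ord_ge N 1 M" unfolding M_def
    using ord_ge_smult[of 1 "fls_const (2 * a) / (fls_X_inv - fls_const a)" N 0 "1\<^sub>m N - cser R"] R
    by (simp add: dressing_scalar_nth ord_ge_minus ord_ge_one ord_ge_cser)
  hence "ser_coeff M 0 = 0\<^sub>m N N"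
    using ord_ge_carrier[OF o] by (intro eq_matI) (auto simp: ord_ge_def)
  thus ?thesis unfolding Kser_eq M_def[symmetric]
    using ord_ge_carrier[OF o] by (simp add: ser_coeff_add[of _ N N] ser_coeff_one)
qed

lemma Kser_inverse:
  assumes "R \<in> carrier_mat N N" "R * R = R" "0 < N"
  shows "Kser N a R * Kser N (- a) R = 1\<^sub>m N"
  using assms gk_inverse[of "cser R" N fls_X_inv "fls_const a"] cser_hom(3)[of R N R] fls_X_inv_neq_const[of "- a"]
  by (simp add: Kser_def fls_X_inv_neq_const)

lemma map_lampoly_cpoly_mat: "map_mat lampoly (cpoly_mat A) = cser A"
  by (rule eq_matI) (auto simp: cpoly_mat_def)

text \<open>Dressing by \<open>K\<close> maps the polynomial part of \<open>X\<close> to that of \<open>K X K\<^sup>-\<^sup>1\<close>, as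
  \<open>K B K\<^sup>-\<^sup>1 - K' K\<^sup>-\<^sup>1\<close> has no pole at \<open>\<plusminus>\<alpha>\<close>; comparing coefficients of \<open>\<lambda>\<^sup>-\<^sup>1\<close> relates
  the next coefficients of the two series.\<close>

lemma dressing:
  fixes a :: complex
  defines "ev \<equiv> \<lambda>z. map_mat (\<lambda>p. poly p z)"
  assumes c: "R \<in> carrier_mat N N" "B \<in> carrier_mat N N" "D \<in> carrier_mat N N" "0 < N" and a: "a \<noteq> 0"
    and R: "R * R = R"
    and z1: "(1\<^sub>m N - R) * (ev a B * R + D) = 0\<^sub>m N N"
    and z2: "R * (ev (- a) B * (1\<^sub>m N - R) - D) = 0\<^sub>m N N"
    and X: "X \<in> carrier_mat N N" and o: "ord_ge N 1 (X - map_mat lampoly B)"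
  shows "z \<noteq> a \<Longrightarrow> z \<noteq> - a \<Longrightarrow> ser_pos_eval (Kser N a R * X * Kser N (- a) R) z
      = gk N a R z * ev z B * gk N (- a) R z + (2 * a / (z + a)) \<cdot>\<^sub>m (gk N a R z * D)" (is "_ \<Longrightarrow> _ \<Longrightarrow> ?P")
    and "ser_coeff (Kser N a R * X * Kser N (- a) R) (- 1) = ser_coeff X (- 1) - (2 * a) \<cdot>\<^sub>m D" (is ?Q)
proof -
  obtain T where T: "T \<in> carrier_mat N N"
    "dress_num N [:0, 1:] [:a:] (cpoly_mat R) B (cpoly_mat D) = ([:- a, 1:] * [:a, 1:]) \<cdot>\<^sub>m T"
    using dress_polynomial[OF c a z1[unfolded ev_def] z2[unfolded ev_def]] by blast
  define K K' where "K = Kser N a R" and "K' = Kser N (- a) R"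
  define k where "k = fls_const (2 * a) / (fls_X_inv - fls_const (- a))"
  define Z where "Z = X - map_mat lampoly B"
  have cc: "K \<in> carrier_mat N N" "K' \<in> carrier_mat N N" "Z \<in> carrier_mat N N" "map_mat lampoly B \<in> carrier_mat N N"
    "cser D \<in> carrier_mat N N" using c X by (auto simp: K_def K'_def Z_def)
  have LT: "map_mat lampoly T = K * map_mat lampoly B * K' + k \<cdot>\<^sub>m (K * cser D)"
    using dress_polynomial_hom[OF lampoly.comm_ring_hom_axioms c(1,2,3) T(1) c(4) T(2) lampoly_X lampoly_const
        fls_X_inv_neq_const _ map_lampoly_cpoly_mat map_lampoly_cpoly_mat] fls_X_inv_neq_const[of "- a"]
    by (simp add: K_def K'_def k_def Kser_def flip: fls_const_mult_const)
  have "X = Z + map_mat lampoly B" using c X by (auto simp: Z_def)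
  \<comment> \<open>Both terms on the right have only negative powers of lambda, so \<open>T\<close>
    is the positive part of K X K^-1.\<close>
  hence eq: "K * X * K' - map_mat lampoly T = K * Z * K' - k \<cdot>\<^sub>m (K * cser D)"
    unfolding LT using cc
    by (simp add: mult_add_distrib_mat[of _ N N _ N] add_mult_distrib_mat[of _ N N _ _ N] del: assoc_mult_mat)
       (auto intro!: eq_matI)
  have k: "\<And>i. i < 1 \<Longrightarrow> fls_nth k i = 0" "fls_nth k 1 = 2 * a"
    unfolding k_def by (rule dressing_scalar_nth, assumption, rule dressing_scalar_nth)
  have oK: "ord_ge N 0 K" "ord_ge N 0 K'" and oZ: "ord_ge N 1 Z" and oD: "ord_ge N 0 (K * cser D)"
    using o c ord_ge_mult[of N 0 K 0 "cser D"] by (simp_all add: K_def K'_def Z_def ord_ge_Kser ord_ge_cser)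
  have o1: "ord_ge N 1 (K * Z)" "ord_ge N 1 (K * Z * K')" "ord_ge N 1 (k \<cdot>\<^sub>m (K * cser D))"
    using ord_ge_mult[OF oK(1) oZ] ord_ge_mult[OF ord_ge_mult[OF oK(1) oZ] oK(2)] ord_ge_smult[of 1 k, OF k(1) oD] by simp_all
  have oT: "ord_ge N 1 (K * X * K' - map_mat lampoly T)"
    unfolding eq using o1 by (intro ord_ge_minus)
  have cX: "K * X * K' \<in> carrier_mat N N" using cc X by simp
  {
    assume z: "z \<noteq> a" "z \<noteq> - a"
    have "ser_pos_eval (K * X * K') z = ev z T"
      unfolding ev_def by (rule ser_pos_eval_eq[OF T(1) cX oT])
    also have "\<dots> = gk N a R z * ev z B * gk N (- a) R z + (2 * a / (z + a)) \<cdot>\<^sub>m (gk N a R z * D)"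
      unfolding ev_def
      by (rule dress_polynomial_hom[OF poly_eval.comm_ring_hom_axioms c(1,2,3) T(1) c(4) T(2)])
         (use z in \<open>simp_all add: poly_eval_cpoly_mat\<close>)
    finally show ?P unfolding K_def K'_def .
  }
  have mz: "M - 0\<^sub>m N N = M" if "M \<in> carrier_mat N N" for M :: "complex mat"
    using that by (intro eq_matI) auto
  have lp: "ser_coeff (map_mat lampoly M) (- 1) = 0\<^sub>m N N" if "M \<in> carrier_mat N N" for M
    using that by (intro eq_matI) (auto simp: lampoly_nth)
  have K0: "ser_coeff K 0 = 1\<^sub>m N" "ser_coeff K' 0 = 1\<^sub>m N"
    using c by (auto simp: K_def K'_def ser_coeff_Kser)
  \<comment> \<open>At lambda^-1 the polynomial \<open>T\<close> contributes nothing. As K = 1 +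
    O(mu), the first term contributes the coefficient of \<open>Z\<close>, which is that of
    \<open>X\<close>, and the second the leading coefficient 2a D.\<close>
  have "ser_coeff (K * X * K') (- 1) = ser_coeff (K * X * K' - map_mat lampoly T) (- 1)"
    using cX T(1) lp[OF T(1)] by (simp add: ser_coeff_minus[of _ N N] mz del: assoc_mult_mat)
  also have "\<dots> = ser_coeff (K * Z * K') (- 1) - ser_coeff (k \<cdot>\<^sub>m (K * cser D)) (- 1)"
    unfolding eq using cc by (intro ser_coeff_minus[of _ N N]) simp_all
  also have "ser_coeff (K * Z * K') (- 1) = ser_coeff Z (- 1)"
    using ser_coeff_mult_lead[OF o1(1) oK(2), of "-1"] ser_coeff_mult_lead[OF oK(1) oZ, of "-1"] K0 cc
    by (simp add: left_mult_one_mat[of _ N N] right_mult_one_mat[of _ N N])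
  also have "ser_coeff Z (- 1) = ser_coeff X (- 1)"
    unfolding Z_def using X c(2) lp[OF c(2)] by (simp add: ser_coeff_minus[of _ N N] mz)
  also have "ser_coeff (k \<cdot>\<^sub>m (K * cser D)) (- 1) = (2 * a) \<cdot>\<^sub>m D"
    using ser_coeff_smult_lead[of 1 k N 0 "K * cser D" "-1", OF k(1) oD] ser_coeff_cser_mult(2)[OF c(3) cc(1), of 0] K0 c k(2)
    by (simp add: left_mult_one_mat[of _ N N])
  finally show ?Q unfolding K_def K'_def .
qed

section \<open>Derivatives of Laurent series matrices\<close>

lemma ser_deriv_carrier: "ser_deriv N f D s \<Longrightarrow> D \<in> carrier_mat N N"
  by (simp add: ser_deriv_def)

lemma ser_deriv_cong:
  assumes "ser_deriv N f D s" "\<forall>\<^sub>F u in nhds s. f u = g u"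
  shows "ser_deriv N g D s"
  unfolding ser_deriv_def
proof (intro conjI allI impI)
  fix r c k assume "r < N" "c < N"
  hence "((\<lambda>u. fls_nth (f u $$ (r,c)) k) has_vector_derivative fls_nth (D $$ (r,c)) k) (at s)"
    using assms(1) by (simp add: ser_deriv_def)
  thus "((\<lambda>u. fls_nth (g u $$ (r,c)) k) has_vector_derivative fls_nth (D $$ (r,c)) k) (at s)"
    by (rule has_vector_derivative_cong_eventually) (use assms(2) in \<open>auto elim: eventually_mono\<close>)
qed (use assms(1) in \<open>simp add: ser_deriv_def\<close>)

text \<open>Coefficients below order \<open>d\<close> vanish identically near \<open>s\<close>,
  hence so do their derivatives.\<close>

lemma ser_deriv_ord:
  assumes "ser_deriv N f D s" "\<forall>\<^sub>F u in nhds s. ord_ge N d (f u)"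
  shows "ord_ge N d D"
  unfolding ord_ge_def
proof (intro conjI allI impI)
  fix r c k assume rc: "r < N" "c < N" "k < d"
  hence "((\<lambda>u. fls_nth (f u $$ (r,c)) k) has_vector_derivative fls_nth (D $$ (r,c)) k) (at s)"
    using assms(1) by (simp add: ser_deriv_def)
  hence "((\<lambda>u. 0) has_vector_derivative fls_nth (D $$ (r,c)) k) (at s)"
    by (rule has_vector_derivative_cong_eventually)
       (use assms(2) rc in \<open>auto simp: ord_ge_def elim: eventually_mono\<close>)
  thus "fls_nth (D $$ (r,c)) k = 0"
    using has_vector_derivative_unique has_vector_derivative_const by blast
qed (use assms(1) in \<open>simp add: ser_deriv_def\<close>)

text \<open>With order bounds uniform near \<open>s\<close>, each coefficient of the product is a
  finite sum over a fixed range, to which the ordinary product rule applies.\<close>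

lemma ser_deriv_mult:
  assumes f: "ser_deriv N f D s" "\<forall>\<^sub>F u in nhds s. ord_ge N d (f u)"
    and g: "ser_deriv N g D' s" "\<forall>\<^sub>F u in nhds s. ord_ge N e (g u)"
  shows "ser_deriv N (\<lambda>u. f u * g u) (f s * D' + D * g s) s"
  unfolding ser_deriv_def
proof (intro conjI allI impI)
  have of: "ord_ge N d (f s)" "ord_ge N d D" and og: "ord_ge N e (g s)" "ord_ge N e D'"
    using f g eventually_nhds_x_imp_x ser_deriv_ord by blast+
  note cc = of[THEN ord_ge_carrier] og[THEN ord_ge_carrier]
  show "f s * D' + D * g s \<in> carrier_mat N N" using cc by simp
  fix r c n assume rc: "r < N" "c < N"
  let ?p = "\<lambda>A B. \<Sum>i<N. \<Sum>k = d..n - e. fls_nth (A $$ (r,i)) k * fls_nth (B $$ (i,c)) (n - k)"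
  show "((\<lambda>u. fls_nth ((f u * g u) $$ (r,c)) n) has_vector_derivative
      fls_nth ((f s * D' + D * g s) $$ (r,c)) n) (at s)"
  proof (rule has_vector_derivative_cong_eventually)
    have "((\<lambda>u. ?p (f u) (g u)) has_vector_derivative
        (\<Sum>i<N. \<Sum>k = d..n - e. fls_nth (f s $$ (r,i)) k * fls_nth (D' $$ (i,c)) (n - k)
          + fls_nth (D $$ (r,i)) k * fls_nth (g s $$ (i,c)) (n - k))) (at s)"
      using f(1) g(1) rc
      by (intro has_vector_derivative_sum has_vector_derivative_mult) (auto simp: ser_deriv_def)
    also have "(\<Sum>i<N. \<Sum>k = d..n - e. fls_nth (f s $$ (r,i)) k * fls_nth (D' $$ (i,c)) (n - k)
          + fls_nth (D $$ (r,i)) k * fls_nth (g s $$ (i,c)) (n - k)) = ?p (f s) D' + ?p D (g s)"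
      by (simp add: sum.distrib)
    also have "\<dots> = fls_nth ((f s * D' + D * g s) $$ (r,c)) n"
      using cc rc mult_mat_entry_nth[OF of(1) og(2) rc] mult_mat_entry_nth[OF of(2) og(1) rc]
      by (simp del: index_mult_mat(1))
    finally show "((\<lambda>u. ?p (f u) (g u)) has_vector_derivative
        fls_nth ((f s * D' + D * g s) $$ (r,c)) n) (at s)" .
    show "\<forall>\<^sub>F u in nhds s. ?p (f u) (g u) = fls_nth ((f u * g u) $$ (r,c)) n"
      using f(2) g(2) by eventually_elim (simp only: mult_mat_entry_nth rc)
  qed
qed

lemma mat_deriv_ser_coeff:
  assumes "ser_deriv N f D s" "\<forall>\<^sub>F u in nhds s. f u \<in> carrier_mat N N"
  shows "mat_deriv N (\<lambda>u. ser_coeff (f u) i) (ser_coeff D i) s"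
  unfolding mat_deriv_def
proof (intro conjI allI impI)
  have D: "D \<in> carrier_mat N N" using assms(1) by (rule ser_deriv_carrier)
  thus "ser_coeff D i \<in> carrier_mat N N" by simp
  fix r c assume rc: "r < N" "c < N"
  have "((\<lambda>u. fls_nth (f u $$ (r,c)) (- i)) has_vector_derivative fls_nth (D $$ (r,c)) (- i)) (at s)"
    using assms(1) rc by (simp add: ser_deriv_def)
  hence "((\<lambda>u. ser_coeff (f u) i $$ (r,c)) has_vector_derivative fls_nth (D $$ (r,c)) (- i)) (at s)"
    by (rule has_vector_derivative_cong_eventually) (use assms(2) rc in \<open>auto elim!: eventually_mono\<close>)
  thus "((\<lambda>u. ser_coeff (f u) i $$ (r,c)) has_vector_derivative ser_coeff D i $$ (r,c)) (at s)"
    using rc D by simp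
qed

lemma ser_deriv_Kser:
  assumes R: "mat_deriv N R D s" "\<forall>\<^sub>F u in nhds s. R u \<in> carrier_mat N N"
  shows "ser_deriv N (\<lambda>u. Kser N a (R u))
    ((- fls_const (2 * a) / (fls_X_inv - fls_const a)) \<cdot>\<^sub>m cser D) s"
  unfolding ser_deriv_def
proof (intro conjI allI impI)
  define k where "k = fls_const (2 * a) / (fls_X_inv - fls_const a)"
  have D: "D \<in> carrier_mat N N" using R by (simp add: mat_deriv_def)
  thus "(- fls_const (2 * a) / (fls_X_inv - fls_const a)) \<cdot>\<^sub>m cser D \<in> carrier_mat N N" by simp
  fix r c n assume rc: "r < N" "c < N"
  define x :: complex where "x = (if r = c then 1 else 0)"
  have x: "fls_const x = (1\<^sub>m N) $$ (r,c)" using rc by (simp add: x_def)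
  have "((\<lambda>u. fls_nth (1\<^sub>m N $$ (r,c)) n + fls_nth k n * (x - R u $$ (r,c))) has_vector_derivative
      0 + fls_nth k n * (0 - D $$ (r,c))) (at s)"
    using R(1) rc by (intro has_vector_derivative_add has_vector_derivative_mult_right
        has_vector_derivative_diff has_vector_derivative_const) (simp add: mat_deriv_def)
  also have "0 + fls_nth k n * (0 - D $$ (r,c)) = fls_nth (((- k) \<cdot>\<^sub>m cser D) $$ (r,c)) n"
    using D rc by simp
  also have "- k = - fls_const (2 * a) / (fls_X_inv - fls_const a)" by (simp add: k_def)
  finally show "((\<lambda>u. fls_nth (Kser N a (R u) $$ (r,c)) n) has_vector_derivative
      fls_nth (((- fls_const (2 * a) / (fls_X_inv - fls_const a)) \<cdot>\<^sub>m cser D) $$ (r,c)) n) (at s)"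
  proof (rule has_vector_derivative_cong_eventually)
    show "\<forall>\<^sub>F u in nhds s. fls_nth (1\<^sub>m N $$ (r,c)) n + fls_nth k n * (x - R u $$ (r,c))
        = fls_nth (Kser N a (R u) $$ (r,c)) n"
      using R(2)
    proof eventually_elim
      case (elim u)
      have "Kser N a (R u) $$ (r,c) = 1\<^sub>m N $$ (r,c) + k * fls_const (x - R u $$ (r,c))"
        using elim rc x unfolding Kser_eq k_def[symmetric] by (simp flip: fls_minus_const)
      thus ?case by simp
    qed
  qed
qed

lemma ord_ge_pow: "ord_ge N d X \<Longrightarrow> ord_ge N (int k * d) (X ^\<^sub>m k)"
proof (induction k)
  case 0
  thus ?case using ord_ge_carrier[OF 0] ord_ge_one by simp
next
  case (Suc k)
  thus ?case using ord_ge_mult[of N "int k * d" "X ^\<^sub>m k" d X] by (simp add: algebra_simps)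
qed

text \<open>Commutation with \<open>M\<close> is a derivation, so powers inherit the equation f' =
  [f, M]; the flow needs it for the power 2j - 1.\<close>

lemma ser_deriv_pow_lax:
  assumes f: "ser_deriv N f (f s * M - M * f s) s" "\<forall>\<^sub>F u in nhds s. ord_ge N d (f u)"
    and M: "M \<in> carrier_mat N N"
  shows "ser_deriv N (\<lambda>u. f u ^\<^sub>m k) (f s ^\<^sub>m k * M - M * f s ^\<^sub>m k) s"
proof (induction k)
  have fs: "f s \<in> carrier_mat N N" using f(2) eventually_nhds_x_imp_x ord_ge_carrier by blast
  case 0
  have "1\<^sub>m N * M - M * 1\<^sub>m N = 0\<^sub>m N N" using M by (auto intro!: eq_matI)
  hence "ser_deriv N (\<lambda>u. 1\<^sub>m N) (1\<^sub>m N * M - M * 1\<^sub>m N) s"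
    by (simp add: ser_deriv_def)
  moreover have "\<forall>\<^sub>F u in nhds s. 1\<^sub>m N = f u ^\<^sub>m 0"
    using f(2) by eventually_elim (auto dest: ord_ge_carrier)
  ultimately show ?case using fs by (auto dest: ser_deriv_cong)
next
  case (Suc k)
  have fs: "f s \<in> carrier_mat N N" using f(2) eventually_nhds_x_imp_x ord_ge_carrier by blast
  have o: "\<forall>\<^sub>F u in nhds s. ord_ge N (int k * d) (f u ^\<^sub>m k)"
    using f(2) by eventually_elim (rule ord_ge_pow)
  define P where "P = f s ^\<^sub>m k"
  have P: "P \<in> carrier_mat N N" using fs by (simp add: P_def)
  have "ser_deriv N (\<lambda>u. f u ^\<^sub>m k * f u) (P * (f s * M - M * f s) + (P * M - M * P) * f s) s"
    unfolding P_def by (rule ser_deriv_mult[OF Suc o f])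
  also have "P * (f s * M - M * f s) + (P * M - M * P) * f s = P * f s * M - M * (P * f s)"
    using fs M P by (auto simp: mult_minus_distrib_mat[of _ N N _ N] minus_mult_distrib_mat[of _ N N _ _ N]
        assoc_mult_mat[of _ N N _ N _ N] intro!: eq_matI simp del: index_mult_mat(1))
  finally show ?case by (simp add: P_def)
qed

section \<open>The reality condition\<close>

declare One_nat_def [simp del]

lemma Cmat_carrier [simp]: "Cmat m n \<in> carrier_mat (NN m n) (NN m n)"
  by (simp add: Cmat_def)

lemma Cmat_dim [simp]: "dim_row (Cmat m n) = NN m n" "dim_col (Cmat m n) = NN m n"
  by (simp_all add: Cmat_def)

text \<open>\<open>Cmat\<close> is a signed permutation matrix: \<open>p\<close> reverses the
  indices within each block, and the signs at \<open>r\<close> and \<open>p r\<close> agree because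
  in the odd block the exponents n + i and n + (2n - i) add up to 4n.\<close>

lemma Cmat_square: "Cmat m n * Cmat m n = 1\<^sub>m (NN m n)"
proof (rule eq_matI)
  define p where "p r = (if r < 2*m then 2*m - 1 - r else 2*m + 2*n - (r - 2*m))" for r
  define s :: "nat \<Rightarrow> complex" where "s r = (if r < 2*m then 1 else (-1) ^ (n + (r - 2*m)))" for r
  have C: "Cmat m n $$ (r,c) = (if c = p r then s r else 0)" if "r < NN m n" "c < NN m n" for r c
    using that by (auto simp: Cmat_def p_def s_def)
  have p: "p r < NN m n" "p (p r) = r" "s r * s (p r) = 1" if "r < NN m n" for r
  proof -
    show "s r * s (p r) = 1"
    proof (cases "r < 2 * m")
      case False
      hence "\<not> p r < 2 * m" "p r - 2 * m = 2 * n - (r - 2 * m)" using that by (auto simp: p_def)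
      hence "s r * s (p r) = (-1) ^ (n + (r - 2*m) + (n + (2*n - (r - 2*m))))"
        using False by (simp only: s_def if_False power_add)
      also have "n + (r - 2*m) + (n + (2*n - (r - 2*m))) = 2 * (2 * n)" using False that by simp
      finally show ?thesis by simp
    qed (simp add: p_def s_def)
    show "p r < NN m n" "p (p r) = r" using that by (auto simp: p_def)
  qed
  fix r c assume "r < dim_row (1\<^sub>m (NN m n) :: complex mat)" "c < dim_col (1\<^sub>m (NN m n) :: complex mat)"
  hence rc: "r < NN m n" "c < NN m n" by auto
  have "(Cmat m n * Cmat m n) $$ (r,c) = (\<Sum>k<NN m n. if k = p r then s r * Cmat m n $$ (p r,c) else 0)"
    unfolding mult_mat_entry[OF Cmat_carrier Cmat_carrier rc] using C rc by (intro sum.cong) auto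
  also have "\<dots> = s r * Cmat m n $$ (p r,c)" using p[OF rc(1)] by simp
  also have "\<dots> = 1\<^sub>m (NN m n) $$ (r,c)" using p[OF rc(1)] rc by (auto simp: C)
  finally show "(Cmat m n * Cmat m n) $$ (r,c) = 1\<^sub>m (NN m n) $$ (r,c)" .
qed (auto simp: Cmat_def)

lemma Cinv_eq: "Cinv m n = Cmat m n"
  unfolding Cinv_def using minv_eqI[OF Cmat_carrier Cmat_carrier Cmat_square Cmat_square] .

text \<open>The ring is arbitrary so that the same rules for an anti-automorphism serve
  \<open>sharp\<close> on complex matrices and its counterpart on series. As C is its own inverse,
  one matrix stands on both sides.\<close>

definition adj_by :: "'a::comm_ring_1 mat \<Rightarrow> 'a mat \<Rightarrow> 'a mat" where
  "adj_by C A = C * transpose_mat A * C"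

lemma adj_by_carrier [simp]:
  "C \<in> carrier_mat N N \<Longrightarrow> A \<in> carrier_mat N N \<Longrightarrow> adj_by C A \<in> carrier_mat N N"
  by (simp add: adj_by_def)

lemma adj_by_mult:
  assumes C: "C \<in> carrier_mat N N" "C * C = 1\<^sub>m N" and A: "A \<in> carrier_mat N N" and B: "B \<in> carrier_mat N N"
  shows "adj_by C (A * B) = adj_by C B * adj_by C A"
proof -
  have t: "transpose_mat A \<in> carrier_mat N N" "transpose_mat B \<in> carrier_mat N N" using A B by auto
  have "adj_by C B * adj_by C A = C * transpose_mat B * (C * C) * transpose_mat A * C"
    using C(1) t by (simp add: adj_by_def assoc_mult_mat[of _ N N _ N _ N])
  also have "\<dots> = adj_by C (A * B)"
    unfolding C(2) adj_by_def transpose_mult[OF A B]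
    using C t by (simp add: assoc_mult_mat[of _ N N _ N _ N])
  finally show ?thesis by simp
qed

lemma adj_by_linear:
  assumes C: "C \<in> carrier_mat N N" and A: "A \<in> carrier_mat N N"
  shows "B \<in> carrier_mat N N \<Longrightarrow> adj_by C (A + B) = adj_by C A + adj_by C B"
    and "B \<in> carrier_mat N N \<Longrightarrow> adj_by C (A - B) = adj_by C A - adj_by C B"
    and "adj_by C (k \<cdot>\<^sub>m A) = k \<cdot>\<^sub>m adj_by C A"
proof -
  have s: "transpose_mat (k \<cdot>\<^sub>m A) = k \<cdot>\<^sub>m transpose_mat A" by (rule eq_matI) auto
  show "adj_by C (k \<cdot>\<^sub>m A) = k \<cdot>\<^sub>m adj_by C A"
    unfolding adj_by_def s
    using A C by (simp add: mult_smult_distrib[of _ N N _ N] mult_smult_assoc_mat[of _ N N _ N] del: assoc_mult_mat)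
  assume B: "B \<in> carrier_mat N N"
  show "adj_by C (A + B) = adj_by C A + adj_by C B"
    unfolding adj_by_def transpose_add[OF A B]
    using A B C by (simp add: mult_add_distrib_mat[of _ N N _ N] add_mult_distrib_mat[of _ N N _ _ N] del: assoc_mult_mat)
  show "adj_by C (A - B) = adj_by C A - adj_by C B"
    unfolding adj_by_def transpose_minus[OF A B]
    using A B C by (simp add: mult_minus_distrib_mat[of _ N N _ N] minus_mult_distrib_mat[of _ N N _ _ N] del: assoc_mult_mat)
qed

lemma adj_by_one: "C \<in> carrier_mat N N \<Longrightarrow> C * C = 1\<^sub>m N \<Longrightarrow> adj_by C (1\<^sub>m N) = 1\<^sub>m N"
  by (simp add: adj_by_def)

lemma sharp_eq: "sharp m n A = adj_by (Cmat m n) A"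
  by (simp add: sharp_def adj_by_def Cinv_eq)

lemma sigma_eq: "sigma m n A = minv (sharp m n A)"
  by (simp add: sigma_def sharp_def Cinv_eq)

lemma sharp_carrier [simp]: "A \<in> carrier_mat (NN m n) (NN m n) \<Longrightarrow> sharp m n A \<in> carrier_mat (NN m n) (NN m n)"
  by (simp add: sharp_eq)

lemma sharp_mult:
  "A \<in> carrier_mat (NN m n) (NN m n) \<Longrightarrow> B \<in> carrier_mat (NN m n) (NN m n) \<Longrightarrow>
    sharp m n (A * B) = sharp m n B * sharp m n A"
  unfolding sharp_eq by (rule adj_by_mult[OF Cmat_carrier Cmat_square])

lemma sharp_linear:
  assumes "A \<in> carrier_mat (NN m n) (NN m n)"
  shows "B \<in> carrier_mat (NN m n) (NN m n) \<Longrightarrow> sharp m n (A + B) = sharp m n A + sharp m n B"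
    and "B \<in> carrier_mat (NN m n) (NN m n) \<Longrightarrow> sharp m n (A - B) = sharp m n A - sharp m n B"
    and "sharp m n (k \<cdot>\<^sub>m A) = k \<cdot>\<^sub>m sharp m n A"
  using adj_by_linear[OF Cmat_carrier assms] unfolding sharp_eq by blast+

lemma sharp_one: "sharp m n (1\<^sub>m (NN m n)) = 1\<^sub>m (NN m n)"
  unfolding sharp_eq by (rule adj_by_one[OF Cmat_carrier Cmat_square])

lemma det_sharp:
  assumes A: "A \<in> carrier_mat (NN m n) (NN m n)"
  shows "det (sharp m n A) = det A"
proof -
  have "det (Cmat m n) * det (Cmat m n) = 1"
    using det_mult[OF Cmat_carrier Cmat_carrier, of m n] Cmat_square[of m n] by simp
  moreover have "det (sharp m n A) = det (Cmat m n) * det (transpose_mat A) * det (Cmat m n)"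
    unfolding sharp_eq adj_by_def using A by (simp add: det_mult[of _ "NN m n"] del: assoc_mult_mat)
  ultimately show ?thesis using det_transpose[OF A] by simp
qed

lemma mat_deriv_sharp:
  assumes f: "mat_deriv (NN m n) f D s" "\<forall>\<^sub>F u in nhds s. f u \<in> carrier_mat (NN m n) (NN m n)"
  shows "mat_deriv (NN m n) (\<lambda>u. sharp m n (f u)) (sharp m n D) s"
proof -
  let ?N = "NN m n" and ?C = "Cmat m n"
  have D: "D \<in> carrier_mat ?N ?N" using f(1) by (rule mat_deriv_carrier)
  have fs: "f s \<in> carrier_mat ?N ?N" using f(2) eventually_nhds_x_imp_x by blast
  have ev: "\<forall>\<^sub>F u in nhds s. ?C * transpose_mat (f u) \<in> carrier_mat ?N ?N"
    "\<forall>\<^sub>F u in nhds s. transpose_mat (f u) \<in> carrier_mat ?N ?N"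
    using f(2) by (auto elim!: eventually_mono)
  have c: "\<forall>\<^sub>F u in nhds s. ?C \<in> carrier_mat ?N ?N" by simp
  note d = mat_deriv_mult[OF mat_deriv_mult[OF mat_deriv_const c mat_deriv_transpose[OF f] ev(2)] ev(1) mat_deriv_const c]
  have t: "transpose_mat D \<in> carrier_mat ?N ?N" "transpose_mat (f s) \<in> carrier_mat ?N ?N" using D fs by auto
  have "?C * transpose_mat (f s) * 0\<^sub>m ?N ?N
      + (?C * transpose_mat D + 0\<^sub>m ?N ?N * transpose_mat (f s)) * ?C = sharp m n D"
    unfolding sharp_eq adj_by_def using t
    by (simp add: left_mult_zero_mat[of _ ?N ?N] right_mult_zero_mat[of _ ?N ?N]
      right_add_zero_mat[of _ ?N ?N] left_add_zero_mat[of _ ?N ?N] del: assoc_mult_mat)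
  thus ?thesis using d unfolding sharp_eq adj_by_def by simp
qed

section \<open>The reality condition for series in lambda\<close>

lemma fls_neg_nth: "fls_nth (fls_compose_fps f (- fps_X)) k = fls_nth f k * (-1) powi k" for f :: "complex fls"
proof -
  have "- fps_X = fps_const (-1) * (fps_X :: complex fps)" by (simp add: fps_eq_iff)
  thus ?thesis by (simp only:) (rule fls_nth_fls_compose_fps_linear, simp)
qed

interpretation fls_neg: comm_ring_hom "\<lambda>f :: complex fls. fls_compose_fps f (- fps_X)"
  by unfold_locales (simp_all add: fls_compose_fps_add fls_compose_fps_mult)

text \<open>The adjoint of X(-lambda). In these terms the group condition reads
  \<open>minv (ser_sharp m n g) = g\<close> and the Lie algebra condition
  \<open>- ser_sharp m n xi = xi\<close>.\<close>

definition ser_sharp :: "nat \<Rightarrow> nat \<Rightarrow> complex fls mat \<Rightarrow> complex fls mat" where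
  "ser_sharp m n X = cser (Cmat m n) * transpose_mat (ser_neg X) * cser (Cinv m n)"

lemma ser_neg_carrier [simp]: "ser_neg X \<in> carrier_mat k l \<longleftrightarrow> X \<in> carrier_mat k l"
  by (simp add: ser_neg_def)

lemma ser_sharp_eq: "ser_sharp m n X = adj_by (cser (Cmat m n)) (ser_neg X)"
  by (simp add: ser_sharp_def adj_by_def Cinv_eq)

lemma ser_sharp_carrier [simp]:
  "X \<in> carrier_mat (NN m n) (NN m n) \<Longrightarrow> ser_sharp m n X \<in> carrier_mat (NN m n) (NN m n)"
  by (simp add: ser_sharp_eq)

lemma cser_Cmat_square: "cser (Cmat m n) * cser (Cmat m n) = 1\<^sub>m (NN m n)"
  using cser_hom(3)[OF Cmat_carrier Cmat_carrier] Cmat_square cser_hom(5) by metis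

lemma ser_sharp_mult:
  assumes X: "X \<in> carrier_mat (NN m n) (NN m n)" and Y: "Y \<in> carrier_mat (NN m n) (NN m n)"
  shows "ser_sharp m n (X * Y) = ser_sharp m n Y * ser_sharp m n X"
  unfolding ser_sharp_eq ser_neg_def fls_neg.mat_hom_mult[OF X Y]
  by (rule adj_by_mult[of _ "NN m n"]) (use X Y in \<open>simp_all add: cser_Cmat_square\<close>)

lemma ser_sharp_add:
  assumes X: "X \<in> carrier_mat (NN m n) (NN m n)" and Y: "Y \<in> carrier_mat (NN m n) (NN m n)"
  shows "ser_sharp m n (X + Y) = ser_sharp m n X + ser_sharp m n Y"
  unfolding ser_sharp_eq ser_neg_def fls_neg.mat_hom_add[OF X Y]
  by (rule adj_by_linear(1)[of _ "NN m n"]) (use X Y in \<open>simp_all\<close>)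

lemma ser_sharp_smult_cser:
  assumes A: "A \<in> carrier_mat (NN m n) (NN m n)"
  shows "ser_sharp m n (k \<cdot>\<^sub>m cser A) = fls_compose_fps k (- fps_X) \<cdot>\<^sub>m cser (sharp m n A)"
proof -
  have n: "ser_neg (cser A) = cser A" by (rule eq_matI) (auto simp: ser_neg_def)
  have t: "transpose_mat (cser A) = cser (transpose_mat A)" by (rule eq_matI) auto
  have "ser_sharp m n (k \<cdot>\<^sub>m cser A) = fls_compose_fps k (- fps_X) \<cdot>\<^sub>m adj_by (cser (Cmat m n)) (cser A)"
    unfolding ser_sharp_eq ser_neg_def fls_neg.mat_hom_smult
    by (subst adj_by_linear(3)[of _ "NN m n"]) (use A n in \<open>simp_all add: ser_neg_def\<close>)
  also have "adj_by (cser (Cmat m n)) (cser A) = cser (sharp m n A)"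
    unfolding sharp_eq adj_by_def t using A
    by (simp add: cser_hom(3)[of _ "NN m n"] del: assoc_mult_mat)
  finally show ?thesis .
qed

lemma one_smult_mat: "(1 :: 'a::monoid_mult) \<cdot>\<^sub>m A = A"
  by (rule eq_matI) auto

lemma ser_sharp_one: "ser_sharp m n (1\<^sub>m (NN m n)) = 1\<^sub>m (NN m n)"
  using ser_sharp_smult_cser[of "1\<^sub>m (NN m n)" m n 1] by (simp add: cser_hom(5) sharp_one one_smult_mat)

text \<open>Replacing lambda by -lambda sends 2a/(lambda - a) to -2a/(lambda + a) while the
  self-adjoint \<open>R\<close> is kept. So the adjoint of K(-lambda) is K^-1, the reality condition
  of the group.\<close>

lemma ser_sharp_Kser:
  assumes R: "R \<in> carrier_mat (NN m n) (NN m n)" "sharp m n R = R"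
  shows "ser_sharp m n (Kser (NN m n) a R) = Kser (NN m n) (- a) R"
proof -
  let ?N = "NN m n"
  define k where "k = fls_const (2 * a) / (fls_X_inv - fls_const a)"
  define k' where "k' = fls_const (2 * (- a)) / (fls_X_inv - fls_const (- a))"
  have "fls_compose_fps fls_X_inv (- fps_X) = - (fls_X_inv :: complex fls)"
    by (rule fls_eqI) (auto simp: fls_neg_nth)
  hence "fls_compose_fps k (- fps_X) = fls_const (2 * a) / (- fls_X_inv - fls_const a)"
    unfolding k_def by (simp add: fls_compose_fps_divide fls_compose_fps_diff)
  also have "- fls_X_inv - fls_const a = - (fls_X_inv - fls_const (- a))" by simp
  also have "fls_const (2 * a) / - (fls_X_inv - fls_const (- a)) = k'"
    unfolding k'_def by (simp only: divide_minus_right mult_minus_right fls_const_uminus minus_divide_left)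
  finally have k: "fls_compose_fps k (- fps_X) = k'" .
  have K: "Kser ?N a R = 1\<^sub>m ?N + k \<cdot>\<^sub>m cser (1\<^sub>m ?N - R)"
    unfolding Kser_eq k_def[symmetric] using R(1) by (simp add: cser_hom(2)[of _ ?N] cser_hom(5))
  have K': "Kser ?N (- a) R = 1\<^sub>m ?N + k' \<cdot>\<^sub>m cser (1\<^sub>m ?N - R)"
    unfolding Kser_eq k'_def[symmetric] using R(1) by (simp add: cser_hom(2)[of _ ?N] cser_hom(5))
  have "ser_sharp m n (Kser ?N a R) = 1\<^sub>m ?N + k' \<cdot>\<^sub>m cser (sharp m n (1\<^sub>m ?N - R))"
    unfolding K using R(1)
    by (simp add: ser_sharp_add ser_sharp_smult_cser ser_sharp_one k)
  thus ?thesis unfolding K' using R by (simp add: sharp_linear(2) sharp_one)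
qed

section \<open>The negative group\<close>

interpretation fps_to_fls_hom: comm_ring_hom "fps_to_fls :: complex fps \<Rightarrow> complex fls"
  by unfold_locales (simp_all add: fls_times_fps_to_fls)

interpretation fps_nth_0: comm_ring_hom "\<lambda>f :: complex fps. fps_nth f 0"
  by unfold_locales simp_all

text \<open>The entries are power series in mu, so the determinant is one too, and its constant term
  is the determinant of the leading coefficient, namely 1.\<close>

lemma det_nz_if_unipotent:
  assumes X: "ord_ge N 0 X" and X0: "ser_coeff X 0 = 1\<^sub>m N"
  shows "det X \<noteq> 0"
proof -
  define G where "G = map_mat fls_regpart X"
  note cX = ord_ge_carrier[OF X]
  have "X = map_mat fps_to_fls G"
  proof (rule eq_matI)
    fix r c assume "r < dim_row (map_mat fps_to_fls G)" "c < dim_col (map_mat fps_to_fls G)"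
    hence "r < N" "c < N" using cX by (auto simp: G_def)
    thus "X $$ (r,c) = map_mat fps_to_fls G $$ (r,c)"
      using cX ord_geD[OF X] by (intro fls_eqI) (auto simp: G_def)
  qed (auto simp: G_def)
  hence "det X = fps_to_fls (det G)" by (simp only: fps_to_fls_hom.hom_det)
  moreover have "map_mat (\<lambda>f. fps_nth f 0) G = ser_coeff X 0"
    using cX by (intro eq_matI) (auto simp: G_def)
  hence "fps_nth (det G) 0 = 1"
    using X0 by (simp flip: fps_nth_0.hom_det)
  ultimately show ?thesis by auto
qed

text \<open>The group condition speaks of \<open>minv\<close>, a definite description, and yields an
  inverse only once the adjoint of \<open>g\<close> is known to be invertible; this comes from the
  leading coefficient 1.\<close>

lemma GGrp_minusD:
  assumes g: "g \<in> GGrp_minus m n"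
  shows "ord_ge (NN m n) 0 g" "ser_coeff g 0 = 1\<^sub>m (NN m n)" "minv (ser_sharp m n g) = g"
    "det g \<noteq> 0" "minv g = ser_sharp m n g" "ser_sharp m n g * g = 1\<^sub>m (NN m n)"
proof -
  let ?N = "NN m n"
  have c: "g \<in> carrier_mat ?N ?N" using g by (simp add: GGrp_minus_def)
  show o: "ord_ge ?N 0 g"
    unfolding ord_ge_def
  proof (intro conjI allI impI c)
    fix r s k assume rs: "r < ?N" "s < ?N" and k: "k < (0::int)"
    have "ser_coeff g (- k) = 0\<^sub>m ?N ?N" using g k by (simp add: GGrp_minus_def)
    thus "fls_nth (g $$ (r,s)) k = 0" using arg_cong[of _ _ "\<lambda>A. A $$ (r,s)"] rs c
      by (metis carrier_matD index_zero_mat(1) minus_minus ser_coeff_nth(1))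
  qed
  show g0: "ser_coeff g 0 = 1\<^sub>m ?N" using g by (simp add: GGrp_minus_def)
  show mi: "minv (ser_sharp m n g) = g" using g by (simp add: GGrp_minus_def ser_sharp_def)
  show d: "det g \<noteq> 0" by (rule det_nz_if_unipotent[OF o g0])
  have "det (cser (Cmat m n)) \<noteq> 0"
    by (rule det_nz_if_inverse[OF _ _ cser_Cmat_square]) simp_all
  moreover have "det (transpose_mat (ser_neg g)) \<noteq> 0"
  proof -
    have "det (transpose_mat (ser_neg g)) = fls_compose_fps (det g) (- fps_X)"
      using det_transpose[of "ser_neg g" ?N] c by (simp add: ser_neg_def)
    thus ?thesis using d by (simp add: fls_compose_fps_eq_0_iff)
  qed
  ultimately have "det (ser_sharp m n g) \<noteq> 0"
    unfolding ser_sharp_eq adj_by_def using c by (simp add: det_mult[of _ ?N] del: assoc_mult_mat)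
  note i = minv_det_nz[OF ser_sharp_carrier[OF c] this]
  show "ser_sharp m n g * g = 1\<^sub>m ?N" using i(2) mi by simp
  have "g * ser_sharp m n g = 1\<^sub>m ?N" using i(3) mi by simp
  thus "minv g = ser_sharp m n g" by (rule minv_eqI_field[OF c ser_sharp_carrier[OF c]])
qed

lemma ord_ge_transpose: "ord_ge N d X \<Longrightarrow> ord_ge N d (transpose_mat X)"
  by (auto simp: ord_ge_def)

lemma ord_ge_ser_neg: "ord_ge N d X \<Longrightarrow> ord_ge N d (ser_neg X)"
  by (auto simp: ord_ge_def ser_neg_def fls_neg_nth)

lemma ord_ge_ser_sharp: "ord_ge (NN m n) d X \<Longrightarrow> ord_ge (NN m n) d (ser_sharp m n X)"
  unfolding ser_sharp_eq adj_by_def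
  using ord_ge_mult[OF ord_ge_mult[OF ord_ge_cser[OF Cmat_carrier] ord_ge_transpose[OF ord_ge_ser_neg]] ord_ge_cser[OF Cmat_carrier], of m n d X]
  by simp

section \<open>The element J and the phase space\<close>

lemma bmat_carrier [simp]: "bmat m n \<in> carrier_mat (NN m n) (NN m n)"
  and Emat_carrier [simp]: "Emat m n \<in> carrier_mat (NN m n) (NN m n)"
  by (auto simp: bmat_def Emat_def)

lemma bmat_dim [simp]: "dim_row (bmat m n) = NN m n" "dim_col (bmat m n) = NN m n"
  and Emat_dim [simp]: "dim_row (Emat m n) = NN m n" "dim_col (Emat m n) = NN m n"
  by (simp_all add: bmat_def Emat_def)

lemma Jser_carrier [simp]: "Jser m n \<in> carrier_mat (NN m n) (NN m n)"
  by (simp add: Jser_def)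

lemma ord_ge_Jser: "ord_ge (NN m n) (-1) (Jser m n)"
  unfolding Jser_def
  by (intro ord_ge_add ord_ge_mono[OF ord_ge_cser] ord_ge_mono[OF ord_ge_smult[where e = "-1" and d = 0]] ord_ge_cser)
     auto

lemma ser_coeff_commutator:
  assumes X: "X \<in> carrier_mat N N" and A: "A \<in> carrier_mat N N" and E: "E \<in> carrier_mat N N"
  shows "ser_coeff ((cser A + fls_X_inv \<cdot>\<^sub>m cser E) * X - X * (cser A + fls_X_inv \<cdot>\<^sub>m cser E)) i
    = (A * ser_coeff X i - ser_coeff X i * A) + (E * ser_coeff X (i - 1) - ser_coeff X (i - 1) * E)"
proof -
  let ?c = "\<lambda>Y. ser_coeff Y i"
  have "?c ((cser A + fls_X_inv \<cdot>\<^sub>m cser E) * X - X * (cser A + fls_X_inv \<cdot>\<^sub>m cser E))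
    = ?c (cser A * X) + ?c (fls_X_inv \<cdot>\<^sub>m (cser E * X)) - (?c (X * cser A) + ?c (fls_X_inv \<cdot>\<^sub>m (X * cser E)))"
    using X A E
    by (simp add: add_mult_distrib_mat[of _ N N] mult_add_distrib_mat[of _ N N]
        mult_smult_assoc_mat[of _ N N _ N] mult_smult_distrib[of _ N N _ N] ser_coeff_minus[of _ N N] ser_coeff_add[of _ N N])
  also have "\<dots> = A * ?c X + E * ser_coeff X (i - 1) - (?c X * A + ser_coeff X (i - 1) * E)"
    using X A E by (simp add: ser_coeff_X_inv ser_coeff_cser_mult)
  also have "\<dots> = (A * ?c X - ?c X * A) + (E * ser_coeff X (i - 1) - ser_coeff X (i - 1) * E)"
    using X A E by (intro eq_matI) (auto simp del: index_mult_mat(1))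
  finally show ?thesis .
qed

lemma Jser_plus_cser:
  assumes "q \<in> carrier_mat (NN m n) (NN m n)"
  shows "Jser m n + cser q = cser (bmat m n + q) + fls_X_inv \<cdot>\<^sub>m cser (Emat m n)"
proof -
  have "cser (bmat m n + q) = cser (bmat m n) + cser q"
    using assms by (intro cser_hom(1)) simp_all
  thus ?thesis unfolding Jser_def using assms carrier_matD[OF assms] by (intro eq_matI) (auto simp: algebra_simps)
qed

lemma NN_pos: "0 < NN m n" by simp

lemma ser_coeff_zero_if_ord_ge: "ord_ge N d X \<Longrightarrow> - i < d \<Longrightarrow> ser_coeff X i = 0\<^sub>m N N"
  by (rule eq_matI) (auto simp: ord_ge_def)

lemma GGrp_minus_dress:
  assumes g: "g \<in> GGrp_minus m n" and R: "R \<in> carrier_mat (NN m n) (NN m n)" "R * R = R" "sharp m n R = R"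
  shows "Kser (NN m n) a R * g \<in> GGrp_minus m n"
proof -
  let ?N = "NN m n" and ?K = "Kser (NN m n) a R" and ?K' = "Kser (NN m n) (- a) R"
  note gd = GGrp_minusD[OF g]
  note cg = ord_ge_carrier[OF gd(1)]
  have o: "ord_ge ?N 0 (?K * g)" using ord_ge_mult[OF ord_ge_Kser[OF R(1)] gd(1)] by simp
  have cK: "?K \<in> carrier_mat ?N ?N" "?K' \<in> carrier_mat ?N ?N" using R by simp_all
  have c: "?K * g \<in> carrier_mat ?N ?N" using cK cg by simp
  have K1: "?K' * ?K = 1\<^sub>m ?N" using Kser_inverse[OF R(1,2) NN_pos, of "- a"] by simp
  have "ser_sharp m n (?K * g) * (?K * g) = ser_sharp m n g * (?K' * ?K) * g"
    using cg cK ser_sharp_carrier[OF cg]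
    by (simp add: ser_sharp_mult ser_sharp_Kser R assoc_mult_mat[of _ ?N ?N _ ?N _ ?N])
  also have "\<dots> = 1\<^sub>m ?N" using gd(6) ser_sharp_carrier[OF cg] unfolding K1 by simp
  finally have mi: "minv (ser_sharp m n (?K * g)) = ?K * g"
    by (rule minv_eqI_field[OF ser_sharp_carrier[OF c] c])
  have "ser_coeff (?K * g) 0 = 1\<^sub>m ?N"
    using ser_coeff_mult_lead[OF ord_ge_Kser[OF R(1)] gd(1), of 0 a] ser_coeff_Kser[OF R(1)] gd(2)
    by simp
  moreover have "ser_coeff (?K * g) i = 0\<^sub>m ?N ?N" if "i > 0" for i
    using ser_coeff_zero_if_ord_ge[OF o] that by simp
  ultimately show ?thesis using c mi by (simp add: GGrp_minus_def ser_sharp_def)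
qed

lemma conjugate_dress:
  assumes g: "g \<in> GGrp_minus m n" and R: "R \<in> carrier_mat (NN m n) (NN m n)" "R * R = R"
  shows "Kser (NN m n) a R * (g * Jser m n * minv g) * Kser (NN m n) (- a) R
    = (Kser (NN m n) a R * g) * Jser m n * minv (Kser (NN m n) a R * g)"
proof -
  let ?N = "NN m n" and ?K = "Kser (NN m n) a R" and ?K' = "Kser (NN m n) (- a) R"
  note gd = GGrp_minusD[OF g]
  note cg = ord_ge_carrier[OF gd(1)]
  have cK: "?K \<in> carrier_mat ?N ?N" "?K' \<in> carrier_mat ?N ?N" using R by simp_all
  note K1 = Kser_inverse[OF R NN_pos, of a]
  have "minv (?K * g) = minv g * minv ?K"
    by (rule minv_mult[OF cK(1) cg det_nz_if_inverse(1)[OF cK K1] gd(4)])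
  moreover have "minv ?K = ?K'" by (rule minv_eqI_field[OF cK K1])
  moreover have "minv g \<in> carrier_mat ?N ?N" unfolding gd(5) using cg by simp
  ultimately show ?thesis using cg cK by (simp add: assoc_mult_mat[of _ ?N ?N _ ?N _ ?N])
qed

lemma ord_ge_conjugate:
  assumes g: "g \<in> GGrp_minus m n"
  shows "ord_ge (NN m n) (-1) (g * Jser m n * minv g)"
  using ord_ge_mult[OF ord_ge_mult[OF GGrp_minusD(1)[OF g] ord_ge_Jser] ord_ge_ser_sharp[OF GGrp_minusD(1)[OF g]]]
  by (simp add: GGrp_minusD(5)[OF g])

lemma Ymn_carrier: "q \<in> Ymn m n \<Longrightarrow> q \<in> carrier_mat (NN m n) (NN m n)"
proof -
  assume "q \<in> Ymn m n"
  then obtain g where g: "g \<in> GLie_minus m n" "ser_coeff (Jser m n * g - g * Jser m n) 0 = q"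
    unfolding Ymn_def by fastforce
  hence "g \<in> carrier_mat (NN m n) (NN m n)" by (simp add: GLie_minus_def GLie_def)
  thus ?thesis using g(2) by (metis Jser_carrier minus_carrier_mat mult_carrier_mat_square ser_coeff_carrier)
qed

lemma commutator_affine:
  fixes c d :: "'a::comm_ring_1"
  assumes "E \<in> carrier_mat N N" "R \<in> carrier_mat N N" "0 < N"
  shows "E * (c \<cdot>\<^sub>m R - d \<cdot>\<^sub>m 1\<^sub>m N) - (c \<cdot>\<^sub>m R - d \<cdot>\<^sub>m 1\<^sub>m N) * E = c \<cdot>\<^sub>m (E * R - R * E)"
  by (rule emb_inject[of N])
     (use assms in \<open>simp_all add: emb_simps sc_central[of "emb N E"] sc_central'[of "emb N E"] algebra_simps\<close>)

text \<open>The element \<open>g\<close> for q is changed by h = M/lambda. Then [lambda e, h] =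
  [e, M] is constant and [b, h] has no nonnegative power. The odd power of lambda changes sign with
  lambda, which is why a self-adjoint \<open>M\<close> gives an element of the Lie algebra.\<close>

lemma Ymn_dress:
  assumes q: "q \<in> Ymn m n" and R: "R \<in> carrier_mat (NN m n) (NN m n)" "sharp m n R = R"
  shows "q + (2 * a) \<cdot>\<^sub>m (Emat m n * R - R * Emat m n) \<in> Ymn m n"
proof -
  let ?N = "NN m n" and ?J = "Jser m n"
  obtain g where g: "g \<in> GLie_minus m n"
    and gq: "\<And>i. i \<ge> 0 \<Longrightarrow> ser_coeff (?J * g - g * ?J) i = (if i = 0 then q else 0\<^sub>m ?N ?N)"
    using q unfolding Ymn_def by blast
  have cg: "g \<in> carrier_mat ?N ?N" and tr: "\<And>i. mtrace (ser_coeff g i) = 0"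
    and sg: "- ser_sharp m n g = g" and g0: "\<And>i. i \<ge> 0 \<Longrightarrow> ser_coeff g i = 0\<^sub>m ?N ?N"
    using g by (auto simp: GLie_minus_def GLie_def ser_sharp_def)
  \<comment> \<open>Removing the mean of the trace puts \<open>M\<close> into sl(N); the scalar
    matrix subtracted is self-adjoint and commutes with e, so nothing else changes.\<close>
  define M where "M = (2 * a) \<cdot>\<^sub>m R - (2 * a * mtrace R / of_nat ?N) \<cdot>\<^sub>m 1\<^sub>m ?N"
  define h where "h = fls_X \<cdot>\<^sub>m cser M"
  have cM: "M \<in> carrier_mat ?N ?N" using R by (simp add: M_def)
  have ch: "h \<in> carrier_mat ?N ?N" using cM by (simp add: h_def)
  have trM: "mtrace M = 0"
  proof -
    have "mtrace M = (\<Sum>i<?N. 2 * a * R $$ (i,i) - 2 * a * mtrace R / of_nat ?N)"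
      using R(1) by (auto simp: mtrace_def M_def)
    also have "\<dots> = 2 * a * mtrace R - of_nat ?N * (2 * a * mtrace R / of_nat ?N)"
      using R(1) by (simp add: sum_subtractf mtrace_def sum_distrib_left[symmetric])
    also have "\<dots> = 0" using NN_pos[of m n] by (simp del: of_nat_add of_nat_mult)
    finally show ?thesis .
  qed
  have hc: "ser_coeff h i = (if i = -1 then M else 0\<^sub>m ?N ?N)" for i
    using cM by (auto simp: h_def fls_X_times_conv_shift intro!: eq_matI)
  have tr': "mtrace (ser_coeff (g + h) i) = 0" for i
  proof -
    have "mtrace (ser_coeff (g + h) i) = mtrace (ser_coeff g i) + mtrace (ser_coeff h i)"
      using cg ch by (simp add: mtrace_def sum.distrib)
    thus ?thesis using tr trM by (simp add: hc mtrace_def)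
  qed
  have "sharp m n M = M"
    unfolding M_def using R by (simp add: sharp_linear sharp_one)
  hence "ser_sharp m n h = (- fls_X) \<cdot>\<^sub>m cser M"
    unfolding h_def using ser_sharp_smult_cser[OF cM] by simp
  also have "\<dots> = - h" unfolding h_def by (intro eq_matI) auto
  finally have sh: "ser_sharp m n h = - h" .
  have "- ser_sharp m n (g + h) = - ser_sharp m n g + h"
    using cg ch carrier_matD[OF ser_sharp_carrier[OF cg]] by (auto simp: ser_sharp_add sh intro!: eq_matI)
  hence sgh: "- ser_sharp m n (g + h) = g + h" using sg by simp
  have z: "0\<^sub>m ?N ?N + 0\<^sub>m ?N ?N = (0\<^sub>m ?N ?N :: complex mat)" by simp
  have gh: "g + h \<in> GLie_minus m n"
    using cg ch tr' sgh g0 unfolding GLie_minus_def GLie_def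
    by (simp add: ser_sharp_def[symmetric] ser_coeff_add[OF cg ch] hc z)
  have cJ: "?J \<in> carrier_mat ?N ?N" by simp
  have "ser_coeff (?J * (g + h) - (g + h) * ?J) i =
      (if i = 0 then q + (2 * a) \<cdot>\<^sub>m (Emat m n * R - R * Emat m n) else 0\<^sub>m ?N ?N)" if i: "i \<ge> 0" for i
  proof -
    have "?J * (g + h) - (g + h) * ?J = (?J * g - g * ?J) + (?J * h - h * ?J)"
      using cg ch cJ carrier_matD[OF cJ] by (auto simp: mult_add_distrib_mat[of _ ?N ?N _ ?N] add_mult_distrib_mat[of _ ?N ?N _ _ ?N] intro!: eq_matI simp del: index_mult_mat(1))
    hence "ser_coeff (?J * (g + h) - (g + h) * ?J) i
      = ser_coeff (?J * g - g * ?J) i + ser_coeff (?J * h - h * ?J) i"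
      using cg ch cJ by (simp add: ser_coeff_add[of _ ?N ?N])
    also have "ser_coeff (?J * h - h * ?J) i
      = (bmat m n * ser_coeff h i - ser_coeff h i * bmat m n)
        + (Emat m n * ser_coeff h (i - 1) - ser_coeff h (i - 1) * Emat m n)"
      unfolding Jser_def by (rule ser_coeff_commutator[OF ch bmat_carrier Emat_carrier])
    also have "\<dots> = (if i = 0 then Emat m n * M - M * Emat m n else 0\<^sub>m ?N ?N)"
      using i cM by (auto simp: hc left_mult_zero_mat[of _ ?N ?N] right_mult_zero_mat[of _ ?N ?N]
          left_add_zero_mat[of _ ?N ?N])
    also have "Emat m n * M - M * Emat m n = (2 * a) \<cdot>\<^sub>m (Emat m n * R - R * Emat m n)"
      unfolding M_def by (rule commutator_affine[OF Emat_carrier R(1) NN_pos])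
    finally show ?thesis using gq[OF i] Ymn_carrier[OF q] R(1) by auto
  qed
  thus ?thesis unfolding Ymn_def using gh by blast
qed

section \<open>The varying projection\<close>

text \<open>\<open>P\<close> fixes exactly its image, so w lies in the moving subspace iff P G w = G
  w; \<open>G\<close> is to be the frame at \<open>a\<close>. Columnwise this becomes matrix
  equations, which can be differentiated.\<close>

lemma OprojD:
  assumes O: "Oproj m n R {w \<in> carrier_vec (NN m n). G *\<^sub>v w \<in> mat_image P}"
    and G: "G \<in> carrier_mat (NN m n) (NN m n)" and P: "P \<in> carrier_mat (NN m n) (NN m n)" "P * P = P"
  shows "R \<in> carrier_mat (NN m n) (NN m n)" "R * R = R" "sharp m n R = R" "P * (G * R) = G * R"
    and "\<And>X. X \<in> carrier_mat (NN m n) (NN m n) \<Longrightarrow> P * (G * X) = G * X \<Longrightarrow> R * X = X"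
proof -
  let ?N = "NN m n"
  show R: "R \<in> carrier_mat ?N ?N" "R * R = R" "sharp m n R = R" using O by (auto simp: Oproj_def)
  have im: "mat_image R = {w \<in> carrier_vec ?N. G *\<^sub>v w \<in> mat_image P}" using O by (simp add: Oproj_def)
  show "P * (G * R) = G * R"
  proof (rule mat_col_eqI)
    fix j assume "j < dim_col (G * R)"
    hence j: "j < ?N" using R by simp
    have "R *\<^sub>v unit_vec ?N j \<in> mat_image R" unfolding mat_image_def using R by auto
    hence "G *\<^sub>v (R *\<^sub>v unit_vec ?N j) \<in> mat_image P" using im by blast
    then obtain v where v: "v \<in> carrier_vec ?N" "G *\<^sub>v (R *\<^sub>v unit_vec ?N j) = P *\<^sub>v v"
      unfolding mat_image_def using P by auto
    have "P *\<^sub>v (P *\<^sub>v v) = (P * P) *\<^sub>v v" by (rule assoc_mult_mat_vec[symmetric, OF P(1) P(1) v(1)])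
    hence "P *\<^sub>v (G *\<^sub>v (R *\<^sub>v unit_vec ?N j)) = G *\<^sub>v (R *\<^sub>v unit_vec ?N j)" unfolding v(2) using P by simp
    moreover have "R *\<^sub>v unit_vec ?N j = col R j"
      using R(1) j by (intro eq_vecI) (auto simp: scalar_prod_right_unit)
    ultimately show "col (P * (G * R)) j = col (G * R) j"
      using P R G j by (simp add: col_mult2[of _ ?N ?N _ ?N])
  qed (use P R G in auto)
  fix X :: "complex mat" assume X: "X \<in> carrier_mat ?N ?N" and e: "P * (G * X) = G * X"
  show "R * X = X"
  proof (rule mat_col_eqI)
    fix j assume "j < dim_col X"
    hence j: "j < ?N" using X by simp
    have c: "col X j \<in> carrier_vec ?N" using X j by auto
    have "G *\<^sub>v col X j = P *\<^sub>v (G *\<^sub>v col X j)"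
      using arg_cong[OF e, of "\<lambda>A. col A j"] P G X j by (simp add: col_mult2[of _ ?N ?N _ ?N])
    hence "G *\<^sub>v col X j \<in> mat_image P"
      unfolding mat_image_def using P G c by (auto intro!: exI[of _ "G *\<^sub>v col X j"])
    hence "col X j \<in> mat_image R" using im c by blast
    then obtain v where v: "v \<in> carrier_vec ?N" "col X j = R *\<^sub>v v" unfolding mat_image_def using R by auto
    have "R *\<^sub>v (R *\<^sub>v v) = (R * R) *\<^sub>v v" by (rule assoc_mult_mat_vec[symmetric, OF R(1) R(1) v(1)])
    thus "col (R * X) j = col X j"
      using R X j v by (simp add: col_mult2[of _ ?N ?N _ ?N])
  qed (use R X in auto)
qed

text \<open>\<open>Q u\<close> is a projection onto the image of \<open>R u\<close> depending differentiably on \<open>u\<close>; the orthogonal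
  projection is recovered from \<open>R (Q + Q\<^sup>\<sharp> - 1) = Q\<close>, where the second factor is \<open>2 R - 1\<close>
  at \<open>u = s\<close> and so invertible nearby.\<close>

lemma projection_differentiable:
  fixes m n :: nat
  defines "N \<equiv> NN m n"
  assumes G: "mat_deriv N G G' s" "\<And>u. G u \<in> carrier_mat N N"
    and H: "mat_deriv N H H' s" "\<And>u. H u \<in> carrier_mat N N" "\<And>u. G u * H u = 1\<^sub>m N" "\<And>u. H u * G u = 1\<^sub>m N"
    and P: "P \<in> carrier_mat N N" "P * P = P"
    and R: "\<forall>\<^sub>F u in nhds s. Oproj m n (R u) {w \<in> carrier_vec (NN m n). G u *\<^sub>v w \<in> mat_image P}"
  shows "\<exists>D. mat_deriv N R D s"
proof -
  note oD = OprojD[OF _ G(2)[unfolded N_def] P[unfolded N_def], folded N_def]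
  have N0: "0 < N" by (simp add: N_def)
  have Os: "Oproj m n (R s) {w \<in> carrier_vec (NN m n). G s *\<^sub>v w \<in> mat_image P}"
    using R by (rule eventually_nhds_x_imp_x)
  note s = oD[OF Os[folded N_def]]
  \<comment> \<open>\<open>A\<close> is \<open>R s\<close> transported by \<open>G s\<close>, a
    projection onto the image of \<open>P\<close> like \<open>P\<close> itself, but chosen so that Q
    s = R s; then M s = 2 R s - 1 squares to 1.\<close>
  define A where "A = G s * R s * H s"
  have A: "A \<in> carrier_mat N N" using G(2) H(2) s(1) by (simp add: A_def)
  define Q where "Q u = H u * A * G u" for u
  define M where "M u = Q u + (sharp m n (Q u) - 1\<^sub>m N)" for u
  have Q: "Q u \<in> carrier_mat N N" for u using A G(2) H(2) by (simp add: Q_def)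
  have sQ: "sharp m n (Q u) \<in> carrier_mat N N" for u using Q unfolding N_def by (rule sharp_carrier)
  have M: "M u \<in> carrier_mat N N" for u using Q sQ by (simp add: M_def)
  have as: "X * Y * Z = X * (Y * Z)" if "X \<in> carrier_mat N N" "Y \<in> carrier_mat N N" "Z \<in> carrier_mat N N"
    for X Y Z :: "complex mat" using that by (rule assoc_mult_mat)
  have GH: "G u * (H u * X) = X" "H u * (G u * X) = X" if "X \<in> carrier_mat N N" for X u
    using as[OF G(2) H(2) that, of u u] as[OF H(2) G(2) that, of u u] H(3,4)[of u] that by auto
  have PG: "P * (G s * (R s * X)) = G s * (R s * X)" if "X \<in> carrier_mat N N" for X
  proof -
    have "P * (G s * R s) * X = G s * R s * X" unfolding s(4) ..
    thus ?thesis using that P G(2) s(1) by (simp add: as)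
  qed
  have RM: "R u * M u = Q u" if u: "Oproj m n (R u) {w \<in> carrier_vec (NN m n). G u *\<^sub>v w \<in> mat_image P}" for u
  proof -
    note r = oD[OF u[folded N_def]]
    have GQ: "G u * Q u = G s * (R s * (H s * G u))"
      using G(2) H(2) s(1) by (simp add: Q_def A_def as GH)
    have RQ: "R u * Q u = Q u"
      by (rule r(5)[OF Q]) (unfold GQ, rule PG, use G(2) H(2) in simp)
    have "R s * (H s * (G u * R u)) = H s * (G u * R u)"
      by (rule s(5)) (use G(2) H(2) r in \<open>simp_all add: GH\<close>)
    hence QR: "Q u * R u = R u"
      using G(2) H(2) s(1) r(1) by (simp add: Q_def A_def as GH)
    \<comment> \<open>This is the adjoint of Q R = R; it cancels the -1 in \<open>M\<close> and
      leaves R M = R Q = Q.\<close>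
    have "R u * sharp m n (Q u) = R u"
      using arg_cong[OF QR, of "sharp m n"] sharp_mult[OF Q[unfolded N_def] r(1)[unfolded N_def]] r(3) by simp
    hence "R u * M u = Q u + (R u - R u)"
      using Q sQ r(1) RQ
      by (simp add: M_def mult_add_distrib_mat[of _ N N _ N] mult_minus_distrib_mat[of _ N N _ N])
    also have "\<dots> = Q u" using Q[of u] r(1) by (auto intro!: eq_matI)
    finally show ?thesis .
  qed
  have Qs: "Q s = R s" using G(2) H(2,4) s(1) by (simp add: Q_def A_def as GH)
  have "M s * M s = 1\<^sub>m N"
  proof (rule emb_inject[of N])
    have rr: "emb N (R s) * emb N (R s) = emb N (R s)" using emb_mult[OF N0 s(1) s(1)] s(2) by simp
    show "emb N (M s * M s) = emb N (1\<^sub>m N)"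
      using N0 s(1) by (simp add: M_def Qs s(3) emb_simps) (simp add: algebra_simps rr)
  qed (use M in auto)
  hence d: "det (M s) \<noteq> 0" by (rule det_nz_if_inverse[OF M M])
  have c: "\<forall>\<^sub>F u in nhds s. H u * A \<in> carrier_mat N N" "\<forall>\<^sub>F u in nhds s. H u \<in> carrier_mat N N"
    "\<forall>\<^sub>F u in nhds s. G u \<in> carrier_mat N N" "\<forall>\<^sub>F u in nhds s. A \<in> carrier_mat N N"
    "\<forall>\<^sub>F u in nhds s. Q u \<in> carrier_mat N N" "\<forall>\<^sub>F u in nhds s. sharp m n (Q u) - 1\<^sub>m N \<in> carrier_mat N N"
    "\<forall>\<^sub>F u in nhds s. 1\<^sub>m N \<in> carrier_mat N N"
    using A G(2) H(2) Q sQ by simp_all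
  obtain Q' where Q': "mat_deriv N Q Q' s"
    using mat_deriv_mult[OF mat_deriv_mult[OF H(1) c(2) mat_deriv_const c(4)] c(1) G(1) c(3)]
    unfolding Q_def[abs_def] by blast
  obtain M' where M': "mat_deriv N M M' s"
    using mat_deriv_add[OF Q' mat_deriv_minus[OF mat_deriv_sharp[OF Q'[unfolded N_def] c(5)[unfolded N_def], folded N_def]
       mat_deriv_const[of N "1\<^sub>m N" s] c(7)] c(6)]
    unfolding M_def[abs_def] by blast
  show ?thesis
  proof (rule quotient_differentiable[OF Q' Q M' M d])
    show "\<forall>\<^sub>F u in nhds s. R u \<in> carrier_mat N N \<and> R u * M u = Q u"
      using R by eventually_elim (use RM oD(1) in \<open>auto simp: N_def\<close>)
  qed
qed

text \<open>\<open>B\<close> is the logarithmic derivative of \<open>G\<close>, and \<open>B'\<close> stands for its value at \<open>-\<alpha>\<close>.\<close>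

lemma projection_derivative:
  fixes m n :: nat
  defines "N \<equiv> NN m n"
  assumes G: "mat_deriv N G G' s" "\<And>u. G u \<in> carrier_mat N N"
    and H: "H \<in> carrier_mat N N" "G s * H = 1\<^sub>m N"
    and P: "P \<in> carrier_mat N N" "P * P = P"
    and R: "\<forall>\<^sub>F u in nhds s. Oproj m n (R u) {w \<in> carrier_vec (NN m n). G u *\<^sub>v w \<in> mat_image P}"
    and D: "mat_deriv N R D s"
    and B: "B = H * G'" and B': "B' \<in> carrier_mat N N" "sharp m n B = - B'"
  shows "(1\<^sub>m N - R s) * (B * R s + D) = 0\<^sub>m N N"
    and "R s * (B' * (1\<^sub>m N - R s) - D) = 0\<^sub>m N N"
proof -
  note oD = OprojD[OF _ G(2)[unfolded N_def] P[unfolded N_def], folded N_def]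
  have N0: "0 < N" by (simp add: N_def)
  have Os: "Oproj m n (R s) {w \<in> carrier_vec (NN m n). G s *\<^sub>v w \<in> mat_image P}"
    using R by (rule eventually_nhds_x_imp_x)
  note r = oD[OF Os[folded N_def]]
  have cG': "G' \<in> carrier_mat N N" and cD: "D \<in> carrier_mat N N" using G D by (auto dest: mat_deriv_carrier)
  have cB: "B \<in> carrier_mat N N" using B H cG' by simp
  have as: "X * Y * Z = X * (Y * Z)" if "X \<in> carrier_mat N N" "Y \<in> carrier_mat N N" "Z \<in> carrier_mat N N"
    for X Y Z :: "complex mat" using that by (rule assoc_mult_mat)
  have ev: "\<forall>\<^sub>F u in nhds s. R u \<in> carrier_mat N N" "\<forall>\<^sub>F u in nhds s. R u * R u = R u"
    "\<forall>\<^sub>F u in nhds s. sharp m n (R u) = R u" "\<forall>\<^sub>F u in nhds s. P * (G u * R u) = G u * R u"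
    using R[folded N_def] by (auto intro: oD(1-4) elim!: eventually_mono simp del: index_mult_mat(1))
  have evG: "\<forall>\<^sub>F u in nhds s. G u \<in> carrier_mat N N" "\<forall>\<^sub>F u in nhds s. P \<in> carrier_mat N N"
    "\<forall>\<^sub>F u in nhds s. G u * R u \<in> carrier_mat N N"
    using G(2) P ev(1) by (auto elim!: eventually_mono)
  have GH: "G s * (H * X) = X" if "X \<in> carrier_mat N N" for X
    using as[OF G(2) H(1) that, of s] H(2) that by simp
  note d1 = mat_deriv_mult[OF G(1) evG(1) D ev(1)]
  \<comment> \<open>Differentiating P G R = G R shows that \<open>P\<close> fixes G (D + B R); hence
    the columns of D + B R lie in the moving subspace and \<open>R s\<close> fixes it.\<close>
  have "mat_deriv N (\<lambda>u. P * (G u * R u)) (P * (G s * D + G' * R s) + 0\<^sub>m N N * (G s * R s)) s"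
    by (rule mat_deriv_mult[OF mat_deriv_const evG(2) d1 evG(3)])
  hence "P * (G s * D + G' * R s) + 0\<^sub>m N N * (G s * R s) = G s * D + G' * R s"
    by (rule mat_deriv_unique[OF mat_deriv_cong[OF _ ev(4)] d1])
  hence "P * (G s * D + G' * R s) = G s * D + G' * R s"
    using P G(2)[of s] cG' cD r(1) by (simp add: left_mult_zero_mat[of _ N N] right_add_zero_mat[of _ N N])
  moreover have "G s * D + G' * R s = G s * (D + B * R s)"
    using G(2)[of s] cG' cD r(1) H(1) unfolding B by (simp add: mult_add_distrib_mat[of _ N N _ N] as GH)
  ultimately have RX: "R s * (D + B * R s) = D + B * R s"
    using cD cB r(1) by (intro r(5)) simp_all
  have "mat_deriv N R (R s * D + D * R s) s"
    using mat_deriv_cong[OF mat_deriv_mult[OF D ev(1) D ev(1)] ev(2)] .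
  hence RD: "R s * D + D * R s = D" using D mat_deriv_unique by blast
  have "mat_deriv N R (sharp m n D) s"
    using mat_deriv_cong[OF mat_deriv_sharp[OF D[unfolded N_def] ev(1)[unfolded N_def]] ev(3), folded N_def] .
  hence sD: "sharp m n D = D" using D mat_deriv_unique by blast
  \<comment> \<open>The adjoint of \<open>RX\<close>: \<open>D\<close> and \<open>R s\<close> are
    self-adjoint, and \<open>B\<close> turns into -B'.\<close>
  have sX: "(D - R s * B') * R s = D - R s * B'"
  proof -
    have "sharp m n (D + B * R s) = D + R s * - B'"
      using cD cB r(1,3) sD B'(2)
      unfolding N_def by (simp add: sharp_linear(1) sharp_mult)
    also have "\<dots> = D - R s * B'"
      using cD r(1) B'(1) by (auto intro!: eq_matI simp del: index_mult_mat(1))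
    finally have e: "sharp m n (D + B * R s) = D - R s * B'" .
    have "sharp m n (R s * (D + B * R s)) = sharp m n (D + B * R s) * R s"
      using cD cB r(1,3) unfolding N_def by (subst sharp_mult) simp_all
    thus ?thesis unfolding RX e by simp
  qed
  define rr dd bb cc where "rr = emb N (R s)" and "dd = emb N D" and "bb = emb N B" and "cc = emb N B'"
  note es = emb_simps N0 r(1) cD cB B'(1) rr_def[symmetric] dd_def[symmetric] bb_def[symmetric] cc_def[symmetric]
  have e1: "rr * (dd + bb * rr) = dd + bb * rr" using arg_cong[OF RX, of "emb N"] by (simp add: es)
  have e2: "rr * dd + dd * rr = dd" using arg_cong[OF RD, of "emb N"] by (simp add: es)
  have e3: "(dd - rr * cc) * rr = dd - rr * cc" using arg_cong[OF sX, of "emb N"] by (simp add: es)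
  have e4: "rr * rr = rr" using arg_cong[OF r(2), of "emb N"] by (simp add: es)
  show "(1\<^sub>m N - R s) * (B * R s + D) = 0\<^sub>m N N"
    by (rule emb_inject[of N]) (use r(1) cD cB e1 in \<open>simp_all add: es algebra_simps\<close>)
  have "rr * (cc * (1 - rr) - dd) = 0"
  proof -
    \<comment> \<open>The last bracket vanishes because R D + D R = D, the derivative of R R =
      R.\<close>
    have "rr * (cc * (1 - rr) - dd) = (dd - rr * cc) * rr - (dd - rr * cc) + (dd - (rr * dd + dd * rr))"
      by (simp add: algebra_simps)
    thus ?thesis unfolding e2 e3 by simp
  qed
  thus "R s * (B' * (1\<^sub>m N - R s) - D) = 0\<^sub>m N N"
    by (intro emb_inject[of N]) (use r(1) cD B'(1) in \<open>simp_all add: es\<close>)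
qed

section \<open>The dressed frame and the dressed solution\<close>

lemma sharp_gk:
  assumes R: "R \<in> carrier_mat (NN m n) (NN m n)" "sharp m n R = R"
  shows "sharp m n (gk (NN m n) a R (- z)) = gk (NN m n) (- a) R z"
proof -
  have "2 * a / (- z - a) = 2 * (- a) / (z - (- a))"
    by (metis add.commute diff_minus_eq_add minus_diff_eq minus_divide_divide minus_minus mult_minus_right)
  thus ?thesis
    using R unfolding gk_def by (simp add: sharp_linear sharp_one)
qed

text \<open>To be used with \<open>F\<close> the frame at -lambda and \<open>F'\<close> the frame at
  lambda: reality makes the inverse an adjoint, which is differentiable whenever the frame
  is.\<close>

lemma frame_inverse:
  assumes F: "F \<in> carrier_mat (NN m n) (NN m n)" "det F = 1" "F' \<in> carrier_mat (NN m n) (NN m n)"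
    and s: "sigma m n F = F'"
  shows "sharp m n F * F' = 1\<^sub>m (NN m n)" "F' * sharp m n F = 1\<^sub>m (NN m n)" "minv F' = sharp m n F"
proof -
  have "det (sharp m n F) \<noteq> 0" using F by (simp add: det_sharp)
  note i = minv_det_nz[OF sharp_carrier[OF F(1)] this]
  show "sharp m n F * F' = 1\<^sub>m (NN m n)" "F' * sharp m n F = 1\<^sub>m (NN m n)"
    using i s by (simp_all add: sigma_eq)
  thus "minv F' = sharp m n F"
    by (intro minv_eqI_field[OF F(3) sharp_carrier[OF F(1)]]) simp
qed

lemma gk_conjugate:
  assumes "F \<in> carrier_mat N N" "H \<in> carrier_mat N N" "P \<in> carrier_mat N N" "H * F = 1\<^sub>m N" "0 < N"
  shows "H * gk N a P u * F = gk N a (H * P * F) u"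
proof (rule emb_inject[of N])
  have h: "emb N H * emb N F = 1" using emb_mult[of N H F] assms emb_1 by metis
  show "emb N (H * gk N a P u * F) = emb N (gk N a (H * P * F) u)"
    using assms(1-3,5)
    by (simp add: gk_def emb_simps) (simp add: algebra_simps sc_central'[of "emb N H"] h)
qed (use assms in simp_all)

lemma mat_deriv_gk:
  fixes R :: "real \<Rightarrow> complex mat"
  assumes R: "mat_deriv N R D s" "\<forall>\<^sub>F u in nhds s. R u \<in> carrier_mat N N"
  shows "mat_deriv N (\<lambda>u. gk N (- a) (R u) z) ((2 * a / (z + a)) \<cdot>\<^sub>m D) s"
proof -
  let ?k = "2 * (- a) / (z - (- a))"
  have D: "D \<in> carrier_mat N N" using R(1) by (rule mat_deriv_carrier)
  have ev: "\<forall>\<^sub>F u in nhds s. 1\<^sub>m N - R u \<in> carrier_mat N N" "\<forall>\<^sub>F u in nhds s. ?k \<cdot>\<^sub>m (1\<^sub>m N - R u) \<in> carrier_mat N N"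
    using R(2) by (auto elim!: eventually_mono)
  have "mat_deriv N (\<lambda>u. 1\<^sub>m N + ?k \<cdot>\<^sub>m (1\<^sub>m N - R u)) (0\<^sub>m N N + ?k \<cdot>\<^sub>m (0\<^sub>m N N - D)) s"
    by (rule mat_deriv_add[OF mat_deriv_const mat_deriv_smult[OF mat_deriv_minus[OF mat_deriv_const R] ev(1)] ev(2)])
  also have "0\<^sub>m N N + ?k \<cdot>\<^sub>m (0\<^sub>m N N - D) = (2 * a / (z + a)) \<cdot>\<^sub>m D"
    using D by (intro eq_matI) auto
  finally show ?thesis unfolding gk_def .
qed

text \<open>The dressed frame along a coordinate line, for both variables at once; \<open>B z\<close> is the logarithmic
  derivative of the given frame at spectral value \<open>z\<close>.\<close>

lemma frame_line:
  fixes m n :: nat and F :: "real \<Rightarrow> complex \<Rightarrow> complex mat"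
  defines "N \<equiv> NN m n"
  assumes F: "\<And>u z. F u z \<in> carrier_mat N N" "\<And>u z. det (F u z) = 1"
      "\<And>u z. sigma m n (F u (- z)) = F u z"
    and FB: "\<And>z. \<exists>F'. mat_deriv N (\<lambda>u. F u z) F' s \<and> minv (F s z) * F' = B z"
    and P: "P \<in> carrier_mat N N" "P * P = P"
    and R: "\<forall>\<^sub>F u in nhds s. Oproj m n (R u) {w \<in> carrier_vec (NN m n). F u a *\<^sub>v w \<in> mat_image P}"
  obtains D where "mat_deriv N R D s"
    "(1\<^sub>m N - R s) * (B a * R s + D) = 0\<^sub>m N N"
    "R s * (B (- a) * (1\<^sub>m N - R s) - D) = 0\<^sub>m N N"
    "\<And>z. z \<noteq> a \<Longrightarrow> z \<noteq> - a \<Longrightarrow> \<exists>F'. mat_deriv N (\<lambda>u. kmat N a P z * F u z * minv (kmat N a (R u) z)) F' s \<and>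
      minv (kmat N a P z * F s z * minv (kmat N a (R s) z)) * F'
      = gk N a (R s) z * B z * gk N (- a) (R s) z + (2 * a / (z + a)) \<cdot>\<^sub>m (gk N a (R s) z * D)"
proof -
  have N0: "0 < N" by (simp add: N_def)
  define H where "H u z = sharp m n (F u (- z))" for u z
  have H: "H u z \<in> carrier_mat N N" for u z
    unfolding H_def N_def by (rule sharp_carrier[OF F(1)[unfolded N_def]])
  have HF: "H u z * F u z = 1\<^sub>m N" "F u z * H u z = 1\<^sub>m N" "minv (F u z) = H u z" for u z
    unfolding H_def N_def
    by (rule frame_inverse[OF F(1)[unfolded N_def] F(2) F(1)[unfolded N_def] F(3)])+
  have as: "X * Y * Z = X * (Y * Z)" if "X \<in> carrier_mat N N" "Y \<in> carrier_mat N N" "Z \<in> carrier_mat N N"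
    for X Y Z :: "complex mat" using that by (rule assoc_mult_mat)
  have FH: "F u z * (H u z * X) = X" "H u z * (F u z * X) = X" if "X \<in> carrier_mat N N" for X u z
    using as[OF F(1) H that, of u z u z] as[OF H F(1) that, of u z u z] HF(1,2)[of u z] that by auto
  obtain F' where F': "\<And>z. mat_deriv N (\<lambda>u. F u z) (F' z) s" "\<And>z. H s z * F' z = B z"
    using FB unfolding HF(3) by metis
  have cF': "F' z \<in> carrier_mat N N" for z using F'(1) by (rule mat_deriv_carrier)
  have B: "B z \<in> carrier_mat N N" for z unfolding F'(2)[symmetric] using H cF' by simp
  have F'B: "F' z = F s z * B z" for z unfolding F'(2)[symmetric] using FH(1) cF' by simp
  have evF: "\<forall>\<^sub>F u in nhds s. F u z \<in> carrier_mat N N" "\<forall>\<^sub>F u in nhds s. H u z \<in> carrier_mat N N" for z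
    using F(1) H by simp_all
  have H': "mat_deriv N (\<lambda>u. H u z) (sharp m n (F' (- z))) s" for z
    unfolding H_def N_def by (rule mat_deriv_sharp[OF F'(1)[unfolded N_def] evF(1)[unfolded N_def]])
  \<comment> \<open>Reality of the logarithmic derivative: F(-z)^-1 F(-z) = 1 is differentiated with
    the inverse written as the adjoint of F(z).\<close>
  have sB: "sharp m n (B z) = - B (- z)" for z
  proof -
    have "sharp m n (F' z) = sharp m n (B z) * H s (- z)"
      unfolding F'B H_def using F(1) B by (simp add: N_def sharp_mult)
    moreover have "mat_deriv N (\<lambda>u. 1\<^sub>m N) (H s (- z) * F' (- z) + sharp m n (F' z) * F s (- z)) s"
      using mat_deriv_mult[OF H'[of "- z"] evF(2) F'(1)[of "- z"] evF(1)] unfolding HF by simp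
    hence "H s (- z) * F' (- z) + sharp m n (F' z) * F s (- z) = 0\<^sub>m N N"
      by (rule mat_deriv_unique[OF _ mat_deriv_const])
    ultimately have "B (- z) + sharp m n (B z) * H s (- z) * F s (- z) = 0\<^sub>m N N"
      by (simp add: F'(2))
    hence e: "B (- z) + sharp m n (B z) = 0\<^sub>m N N"
      using sharp_carrier[OF B[unfolded N_def], folded N_def] H F(1) HF(1)[of s "- z"] as
      by (simp add: right_mult_one_mat[of _ N N])
    show ?thesis
    proof (rule eq_matI)
      fix i j assume "i < dim_row (- B (- z))" "j < dim_col (- B (- z))"
      hence ij: "i < N" "j < N" using B[of "- z"] by auto
      thus "sharp m n (B z) $$ (i,j) = (- B (- z)) $$ (i,j)"
        using arg_cong[OF e, of "\<lambda>A. A $$ (i,j)"] B[of "- z"] sharp_carrier[OF B[unfolded N_def], folded N_def, of z]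
        by (simp add: add_eq_0_iff)
    qed (use B[of "- z"] sharp_carrier[OF B[unfolded N_def], folded N_def, of z] in auto)
  qed
  obtain D where D: "mat_deriv N R D s"
    using projection_differentiable[OF F'(1)[unfolded N_def] F(1)[unfolded N_def] H'[unfolded N_def] H[unfolded N_def]
      HF(2,1)[unfolded N_def] P[unfolded N_def] R] unfolding N_def by blast
  have cD: "D \<in> carrier_mat N N" using D by (rule mat_deriv_carrier)
  note zz = projection_derivative[OF F'(1)[unfolded N_def] F(1)[unfolded N_def] H[unfolded N_def] HF(2)[unfolded N_def]
      P[unfolded N_def] R D[unfolded N_def] F'(2)[symmetric] B[unfolded N_def] sB, folded N_def]
  have Oproj: "R u \<in> carrier_mat N N" "R u * R u = R u"
    if "Oproj m n (R u) {w \<in> carrier_vec (NN m n). F u a *\<^sub>v w \<in> mat_image P}" for u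
    using that by (auto simp: Oproj_def N_def)
  have Rs: "R s \<in> carrier_mat N N" "R s * R s = R s" using Oproj R eventually_nhds_x_imp_x by blast+
  have evR: "\<forall>\<^sub>F u in nhds s. R u \<in> carrier_mat N N" "\<forall>\<^sub>F u in nhds s. R u * R u = R u"
    using R by (auto elim!: eventually_mono dest: Oproj)
  show ?thesis
  proof (rule that[OF D zz])
    fix z assume z: "z \<noteq> a" "z \<noteq> - a"
    let ?k = "\<lambda>u. gk N (- a) (R u) z" and ?p = "gk N a P z"
    define K' where "K' = (2 * a / (z + a)) \<cdot>\<^sub>m D"
    have cK': "K' \<in> carrier_mat N N" using cD by (simp add: K'_def)
    have k': "mat_deriv N ?k K' s" unfolding K'_def by (rule mat_deriv_gk[OF D evR(1)])
    have evk: "\<forall>\<^sub>F u in nhds s. ?k u \<in> carrier_mat N N" using evR(1) by eventually_elim simp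
    have evp: "\<forall>\<^sub>F u in nhds s. ?p \<in> carrier_mat N N" "\<forall>\<^sub>F u in nhds s. ?p * F u z \<in> carrier_mat N N"
      using P F(1) by simp_all
    have mk: "minv (kmat N a (R u) z) = ?k u" if "R u \<in> carrier_mat N N" "R u * R u = R u" for u
      unfolding kmat_eq_gk by (rule minv_gk[OF that z N0])
    note d = mat_deriv_mult[OF mat_deriv_mult[OF mat_deriv_const evp(1) F'(1) evF(1)] evp(2) k' evk]
    define F2 where "F2 = ?p * F s z * K' + (?p * F' z + 0\<^sub>m N N * F s z) * ?k s"
    have F2: "F2 = ?p * F s z * K' + ?p * F s z * B z * ?k s"
      using P F(1)[of s z] B[of z] Rs(1) cK' unfolding F2_def F'B
      by (simp add: as left_mult_zero_mat[of _ N N] right_add_zero_mat[of _ N N])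
    have "mat_deriv N (\<lambda>u. kmat N a P z * F u z * minv (kmat N a (R u) z)) F2 s"
      unfolding F2_def
      by (rule mat_deriv_cong[OF d]) (use evR in \<open>eventually_elim; simp add: mk[unfolded kmat_eq_gk] kmat_eq_gk\<close>)
    moreover have "minv (kmat N a P z * F s z * minv (kmat N a (R s) z)) * F2
      = gk N a (R s) z * B z * ?k s + (2 * a / (z + a)) \<cdot>\<^sub>m (gk N a (R s) z * D)"
    proof -
      let ?p' = "gk N (- a) P z" and ?k' = "gk N a (R s) z"
      note cc = gk_carrier[OF P(1), of a z] gk_carrier[OF P(1), of "- a" z] gk_carrier[OF Rs(1), of a z]
        gk_carrier[OF Rs(1), of "- a" z] F(1)[of s z] H[of s z] B[of z] cK' cD
      have pp: "?p' * (?p * X) = X" if "X \<in> carrier_mat N N" for X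
        using as[OF cc(2,1) that] gk_inverse'[OF P z N0] that by simp
      have pp': "?p * (?p' * X) = X" if "X \<in> carrier_mat N N" for X
        using as[OF cc(1,2) that] gk_inverse[OF P z N0] that by simp
      have kk: "?k s * (?k' * X) = X" if "X \<in> carrier_mat N N" for X
        using as[OF cc(4,3) that] gk_inverse'[OF Rs z N0] that by simp
      have "minv (?p * F s z * ?k s) = ?k' * H s z * ?p'"
        by (rule minv_eqI_field[of _ N])
           (use cc in \<open>simp_all add: as kk FH pp' gk_inverse[OF P z N0]\<close>)
      hence "minv (kmat N a P z * F s z * minv (kmat N a (R s) z)) * F2 = ?k' * H s z * ?p' * F2"
        unfolding mk[OF Rs] by (simp add: kmat_eq_gk)
      also have "\<dots> = ?k' * K' + ?k' * B z * ?k s"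
        unfolding F2 using cc by (simp add: mult_add_distrib_mat[of _ N N _ N] as pp FH)
      also have "\<dots> = ?k' * B z * ?k s + ?k' * K'"
        using cc by (intro comm_add_mat[of _ N N]) simp_all
      also have "?k' * K' = (2 * a / (z + a)) \<cdot>\<^sub>m (?k' * D)"
        unfolding K'_def by (rule mult_smult_distrib[OF cc(3) cD])
      finally show ?thesis .
    qed
    ultimately show "\<exists>F'. mat_deriv N (\<lambda>u. kmat N a P z * F u z * minv (kmat N a (R u) z)) F' s \<and>
      minv (kmat N a P z * F s z * minv (kmat N a (R s) z)) * F'
      = gk N a (R s) z * B z * gk N (- a) (R s) z + (2 * a / (z + a)) \<cdot>\<^sub>m (gk N a (R s) z * D)" by blast
  qed
qed

text \<open>\<open>R\<close> and \<open>P\<close> project onto different subspaces, but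
  \<open>R\<close> has the same image as F(a)^-1 P F(a), which is conjugate to \<open>P\<close>; so
  the two simple factors have equal determinants. Reality holds since the adjoint of each simple
  factor at -z is its inverse at z.\<close>

lemma dressed_frame_algebra:
  fixes m n :: nat and F :: "complex \<Rightarrow> complex mat"
  defines "N \<equiv> NN m n"
  assumes F: "\<And>z. F z \<in> carrier_mat N N" "\<And>z. det (F z) = 1" "\<And>z. sigma m n (F (- z)) = F z"
    and P: "P \<in> carrier_mat N N" "P * P = P" "sharp m n P = P"
    and R: "Oproj m n R {w \<in> carrier_vec (NN m n). F a *\<^sub>v w \<in> mat_image P}"
    and z: "z \<noteq> a" "z \<noteq> - a"
  shows "det (kmat N a P z * F z * minv (kmat N a R z)) = 1"
    and "sigma m n (kmat N a P (- z) * F (- z) * minv (kmat N a R (- z)))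
      = kmat N a P z * F z * minv (kmat N a R z)"
proof -
  have N0: "0 < N" by (simp add: N_def)
  define H where "H z = sharp m n (F (- z))" for z
  have H: "H z \<in> carrier_mat N N" for z
    unfolding H_def N_def by (rule sharp_carrier[OF F(1)[unfolded N_def]])
  have HF: "H z * F z = 1\<^sub>m N" "F z * H z = 1\<^sub>m N" for z
    unfolding H_def N_def
    by (rule frame_inverse[OF F(1)[unfolded N_def] F(2) F(1)[unfolded N_def] F(3)])+
  have as: "X * Y * Z = X * (Y * Z)" if "X \<in> carrier_mat N N" "Y \<in> carrier_mat N N" "Z \<in> carrier_mat N N"
    for X Y Z :: "complex mat" using that by (rule assoc_mult_mat)
  note r = OprojD[OF R F(1)[unfolded N_def] P(1)[unfolded N_def] P(2), folded N_def]
  have FH: "F z * (H z * X) = X" "H z * (F z * X) = X" if "X \<in> carrier_mat N N" for X z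
    using as[OF F(1) H that, of z z] as[OF H F(1) that, of z z] HF(1,2)[of z] that by auto
  have z': "- z \<noteq> a" "- z \<noteq> - a" using z by (auto simp: minus_equation_iff)
  have mk: "minv (kmat N a R z) = gk N (- a) R z" "minv (kmat N a R (- z)) = gk N (- a) R (- z)"
    unfolding kmat_eq_gk by (rule minv_gk[OF r(1,2) _ _ N0], use z z' in simp_all)+
  define Q where "Q = H a * P * F a"
  have Q: "Q \<in> carrier_mat N N" using H F(1) P by (simp add: Q_def)
  have PPX: "P * (P * X) = P * X" if "X \<in> carrier_mat N N" for X using as[OF P(1,1) that] P(2) by simp
  have RQ: "R * Q = Q"
    by (rule r(5)[OF Q]) (use H F(1) P in \<open>simp add: Q_def as FH PPX\<close>)
  have QR: "Q * R = R"
    unfolding Q_def using H F(1) P(1) r(1,4) by (simp add: as FH)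
  have "det (gk N a R z) = det (gk N a Q z)" by (rule det_gk_same_image[OF r(1) Q RQ QR N0])
  also have "gk N a Q z = H a * gk N a P z * F a"
    unfolding Q_def by (rule gk_conjugate[symmetric, OF F(1) H P(1) HF(1) N0])
  also have "det (H a * gk N a P z * F a) = det (gk N a P z)"
    using H F(1,2) P(1) det_mult[OF H F(1), of a a] HF(1)[of a] by (simp add: det_mult[of _ N])
  finally have dd: "det (gk N a R z) = det (gk N a P z)" .
  have "det (gk N a R z) * det (gk N (- a) R z) = 1"
    using gk_inverse[OF r(1,2) z N0] r(1) det_mult[of "gk N a R z" N "gk N (- a) R z"] by simp
  thus "det (kmat N a P z * F z * minv (kmat N a R z)) = 1"
    unfolding mk unfolding kmat_eq_gk using P(1) F(1,2) r(1)
    by (simp add: det_mult[of _ N] dd del: assoc_mult_mat)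
  have sk: "sharp m n (gk N a P (- z)) = gk N (- a) P z" "sharp m n (gk N (- a) R (- z)) = gk N a R z"
    using sharp_gk[of P m n a z] sharp_gk[of R m n "- a" z] P(1,3) r(1,3) by (simp_all add: N_def)
  define Y where "Y = gk N a P (- z) * F (- z) * gk N (- a) R (- z)"
  have Y: "Y \<in> carrier_mat N N" using P(1) r(1) F(1) by (simp add: Y_def)
  have "sharp m n Y = gk N a R z * (H z * gk N (- a) P z)"
    unfolding Y_def H_def using P(1) r(1) F(1) sk
    unfolding N_def by (simp add: sharp_mult del: assoc_mult_mat)
  moreover have "gk N a R z * (H z * gk N (- a) P z) * (gk N a P z * F z * gk N (- a) R z) = 1\<^sub>m N"
  proof -
    have "gk N (- a) P z * (gk N a P z * X) = X" if "X \<in> carrier_mat N N" for X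
      using as[OF gk_carrier[OF P(1), of "- a" z] gk_carrier[OF P(1), of a z] that] gk_inverse'[OF P(1,2) z N0] that by simp
    thus ?thesis using P(1) r(1) F(1) H gk_inverse[OF r(1,2) z N0] by (simp add: as FH)
  qed
  ultimately have "minv (sharp m n Y) = gk N a P z * F z * gk N (- a) R z"
    using P(1) r(1) F(1) H by (intro minv_eqI_field[of _ N]) simp_all
  thus "sigma m n (kmat N a P (- z) * F (- z) * minv (kmat N a R (- z)))
      = kmat N a P z * F z * minv (kmat N a R z)"
    unfolding mk unfolding kmat_eq_gk sigma_eq Y_def .
qed

section \<open>Gauge transformation of the Lax equation\<close>

lemma gauge_linear:
  fixes a u :: "'a::field"
  assumes c: "R \<in> carrier_mat N N" "E \<in> carrier_mat N N" "A \<in> carrier_mat N N" "D \<in> carrier_mat N N" "0 < N"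
    and R: "R * R = R"
    and z1: "(1\<^sub>m N - R) * ((a \<cdot>\<^sub>m E + A) * R + D) = 0\<^sub>m N N"
    and z2: "R * ((A - a \<cdot>\<^sub>m E) * (1\<^sub>m N - R) - D) = 0\<^sub>m N N"
    and u: "u \<noteq> a" "u \<noteq> - a"
  shows "gk N a R u * (u \<cdot>\<^sub>m E + A) * gk N (- a) R u + (2 * a / (u + a)) \<cdot>\<^sub>m (gk N a R u * D)
    = u \<cdot>\<^sub>m E + A + (2 * a) \<cdot>\<^sub>m (E * R - R * E)"
proof (rule smult_mat_cancel[of _ _ _ N N])
  have "u \<cdot>\<^sub>m E + A \<in> carrier_mat N N" using c by simp
  thus "((u - a) * (u + a)) \<cdot>\<^sub>m (gk N a R u * (u \<cdot>\<^sub>m E + A) * gk N (- a) R u + (2 * a / (u + a)) \<cdot>\<^sub>m (gk N a R u * D))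
    = ((u - a) * (u + a)) \<cdot>\<^sub>m (u \<cdot>\<^sub>m E + A + (2 * a) \<cdot>\<^sub>m (E * R - R * E))"
    using dress_num_linear[OF c R z1 z2, of u] dress_num_field[OF c(1) _ c(4,5) u] by metis
qed (use c u in \<open>auto simp: add_eq_0_iff2\<close>)

lemma ser_deriv_unique:
  assumes "ser_deriv N f D s" "ser_deriv N f D' s"
  shows "D = D'"
proof (rule eq_matI)
  fix r c assume "r < dim_row D'" "c < dim_col D'"
  hence rc: "r < N" "c < N" using assms by (auto simp: ser_deriv_def)
  show "D $$ (r,c) = D' $$ (r,c)"
  proof (rule fls_eqI)
    fix k show "fls_nth (D $$ (r,c)) k = fls_nth (D' $$ (r,c)) k"
      using assms rc unfolding ser_deriv_def
      by (blast intro: has_vector_derivative_unique[of "\<lambda>u. fls_nth (f u $$ (r,c)) k" _ s])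
  qed
qed (use assms in \<open>auto simp: ser_deriv_def\<close>)

text \<open>Gauge covariance of s' = [s, M]: conjugation by a moving k replaces M by k M k^-1 + k
  (k^-1)', the same expression as for the logarithmic derivative of the dressed frame.
  \<open>d\<close> is the derivative of k k^-1 = 1.\<close>

lemma linop_gauge_lax:
  fixes k k' kx k'x s M :: "'a::ring_1"
  assumes kk: "k' * k = 1" and d: "k * k'x + kx * k' = 0"
  shows "k * s * k'x + (k * (s * M - M * s) + kx * s) * k'
    = (k * s * k') * (k * M * k' + k * k'x) - (k * M * k' + k * k'x) * (k * s * k')"
proof -
  have kk': "k' * (k * X) = X" for X using kk by (simp flip: mult.assoc)
  have d': "k * k'x = - (kx * k')" using d by (simp add: eq_neg_iff_add_eq_0)
  have "(k * s * k') * (k * M * k' + k * k'x) = k * s * M * k' + k * s * k'x"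
    by (simp add: algebra_simps kk')
  moreover have "(k * M * k' + k * k'x) * (k * s * k') = k * M * s * k' - kx * s * k'"
    unfolding d' by (simp add: algebra_simps kk')
  ultimately show ?thesis by (simp add: algebra_simps)
qed

text \<open>The degree-one gauge formula is used twice: over the complex numbers for the frame, and
  over Laurent series with u = 1/mu to identify the transform of J + q with J + qt. Gauge covariance
  then gives the Lax equation of the dressed series.\<close>

lemma lax_dressed:
  fixes m n :: nat and a :: complex and S :: "real \<Rightarrow> complex fls mat"
  defines "N \<equiv> NN m n"
  defines "St \<equiv> \<lambda>R u. Kser N a (R u) * S u * Kser N (- a) (R u)"
  assumes q: "q \<in> carrier_mat N N"
    and S: "ser_deriv N S Sx s" "\<And>u. ord_ge N (-1) (S u)"
    and Sx: "Sx + ((Jser m n + cser q) * S s - S s * (Jser m n + cser q)) = 0\<^sub>m N N"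
    and R: "mat_deriv N R D s" "\<forall>\<^sub>F u in nhds s. R u \<in> carrier_mat N N" "\<forall>\<^sub>F u in nhds s. R u * R u = R u"
    and z1: "(1\<^sub>m N - R s) * ((Jmat m n a + q) * R s + D) = 0\<^sub>m N N"
    and z2: "R s * ((Jmat m n (- a) + q) * (1\<^sub>m N - R s) - D) = 0\<^sub>m N N"
    and qt: "qt = q + (2 * a) \<cdot>\<^sub>m (Emat m n * R s - R s * Emat m n)"
  shows "ser_deriv N S (S s * (Jser m n + cser q) - (Jser m n + cser q) * S s) s"
    and "ser_deriv N (St R) (St R s * (Jser m n + cser qt) - (Jser m n + cser qt) * St R s) s"
    and "\<forall>\<^sub>F u in nhds s. ord_ge N (-1) (St R u)"
    and "z \<noteq> a \<Longrightarrow> z \<noteq> - a \<Longrightarrow> gk N a (R s) z * (Jmat m n z + q) * gk N (- a) (R s) z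
      + (2 * a / (z + a)) \<cdot>\<^sub>m (gk N a (R s) z * D) = Jmat m n z + qt"
proof -
  let ?E = "Emat m n" and ?A = "bmat m n + q"
  have N0: "0 < N" by (simp add: N_def)
  have cE: "?E \<in> carrier_mat N N" "bmat m n \<in> carrier_mat N N" "Jser m n \<in> carrier_mat N N" by (simp_all add: N_def)
  have cA: "?A \<in> carrier_mat N N" using q by simp
  have r: "R s \<in> carrier_mat N N" "R s * R s = R s" using R(2,3) eventually_nhds_x_imp_x by blast+
  have cD: "D \<in> carrier_mat N N" using R(1) by (rule mat_deriv_carrier)
  have J: "Jmat m n z + q = z \<cdot>\<^sub>m ?E + ?A" "Jmat m n (- z) + q = ?A - z \<cdot>\<^sub>m ?E" for z
    unfolding Jmat_def using q cE by (auto intro!: eq_matI)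
  note z1' = z1[unfolded J(1)] and z2' = z2[unfolded J(2)]
  have cqt: "qt \<in> carrier_mat N N" unfolding qt using q cE r by simp
  have Jt: "Jmat m n z + qt = z \<cdot>\<^sub>m ?E + ?A + (2 * a) \<cdot>\<^sub>m (?E * R s - R s * ?E)" for z
    unfolding qt J[symmetric] Jmat_def using q cE r by (auto intro!: eq_matI simp del: index_mult_mat(1))
  show "z \<noteq> a \<Longrightarrow> z \<noteq> - a \<Longrightarrow> gk N a (R s) z * (Jmat m n z + q) * gk N (- a) (R s) z
      + (2 * a / (z + a)) \<cdot>\<^sub>m (gk N a (R s) z * D) = Jmat m n z + qt"
    unfolding J(1) Jt by (rule gauge_linear[OF r(1) cE(1) cA cD N0 r(2) z1' z2'])
  define M where "M = Jser m n + cser q"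
  define Mt where "Mt = Jser m n + cser qt"
  define K K' where "K = Kser N a (R s)" and "K' = Kser N (- a) (R s)"
  define Kx where "Kx = (- fls_const (2 * a) / (fls_X_inv - fls_const a)) \<cdot>\<^sub>m cser D"
  define Kx' where "Kx' = (fls_const (2 * a) / (fls_X_inv + fls_const a)) \<cdot>\<^sub>m cser D"
  have cS: "S s \<in> carrier_mat N N" using ord_ge_carrier[OF S(2)] .
  have cM: "M \<in> carrier_mat N N" "Mt \<in> carrier_mat N N" using cE q cqt by (simp_all add: M_def Mt_def)
  have cK: "K \<in> carrier_mat N N" "K' \<in> carrier_mat N N" "Kx \<in> carrier_mat N N" "Kx' \<in> carrier_mat N N"
    using r cD by (simp_all add: K_def K'_def Kx_def Kx'_def)
  have cSx: "Sx \<in> carrier_mat N N" using S(1) by (rule ser_deriv_carrier)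
  have Sx': "Sx = S s * M - M * S s"
  proof (rule eq_matI)
    fix i j assume "i < dim_row (S s * M - M * S s)" "j < dim_col (S s * M - M * S s)"
    hence ij: "i < N" "j < N" using cS cM by auto
    have "(Sx + (M * S s - S s * M)) $$ (i,j) = 0" using Sx ij unfolding M_def by simp
    thus "Sx $$ (i,j) = (S s * M - M * S s) $$ (i,j)"
      using ij cS cM cSx by (simp add: algebra_simps eq_diff_eq diff_eq_eq add_eq_0_iff del: index_mult_mat(1))
  qed (use cSx cS cM in auto)
  show "ser_deriv N S (S s * (Jser m n + cser q) - (Jser m n + cser q) * S s) s"
    using S(1) unfolding Sx' M_def .
  have Mt: "Mt = K * M * K' + K * Kx'"
  proof -
    let ?u = "fls_X_inv :: complex fls" and ?al = "fls_const a"
    let ?cE = "cser ?E" and ?cA = "cser ?A" and ?cR = "cser (R s)" and ?cD = "cser D"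
    note hs = cser_hom(1)[of _ N] cser_hom(2)[of _ N] cser_hom(3)[of _ N] cser_hom(4) cser_hom(5)
    have y1: "(1\<^sub>m N - ?cR) * ((?al \<cdot>\<^sub>m ?cE + ?cA) * ?cR + ?cD) = 0\<^sub>m N N"
      using arg_cong[OF z1', of cser] r(1) cE(1) cA cD
      by (simp add: hs) (simp add: cser_def fls_const.mat_hom_zero)
    have y2: "?cR * ((?cA - ?al \<cdot>\<^sub>m ?cE) * (1\<^sub>m N - ?cR) - ?cD) = 0\<^sub>m N N"
      using arg_cong[OF z2', of cser] r(1) cE(1) cA cD
      by (simp add: hs) (simp add: cser_def fls_const.mat_hom_zero)
    have rr: "?cR * ?cR = ?cR" using r by (simp flip: cser_hom(3))
    have ne: "?u \<noteq> ?al" "?u \<noteq> - ?al" using fls_X_inv_neq_const[of a] fls_X_inv_neq_const[of "- a"] by simp_all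
    have cc: "?cR \<in> carrier_mat N N" "?cE \<in> carrier_mat N N" "?cA \<in> carrier_mat N N" "?cD \<in> carrier_mat N N"
      using r cE cA cD by simp_all
    have Meq: "M = ?u \<cdot>\<^sub>m ?cE + ?cA"
      using Jser_plus_cser[OF q[unfolded N_def]] cc cE q unfolding M_def
      by (simp add: comm_add_mat[of _ N N "fls_X_inv \<cdot>\<^sub>m cser (Emat m n)"])
    have "cser (bmat m n + qt) = ?cA + (2 * ?al) \<cdot>\<^sub>m (?cE * ?cR - ?cR * ?cE)"
    proof -
      have "bmat m n + qt = ?A + (2 * a) \<cdot>\<^sub>m (?E * R s - R s * ?E)"
        unfolding qt using q cE r by (auto intro!: eq_matI simp del: index_mult_mat(1))
      thus ?thesis using q cE r by (simp add: hs del: assoc_add_mat flip: fls_const_mult_const)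
    qed
    hence "Mt = ?u \<cdot>\<^sub>m ?cE + ?cA + (2 * ?al) \<cdot>\<^sub>m (?cE * ?cR - ?cR * ?cE)"
      using Jser_plus_cser[OF cqt[unfolded N_def]] cc cE q cqt unfolding Mt_def
      by (auto intro!: eq_matI simp del: index_mult_mat(1))
    also have "\<dots> = gk N ?al ?cR ?u * M * gk N (- ?al) ?cR ?u + (2 * ?al / (?u + ?al)) \<cdot>\<^sub>m (gk N ?al ?cR ?u * ?cD)"
      unfolding Meq by (rule gauge_linear[symmetric, OF cc N0 rr y1 y2 ne])
    also have "\<dots> = K * M * K' + (fls_const (2 * a) / (?u + ?al)) \<cdot>\<^sub>m (K * ?cD)"
      by (simp add: K_def K'_def Kser_def flip: fls_const_mult_const)
    also have "(fls_const (2 * a) / (?u + ?al)) \<cdot>\<^sub>m (K * ?cD) = K * Kx'"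
      unfolding Kx'_def by (rule mult_smult_distrib[symmetric, OF cK(1) cc(4)])
    finally show ?thesis .
  qed
  have KK: "K * K' = 1\<^sub>m N" "K' * K = 1\<^sub>m N"
    unfolding K_def K'_def using Kser_inverse[OF r N0, of a] Kser_inverse[OF r N0, of "- a"] by simp_all
  have dK: "ser_deriv N (\<lambda>u. Kser N a (R u)) Kx s" unfolding Kx_def by (rule ser_deriv_Kser[OF R(1,2)])
  have dK': "ser_deriv N (\<lambda>u. Kser N (- a) (R u)) Kx' s"
    using ser_deriv_Kser[OF R(1,2), of "- a"] unfolding Kx'_def by simp
  have oK: "\<forall>\<^sub>F u in nhds s. ord_ge N 0 (Kser N b (R u))" for b
    using R(2) by eventually_elim (rule ord_ge_Kser)
  have oS: "\<forall>\<^sub>F u in nhds s. ord_ge N (-1) (S u)" using S(2) by simp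
  have oKS: "\<forall>\<^sub>F u in nhds s. ord_ge N (-1) (Kser N a (R u) * S u)"
    using oK[of a] oS by eventually_elim (use ord_ge_mult[of N 0 _ "-1"] in simp)
  show "\<forall>\<^sub>F u in nhds s. ord_ge N (-1) (St R u)"
    using oKS oK[of "- a"] unfolding St_def by eventually_elim (use ord_ge_mult[of N "-1" _ 0] in simp)
  have KKd: "K * Kx' + Kx * K' = 0\<^sub>m N N"
  proof -
    have "ser_deriv N (\<lambda>u. Kser N a (R u) * Kser N (- a) (R u)) (K * Kx' + Kx * K') s"
      unfolding K_def K'_def by (rule ser_deriv_mult[OF dK oK dK' oK])
    hence "ser_deriv N (\<lambda>u. 1\<^sub>m N) (K * Kx' + Kx * K') s"
      by (rule ser_deriv_cong) (use R(2,3) in \<open>eventually_elim; simp add: Kser_inverse N0\<close>)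
    moreover have "ser_deriv N (\<lambda>u. 1\<^sub>m N) (0\<^sub>m N N) s" by (simp add: ser_deriv_def)
    ultimately show ?thesis by (rule ser_deriv_unique)
  qed
  have "ser_deriv N (St R) (K * S s * Kx' + (K * (S s * M - M * S s) + Kx * S s) * K') s"
    unfolding St_def Sx'[symmetric] K_def K'_def
    by (rule ser_deriv_mult[OF ser_deriv_mult[OF dK oK S(1) oS] oKS dK' oK])
  also have "K * S s * Kx' + (K * (S s * M - M * S s) + Kx * S s) * K'
      = (K * S s * K') * Mt - Mt * (K * S s * K')"
  proof (rule emb_inject[of N])
    have e1: "emb N K' * emb N K = 1" using emb_mult[OF N0 cK(2,1)] KK N0 emb_1 by metis
    have e2: "emb N K * emb N Kx' + emb N Kx * emb N K' = 0"
      using arg_cong[OF KKd, of "emb N"] N0 cK by (simp add: emb_simps)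
    show "emb N (K * S s * Kx' + (K * (S s * M - M * S s) + Kx * S s) * K')
      = emb N ((K * S s * K') * Mt - Mt * (K * S s * K'))"
      unfolding Mt using N0 cK cS cM linop_gauge_lax[OF e1 e2, of "emb N (S s)" "emb N M"]
      by (simp add: emb_mult emb_add emb_diff del: assoc_mult_mat)
  qed (use cK cS cM in simp_all)
  finally show "ser_deriv N (St R) (St R s * (Jser m n + cser qt) - (Jser m n + cser qt) * St R s) s"
    unfolding Mt_def St_def K_def K'_def .
qed

lemma conjugate_pow:
  fixes S :: "'a::comm_ring_1 mat"
  assumes "K \<in> carrier_mat N N" "K' \<in> carrier_mat N N" "S \<in> carrier_mat N N" "K * K' = 1\<^sub>m N" "K' * K = 1\<^sub>m N"
  shows "(K * S * K') ^\<^sub>m k = K * S ^\<^sub>m k * K'"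
  by (rule similar_mat_wit_pow_id) (use assms in \<open>simp add: similar_mat_wit_def Let_def\<close>)

lemma commutator_shift:
  fixes c :: "'a::comm_ring_1"
  assumes "E \<in> carrier_mat N N" "X \<in> carrier_mat N N" "D \<in> carrier_mat N N" "0 < N"
  shows "(X - c \<cdot>\<^sub>m D) * E - E * (X - c \<cdot>\<^sub>m D) = (X * E - E * X) + c \<cdot>\<^sub>m (E * D - D * E)"
  by (rule emb_inject[of N])
     (use assms in \<open>simp_all add: emb_simps sc_central'[of "emb N E"] algebra_simps\<close>)

text \<open>The lambda^0 coefficient of (S^k)' + [b + q + lambda e, S^k] = 0 contains [b + q, S_0]
  and, shifted by lambda, [e, S_-1]. So the right side of the flow equals a commutator with e that
  is free of derivatives.\<close>

lemma lax_flow: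
  fixes m n k :: nat and S :: "real \<Rightarrow> complex fls mat"
  defines "N \<equiv> NN m n"
  assumes q: "q \<in> carrier_mat N N"
    and S: "ser_deriv N S (S s * (Jser m n + cser q) - (Jser m n + cser q) * S s) s"
      "\<forall>\<^sub>F u in nhds s. ord_ge N (-1) (S u)"
  obtains Px where "mat_deriv N (\<lambda>u. ser_coeff (S u ^\<^sub>m k) 0) Px s"
    "Px + ((bmat m n + q) * ser_coeff (S s ^\<^sub>m k) 0 - ser_coeff (S s ^\<^sub>m k) 0 * (bmat m n + q))
      = ser_coeff (S s ^\<^sub>m k) (-1) * Emat m n - Emat m n * ser_coeff (S s ^\<^sub>m k) (-1)"
proof -
  define M where "M = Jser m n + cser q"
  define X where "X = S s ^\<^sub>m k"
  have cM: "M \<in> carrier_mat N N" using q by (simp add: M_def)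
  have cE: "Emat m n \<in> carrier_mat N N" "bmat m n + q \<in> carrier_mat N N" using q by (simp_all add: N_def)
  have cX: "X \<in> carrier_mat N N" unfolding X_def using S(2) eventually_nhds_x_imp_x ord_ge_carrier by force
  have ev: "\<forall>\<^sub>F u in nhds s. S u ^\<^sub>m k \<in> carrier_mat N N" using S(2) by (auto elim!: eventually_mono dest: ord_ge_carrier)
  have d: "mat_deriv N (\<lambda>u. ser_coeff (S u ^\<^sub>m k) 0) (ser_coeff (X * M - M * X) 0) s"
    unfolding X_def
    by (rule mat_deriv_ser_coeff[OF ser_deriv_pow_lax[OF S[folded M_def] cM] ev])
  have c: "ser_coeff (M * X - X * M) 0
    = ((bmat m n + q) * ser_coeff X 0 - ser_coeff X 0 * (bmat m n + q))
      + (Emat m n * ser_coeff X (-1) - ser_coeff X (-1) * Emat m n)"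
    unfolding M_def Jser_plus_cser[OF q[unfolded N_def]]
    using ser_coeff_commutator[OF cX cE(2,1), of 0] by simp
  show ?thesis
  proof (rule that[OF d], fold X_def, rule eq_matI)
    fix i j assume "i < dim_row (ser_coeff X (-1) * Emat m n - Emat m n * ser_coeff X (-1))"
      "j < dim_col (ser_coeff X (-1) * Emat m n - Emat m n * ser_coeff X (-1))"
    hence ij: "i < N" "j < N" using cX cE by auto
    show "(ser_coeff (X * M - M * X) 0 + ((bmat m n + q) * ser_coeff X 0 - ser_coeff X 0 * (bmat m n + q))) $$ (i,j)
      = (ser_coeff X (-1) * Emat m n - Emat m n * ser_coeff X (-1)) $$ (i,j)"
      using arg_cong[OF c, of "\<lambda>A. A $$ (i,j)"] ij cX cM carrier_matD[OF cE(1)] carrier_matD[OF cE(2)]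
      by (simp del: index_mult_mat(1) index_add_mat(2,3)) (simp add: algebra_simps del: index_mult_mat(1))
  qed (use cX cM carrier_matD[OF cE(1)] carrier_matD[OF cE(2)] in auto)
qed

section \<open>Assembly at a point of the neighborhood\<close>

lemma eventually_nhds_slice:
  assumes "open U" "(x,t) \<in> U"
  shows "\<forall>\<^sub>F u in nhds x. (u,t) \<in> U" "\<forall>\<^sub>F u in nhds t. (x,u) \<in> U"
proof -
  have "((\<lambda>u. (u,t)) \<longlongrightarrow> (x,t)) (nhds x)" "((\<lambda>u. (x,u)) \<longlongrightarrow> (x,t)) (nhds t)"
    by (intro tendsto_Pair tendsto_ident_at filterlim_ident tendsto_const)+
  thus "\<forall>\<^sub>F u in nhds x. (u,t) \<in> U" "\<forall>\<^sub>F u in nhds t. (x,u) \<in> U"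
    using assms by (auto dest: topological_tendstoD)
qed

text \<open>The claim concerns one point, but the derivatives along the coordinate lines need the
  projection nearby, hence the open set. The values a and -a are left out as the poles of k and of
  its inverse.\<close>

lemma dressed_solution_at:
  fixes m n j :: nat and a :: complex
  defines "N \<equiv> NN m n"
  defines "qt \<equiv> \<lambda>q Pt x t. q x t + (2 * a) \<cdot>\<^sub>m (Emat m n * Pt x t - Pt x t * Emat m n)"
    and "St \<equiv> \<lambda>S Pt x t. Kser N a (Pt x t) * S x t * Kser N (- a) (Pt x t)"
    and "Ft \<equiv> \<lambda>F P Pt x t lam. kmat N a P lam * F x t lam * minv (kmat N a (Pt x t) lam)"
  assumes fl: "flow_sol m n j q S UNIV"
    and fr: "is_frame m n j q S F UNIV UNIV"
    and P: "Oproj m n P (mat_image P)"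
    and a: "a \<noteq> 0"
    and U: "open Uo" "(x,t) \<in> Uo"
    and Pt: "\<forall>(x,t)\<in>Uo. Oproj m n (Pt x t) {w \<in> carrier_vec (NN m n). F x t a *\<^sub>v w \<in> mat_image P}"
  shows "flow_sol m n j (qt q Pt) (St S Pt) {(x,t)} \<and> is_frame m n j (qt q Pt) (St S Pt) (Ft F P Pt) {(x,t)} (- {a, - a})"
proof -
  have N0: "0 < N" by (simp add: N_def)
  define k where "k = 2 * j - 1"
  have P: "P \<in> carrier_mat N N" "P * P = P" "sharp m n P = P" using P by (simp_all add: Oproj_def N_def)
  have F: "F x t z \<in> carrier_mat N N" "det (F x t z) = 1" "sigma m n (F x t (- z)) = F x t z"
    "\<exists>F'. mat_deriv N (\<lambda>u. F u t z) F' x \<and> minv (F x t z) * F' = Jmat m n z + q x t"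
    "\<exists>F'. mat_deriv N (\<lambda>u. F x u z) F' t \<and> minv (F x t z) * F' = ser_pos_eval (S x t ^\<^sub>m k) z" for x t z
    using fr unfolding is_frame_def N_def k_def by auto
  have fl': "q x t \<in> Ymn m n" "\<exists>g \<in> GGrp_minus m n. S x t = g * Jser m n * minv g"
    "\<exists>Sx. ser_deriv N (\<lambda>s. S s t) Sx x \<and>
        Sx + ((Jser m n + cser (q x t)) * S x t - S x t * (Jser m n + cser (q x t))) = 0\<^sub>m N N"
    "\<exists>qt Px. mat_deriv N (\<lambda>s. q x s) qt t \<and> mat_deriv N (\<lambda>s. ser_coeff (S s t ^\<^sub>m k) 0) Px x \<and>
        qt = Px + ((bmat m n + q x t) * ser_coeff (S x t ^\<^sub>m k) 0 - ser_coeff (S x t ^\<^sub>m k) 0 * (bmat m n + q x t))" for x t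
    using fl unfolding flow_sol_def N_def k_def by auto
  have cq: "q x t \<in> carrier_mat N N" for x t unfolding N_def by (rule Ymn_carrier[OF fl'(1)])
  have oS: "ord_ge N (-1) (S x t)" for x t using fl'(2)[of x t] ord_ge_conjugate unfolding N_def by auto
  define R where "R = Pt x t"
  have Oxt: "Oproj m n R {w \<in> carrier_vec (NN m n). F x t a *\<^sub>v w \<in> mat_image P}" using Pt U(2) by (auto simp: R_def)
  have R: "R \<in> carrier_mat N N" "R * R = R" "sharp m n R = R" using Oxt by (auto simp: Oproj_def N_def)
  note slice = eventually_nhds_slice[OF U]
  have ex: "\<forall>\<^sub>F u in nhds x. Oproj m n (Pt u t) {w \<in> carrier_vec (NN m n). F u t a *\<^sub>v w \<in> mat_image P}"
    using slice(1) Pt by (auto elim!: eventually_mono)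
  have et: "\<forall>\<^sub>F u in nhds t. Oproj m n (Pt x u) {w \<in> carrier_vec (NN m n). F x u a *\<^sub>v w \<in> mat_image P}"
    using slice(2) Pt by (auto elim!: eventually_mono)
  have ex': "\<forall>\<^sub>F u in nhds x. Pt u t \<in> carrier_mat N N" "\<forall>\<^sub>F u in nhds x. Pt u t * Pt u t = Pt u t"
    and et': "\<forall>\<^sub>F u in nhds t. Pt x u \<in> carrier_mat N N"
    using ex et by (auto simp: Oproj_def N_def elim!: eventually_mono)
  obtain Dx where Dx: "mat_deriv N (\<lambda>u. Pt u t) Dx x"
    "(1\<^sub>m N - R) * ((Jmat m n a + q x t) * R + Dx) = 0\<^sub>m N N"
    "R * ((Jmat m n (- a) + q x t) * (1\<^sub>m N - R) - Dx) = 0\<^sub>m N N"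
    "\<And>z. z \<noteq> a \<Longrightarrow> z \<noteq> - a \<Longrightarrow> \<exists>F'. mat_deriv N (\<lambda>u. kmat N a P z * F u t z * minv (kmat N a (Pt u t) z)) F' x \<and>
      minv (kmat N a P z * F x t z * minv (kmat N a R z)) * F'
      = gk N a R z * (Jmat m n z + q x t) * gk N (- a) R z + (2 * a / (z + a)) \<cdot>\<^sub>m (gk N a R z * Dx)"
    unfolding R_def N_def
    by (rule frame_line[where F = "\<lambda>u z. F u t z" and s = x and B = "\<lambda>z. Jmat m n z + q x t"
          and R = "\<lambda>u. Pt u t" and a = a and P = P and m = m and n = n])
       (use F(1-4) P ex in \<open>simp_all add: N_def\<close>)
  define X where "X = S x t ^\<^sub>m k"
  obtain Dt where Dt: "mat_deriv N (\<lambda>u. Pt x u) Dt t"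
    "(1\<^sub>m N - R) * (ser_pos_eval X a * R + Dt) = 0\<^sub>m N N"
    "R * (ser_pos_eval X (- a) * (1\<^sub>m N - R) - Dt) = 0\<^sub>m N N"
    "\<And>z. z \<noteq> a \<Longrightarrow> z \<noteq> - a \<Longrightarrow> \<exists>F'. mat_deriv N (\<lambda>u. kmat N a P z * F x u z * minv (kmat N a (Pt x u) z)) F' t \<and>
      minv (kmat N a P z * F x t z * minv (kmat N a R z)) * F'
      = gk N a R z * ser_pos_eval X z * gk N (- a) R z + (2 * a / (z + a)) \<cdot>\<^sub>m (gk N a R z * Dt)"
    unfolding R_def N_def X_def
    by (rule frame_line[where F = "\<lambda>u z. F x u z" and s = t and B = "\<lambda>z. ser_pos_eval (S x t ^\<^sub>m k) z"
          and R = "\<lambda>u. Pt x u" and a = a and P = P and m = m and n = n])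
       (use F(1-3,5) P et in \<open>simp_all add: N_def\<close>)
  define Q where "Q = q x t + (2 * a) \<cdot>\<^sub>m (Emat m n * R - R * Emat m n)"
  define K K' where "K = Kser N a R" and "K' = Kser N (- a) R"
  have qtQ: "qt q Pt x t = Q" and StK: "St S Pt x t = K * S x t * K'"
    by (simp_all add: qt_def St_def Q_def R_def K_def K'_def)
  have QY: "Q \<in> Ymn m n" unfolding Q_def
    by (rule Ymn_dress[OF fl'(1) R(1)[unfolded N_def] R(3)])
  have cQ: "Q \<in> carrier_mat N N" unfolding N_def by (rule Ymn_carrier[OF QY])
  obtain Sx where Sx: "ser_deriv N (\<lambda>s. S s t) Sx x"
    "Sx + ((Jser m n + cser (q x t)) * S x t - S x t * (Jser m n + cser (q x t))) = 0\<^sub>m N N"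
    using fl'(3) by blast
  note lax = lax_dressed[OF cq[unfolded N_def] Sx(1)[unfolded N_def] oS[unfolded N_def] Sx(2)[unfolded N_def]
      Dx(1)[unfolded N_def] ex'[unfolded N_def] Dx(2,3)[unfolded R_def N_def] Q_def[unfolded R_def], folded N_def]
  have lS: "ser_deriv N (\<lambda>u. S u t) (S x t * (Jser m n + cser (q x t)) - (Jser m n + cser (q x t)) * S x t) x"
    by (rule lax(1))
  have lSt: "ser_deriv N (\<lambda>u. St S Pt u t) (St S Pt x t * (Jser m n + cser Q) - (Jser m n + cser Q) * St S Pt x t) x"
    "\<forall>\<^sub>F u in nhds x. ord_ge N (-1) (St S Pt u t)"
    unfolding St_def by (rule lax(2,3))+
  have cS: "S x t \<in> carrier_mat N N" and cK: "K \<in> carrier_mat N N" "K' \<in> carrier_mat N N"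
    using ord_ge_carrier[OF oS] R(1) by (simp_all add: K_def K'_def)
  have KK: "K * K' = 1\<^sub>m N" "K' * K = 1\<^sub>m N"
    unfolding K_def K'_def using Kser_inverse[OF R(1,2) N0, of a] Kser_inverse[OF R(1,2) N0, of "- a"] by simp_all
  have cX: "X \<in> carrier_mat N N" using cS by (simp add: X_def)
  have Stk: "St S Pt x t ^\<^sub>m k = K * X * K'"
    unfolding StK X_def by (rule conjugate_pow[OF cK cS KK])
  have cB: "map_mat pospart X \<in> carrier_mat N N" using cX by simp
  have evB: "map_mat (\<lambda>p. poly p z) (map_mat pospart X) = ser_pos_eval X z" for z
    by (rule ser_pos_eval_eq[symmetric, OF cB cX ord_ge_pospart[OF cX]])
  have cDt: "Dt \<in> carrier_mat N N" using Dt(1) by (rule mat_deriv_carrier)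
  \<comment> \<open>In the t-direction \<open>B\<close> is the polynomial part of X = S^k, whose
    value at each number is the logarithmic derivative of the given frame.\<close>
  note dr = dressing[OF R(1) cB cDt N0 a R(2) _ _ cX ord_ge_pospart[OF cX], unfolded evB, OF Dt(2,3), folded K_def K'_def]
  have cE: "Emat m n \<in> carrier_mat N N" by (simp add: N_def)
  have evol: "\<exists>qt' Px. mat_deriv N (\<lambda>s. qt q Pt x s) qt' t \<and>
        mat_deriv N (\<lambda>s. ser_coeff (St S Pt s t ^\<^sub>m k) 0) Px x \<and>
        qt' = Px + ((bmat m n + Q) * ser_coeff (St S Pt x t ^\<^sub>m k) 0 - ser_coeff (St S Pt x t ^\<^sub>m k) 0 * (bmat m n + Q))"
  proof -
    obtain q' Px where q': "mat_deriv N (\<lambda>s. q x s) q' t" "mat_deriv N (\<lambda>s. ser_coeff (S s t ^\<^sub>m k) 0) Px x"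
        "q' = Px + ((bmat m n + q x t) * ser_coeff X 0 - ser_coeff X 0 * (bmat m n + q x t))"
      using fl'(4) unfolding X_def by blast
    have ev: "\<forall>\<^sub>F u in nhds x. ord_ge N (-1) (S u t)" using oS by simp
    obtain Px0 where Px0: "mat_deriv N (\<lambda>u. ser_coeff (S u t ^\<^sub>m k) 0) Px0 x"
      "Px0 + ((bmat m n + q x t) * ser_coeff X 0 - ser_coeff X 0 * (bmat m n + q x t))
      = ser_coeff X (-1) * Emat m n - Emat m n * ser_coeff X (-1)"
      unfolding X_def
      by (rule lax_flow[OF cq[unfolded N_def] lS[unfolded N_def] ev[unfolded N_def], folded N_def])
    \<comment> \<open>Both are derivatives of the same function; their equality turns the given
      evolution of q into q_t = [X_-1, e].\<close>
    have "Px = Px0" using q'(2) Px0(1) by (rule mat_deriv_unique)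
    hence q'': "q' = ser_coeff X (-1) * Emat m n - Emat m n * ser_coeff X (-1)" using q'(3) Px0(2) by simp
    obtain Px1 where Px1: "mat_deriv N (\<lambda>u. ser_coeff (St S Pt u t ^\<^sub>m k) 0) Px1 x"
      "Px1 + ((bmat m n + Q) * ser_coeff (St S Pt x t ^\<^sub>m k) 0 - ser_coeff (St S Pt x t ^\<^sub>m k) 0 * (bmat m n + Q))
      = ser_coeff (St S Pt x t ^\<^sub>m k) (-1) * Emat m n - Emat m n * ser_coeff (St S Pt x t ^\<^sub>m k) (-1)"
      by (rule lax_flow[OF cQ[unfolded N_def] lSt[unfolded N_def], folded N_def])
    have ev1: "\<forall>\<^sub>F u in nhds t. Emat m n \<in> carrier_mat N N" using cE by simp
    have ev2: "\<forall>\<^sub>F u in nhds t. Pt x u * Emat m n \<in> carrier_mat N N"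
      "\<forall>\<^sub>F u in nhds t. Emat m n * Pt x u - Pt x u * Emat m n \<in> carrier_mat N N"
      "\<forall>\<^sub>F u in nhds t. (2 * a) \<cdot>\<^sub>m (Emat m n * Pt x u - Pt x u * Emat m n) \<in> carrier_mat N N"
      using et' cE by (auto elim!: eventually_mono)
    define W where "W = (2 * a) \<cdot>\<^sub>m ((Emat m n * Dt + 0\<^sub>m N N * Pt x t) - (Pt x t * 0\<^sub>m N N + Dt * Emat m n))"
    have W: "W = (2 * a) \<cdot>\<^sub>m (Emat m n * Dt - Dt * Emat m n)"
      unfolding W_def using cE cDt R(1)
      by (simp add: R_def left_mult_zero_mat[of _ N N] right_mult_zero_mat[of _ N N] left_add_zero_mat[of _ N N] right_add_zero_mat[of _ N N])
    have "mat_deriv N (\<lambda>s. qt q Pt x s) (q' + W) t"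
      unfolding qt_def W_def
      by (rule mat_deriv_add[OF q'(1) mat_deriv_smult[OF mat_deriv_minus[OF
            mat_deriv_mult[OF mat_deriv_const ev1 Dt(1) et'] mat_deriv_mult[OF Dt(1) et' mat_deriv_const ev1] ev2(1)] ev2(2)] ev2(3)])
    \<comment> \<open>Shifting the lambda^-1 coefficient by -2a Dt changes its commutator with e by
      2a [e, Dt], which is \<open>W\<close>, the t-derivative of the correction to q.\<close>
    moreover have "q' + W = Px1 + ((bmat m n + Q) * ser_coeff (St S Pt x t ^\<^sub>m k) 0
        - ser_coeff (St S Pt x t ^\<^sub>m k) 0 * (bmat m n + Q))"
      unfolding Px1(2) unfolding Stk dr(2) W q''
      by (rule commutator_shift[symmetric]) (use cE cX cDt N0 in simp_all)
    ultimately show ?thesis using Px1(1) by blast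
  qed
  have flow: "flow_sol m n j (qt q Pt) (St S Pt) {(x,t)}"
  proof -
    obtain g where g: "g \<in> GGrp_minus m n" "S x t = g * Jser m n * minv g" using fl'(2) by blast
    have "St S Pt x t = Kser N a R * g * Jser m n * minv (Kser N a R * g)"
      unfolding StK K_def K'_def g(2) N_def by (rule conjugate_dress[OF g(1) R(1,2)[unfolded N_def]])
    moreover have "Kser N a R * g \<in> GGrp_minus m n"
      unfolding N_def by (rule GGrp_minus_dress[OF g(1) R[unfolded N_def]])
    ultimately have 1: "\<exists>g \<in> GGrp_minus m n. St S Pt x t = g * Jser m n * minv g" by blast
    have cSt: "St S Pt x t \<in> carrier_mat N N" unfolding StK using cK cS by simp
    have cancel: "A - B + (B - A) = 0\<^sub>m N N" if "A \<in> carrier_mat N N" "B \<in> carrier_mat N N"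
      for A B :: "complex fls mat"
      using that by (intro eq_matI) auto
    have cJQ: "Jser m n + cser Q \<in> carrier_mat N N" using cQ by simp
    have "St S Pt x t * (Jser m n + cser Q) - (Jser m n + cser Q) * St S Pt x t
        + ((Jser m n + cser Q) * St S Pt x t - St S Pt x t * (Jser m n + cser Q)) = 0\<^sub>m N N"
      by (rule cancel) (use cSt cJQ in simp_all)
    hence 2: "\<exists>Sx. ser_deriv N (\<lambda>s. St S Pt s t) Sx x \<and>
        Sx + ((Jser m n + cser Q) * St S Pt x t - St S Pt x t * (Jser m n + cser Q)) = 0\<^sub>m N N"
      using lSt(1) by blast
    show ?thesis
      using QY cSt 1 2 evol unfolding flow_sol_def by (simp add: qtQ N_def k_def)
  qed
  have frame: "is_frame m n j (qt q Pt) (St S Pt) (Ft F P Pt) {(x,t)} (- {a, - a})"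
    unfolding is_frame_def
  proof (intro allI impI)
    fix x' t' z assume "(x',t') \<in> {(x,t)}" "z \<in> - {a, - a}"
    hence xt: "x' = x" "t' = t" and z: "z \<noteq> a" "z \<noteq> - a" by auto
    note alg = dressed_frame_algebra[OF F(1)[unfolded N_def] F(2,3) P[unfolded N_def] Oxt z, folded N_def]
    have mk: "minv (kmat N a R z) = gk N (- a) R z"
      unfolding kmat_eq_gk by (rule minv_gk[OF R(1,2) z N0])
    have c: "Ft F P Pt x t z \<in> carrier_mat N N"
      unfolding Ft_def R_def[symmetric] mk using P(1) F(1) R(1) by (simp add: kmat_eq_gk)
    have x: "\<exists>F'. mat_deriv N (\<lambda>s. Ft F P Pt s t z) F' x \<and> minv (Ft F P Pt x t z) * F' = Jmat m n z + Q"
      using Dx(4)[OF z] lax(4)[OF z] unfolding Ft_def R_def by simp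
    have t: "\<exists>F'. mat_deriv N (\<lambda>s. Ft F P Pt x s z) F' t \<and> minv (Ft F P Pt x t z) * F' = ser_pos_eval (St S Pt x t ^\<^sub>m k) z"
      using Dt(4)[OF z] dr(1)[OF z] unfolding Stk Ft_def R_def by simp
    have "det (Ft F P Pt x t z) = 1" "sigma m n (Ft F P Pt x t (- z)) = Ft F P Pt x t z"
      using alg unfolding Ft_def R_def by simp_all
    thus "Ft F P Pt x' t' z \<in> carrier_mat (NN m n) (NN m n) \<and> det (Ft F P Pt x' t' z) = 1 \<and>
     (\<exists>Fx. mat_deriv (NN m n) (\<lambda>s. Ft F P Pt s t' z) Fx x' \<and>
        minv (Ft F P Pt x' t' z) * Fx = Jmat m n z + qt q Pt x' t') \<and>
     (\<exists>Ft'. mat_deriv (NN m n) (\<lambda>s. Ft F P Pt x' s z) Ft' t' \<and>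
        minv (Ft F P Pt x' t' z) * Ft' = ser_pos_eval (St S Pt x' t' ^\<^sub>m (2*j-1)) z) \<and>
     sigma m n (Ft F P Pt x' t' (- z)) = Ft F P Pt x' t' z"
      using c x t unfolding xt qtQ N_def k_def by blast
  qed
  show ?thesis using flow frame by blast
qed

theorem mainTheorem5:
  fixes m n j :: nat
    and q :: "real \<Rightarrow> real \<Rightarrow> complex mat"
    and S :: "real \<Rightarrow> real \<Rightarrow> complex fls mat"
    and F :: "real \<Rightarrow> real \<Rightarrow> complex \<Rightarrow> complex mat"
    and P :: "complex mat" and a :: complex
    and Uo :: "(real \<times> real) set"
    and Pt :: "real \<Rightarrow> real \<Rightarrow> complex mat"
  assumes "j \<ge> 1"
    and "flow_sol m n j q S UNIV"
    and "is_frame m n j q S F UNIV UNIV"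
    and "Oproj m n P (mat_image P)"
    and "a \<noteq> 0"
    and "open Uo" and "(0,0) \<in> Uo"
    and "\<forall>(x,t)\<in>Uo. nondeg m n {w \<in> carrier_vec (NN m n). F x t a *\<^sub>v w \<in> mat_image P}"
    and "\<forall>(x,t)\<in>Uo. Oproj m n (Pt x t) {w \<in> carrier_vec (NN m n). F x t a *\<^sub>v w \<in> mat_image P}"
  shows "\<exists>St. flow_sol m n j (\<lambda>x t. q x t + (2 * a) \<cdot>\<^sub>m (Emat m n * Pt x t - Pt x t * Emat m n)) St Uo
           \<and> is_frame m n j (\<lambda>x t. q x t + (2 * a) \<cdot>\<^sub>m (Emat m n * Pt x t - Pt x t * Emat m n)) St
               (\<lambda>x t lam. kmat (NN m n) a P lam * F x t lam * minv (kmat (NN m n) a (Pt x t) lam))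
               Uo (- {a, - a})"
proof -
  note at = dressed_solution_at[OF assms(2-6) _ assms(9)]
  have flow: "flow_sol m n j Q T U" if "\<And>x t. (x,t) \<in> U \<Longrightarrow> flow_sol m n j Q T {(x,t)}" for Q T U
    using that unfolding flow_sol_def by blast
  have frame: "is_frame m n j Q T G U L" if "\<And>x t. (x,t) \<in> U \<Longrightarrow> is_frame m n j Q T G {(x,t)} L" for Q T G U L
    using that unfolding is_frame_def by blast
  show ?thesis
    \<comment> \<open>The witness stays schematic at \<open>exI\<close> and is fixed by the first
      resolution with \<open>at\<close>; as it cannot depend on the bound point, one function K S
      K^-1 serves all of \<open>Uo\<close>.\<close>
    by (rule exI, rule conjI, (rule flow, rule conjunct1[OF at], assumption),
        (rule frame, rule conjunct2[OF at], assumption))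
qed

end
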